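(* Let $f$ be a multiplicative function resembling the Möbius function. Assume that for some real non-principal Dirichlet character $\chi$ and some constant $c>0$, $$\sum_{p\leq x}|1-f(p)\chi(p)|\ll \frac{\sqrt{x}}{\exp(c\sqrt{\log x})},$$ where the sum runs over primes $p\leq x$. Then there exists $\lambda>0$ such that $$M_f(x)\ll \frac{\sqrt{x}}{\exp(\lambda(\log x)^{1/4})}.$$
   Context: A function $f:\mathbb{N}\to\mathbb{C}$ resembles the Möbius function if $f$ is multiplicative, supported on the squarefree integers, and $f(p)\in\{+1,-1\}$ for every prime $p$. $M_f(x):=\sum_{n\leq x}f(n)$. $F(x)\ll G(x)$ means there is a constant $C>0$ with $|F(x)|\leq C|G(x)|$ for all large $x$. *)

theory Defs
  imports
    Complex_Main
    "HOL-Computational_Algebra.Squarefree"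
    "HOL-Library.Landau_Symbols"
begin

text \<open>Arithmetic functions live on the positive integers; their value at \<^term>\<open>0::nat\<close> is
  left unconstrained.\<close>

definition multiplicative_fun :: "(nat \<Rightarrow> complex) \<Rightarrow> bool" where
  "multiplicative_fun f \<longleftrightarrow>
     f 1 = 1 \<and> (\<forall>m n. m > 0 \<longrightarrow> n > 0 \<longrightarrow> coprime m n \<longrightarrow> f (m * n) = f m * f n)"

definition resembles_moebius :: "(nat \<Rightarrow> complex) \<Rightarrow> bool" where
  "resembles_moebius f \<longleftrightarrow>
     multiplicative_fun f \<and>
     (\<forall>n>0. \<not> squarefree n \<longrightarrow> f n = 0) \<and>
     (\<forall>p. prime p \<longrightarrow> f p \<in> {1, -1})"

definition summatory :: "(nat \<Rightarrow> complex) \<Rightarrow> real \<Rightarrow> complex" where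
  "summatory f x = (\<Sum>n | n > 0 \<and> real n \<le> x. f n)"

definition dirichlet_character :: "nat \<Rightarrow> (nat \<Rightarrow> complex) \<Rightarrow> bool" where
  "dirichlet_character q \<chi> \<longleftrightarrow>
     q > 0 \<and>
     \<chi> 1 = 1 \<and>
     (\<forall>m n. \<chi> (m * n) = \<chi> m * \<chi> n) \<and>
     (\<forall>n. \<chi> (n + q) = \<chi> n) \<and>
     (\<forall>n. \<chi> n = 0 \<longleftrightarrow> \<not> coprime n q)"

definition principal_character :: "nat \<Rightarrow> nat \<Rightarrow> complex" where
  "principal_character q n = (if coprime n q then 1 else 0)"

end

theory Submission
  imports
    Defs
    "HOL-Complex_Analysis.Complex_Analysis"
    "HOL-Number_Theory.Number_Theory"
begin

text \<open>
  Write \<open>M\<^sub>f\<close> for the summatory function and let \<open>f\<^sub>p\<close> be \<open>f\<close> with its value at the prime \<open>p\<close> replaced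
  by \<open>0\<close>. Then \<open>M\<^sub>f(x) = M(x) + f(p) M(x/p)\<close> with \<open>M = M\<^sub>f\<^sub>p\<close>, so a bound \<open>|M\<^sub>f| \<le> K W\<close> with
  \<open>W(x/p) \<le> \<theta>\<^sub>p W(x)\<close> survives a change of \<open>f(p)\<close> at the cost of a factor \<open>(1 + \<theta>\<^sub>p) / (1 - \<theta>\<^sub>p)\<close>. For
  \<open>W(x) = \<surd>x exp(-\<lambda>\<surd>(log x))\<close> the sum of \<open>\<theta>\<^sub>p\<close> over the primes with \<open>f(p) \<noteq> \<chi>(p)\<close> converges by
  hypothesis, which leaves the function \<open>\<mu>\<^sup>2\<chi>\<close>. Its summatory function is the sum of \<open>\<mu>(d)\<chi>(d)\<^sup>2\<chi>(m)\<close>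
  over \<open>d\<^sup>2m \<le> x\<close>; since the partial sums of \<open>\<chi>\<close> are bounded, the hyperbola method reduces it to
  \<open>M\<^sub>\<mu>(x) = O(x exp(-c\<surd>(log x)))\<close>. This follows from the classical zero-free region, proved by Landau's
  local method, and from Newman's contour argument with the contour pushed into that region. The
  argument gives the exponent \<open>1/2\<close> of the logarithm instead of \<open>1/4\<close>.
\<close>

text \<open>The syntax of vectors makes \<open>\<chi>\<close> a binder.\<close>

unbundle no vec_syntax

section \<open>Changing a squarefree-supported function at one prime\<close>

text \<open>The L-function of \<chi> is never studied. The Dirichlet series attached to the
  squarefree part of \<chi> is L(s, \<chi>) / zeta(2s) up to factors at the primes dividing q; the
  numerator enters only through the bounded partial sums of \<chi>, and the denominator only through
  the zero-free region of zeta near Re 2s = 1. This is the origin of sqrt x, and it explains why a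
  possible exceptional real zero of L(s, \<chi>) does no harm. A prime dividing q counts as
  exceptional, since \<chi> vanishes there while f does not. The exceptional set may be infinite,
  but the summatory function at X sees only its part up to X; it is therefore enough to change
  finitely many primes with a total factor that does not depend on X. Newman's argument is run for
  the sum of \<open>mu n / n\<close>, because the trivial bound for its tails and partial sums has
  exactly the form that the kernel can absorb.\<close>

definition sqf_mult :: "(nat \<Rightarrow> complex) \<Rightarrow> nat \<Rightarrow> complex" where
  "sqf_mult a n = (if squarefree n then \<Prod>p\<in>prime_factors n. a p else 0)"

lemma sqf_mult_0 [simp]: "sqf_mult a 0 = 0"
  by (simp add: sqf_mult_def)

lemma sqf_mult_1 [simp]: "sqf_mult a (Suc 0) = 1"
  by (simp add: sqf_mult_def)

lemma norm_sqf_mult_le: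
  assumes "\<And>p. norm (a p) \<le> 1"
  shows "norm (sqf_mult a n) \<le> 1"
  using assms by (auto simp: sqf_mult_def prod_norm[symmetric] intro!: prod_le_1)

lemma sqf_mult_prime_mult:
  assumes "prime p" "\<not> p dvd m"
  shows "sqf_mult a (p * m) = a p * sqf_mult a m"
proof -
  have cop: "coprime p m" using assms by (simp add: prime_imp_coprime_nat)
  have m: "m \<noteq> 0" using assms by (metis dvd_0_right)
  have sq: "squarefree (p * m) \<longleftrightarrow> squarefree m"
    using squarefree_mult_coprime[OF cop] squarefree_prime[OF assms(1)]
      squarefree_mono[of m "p * m"] by auto
  have pf: "prime_factors (p * m) = insert p (prime_factors m)"
    using assms m by (simp add: prime_factors_product prime_prime_factors)
  have "p \<notin> prime_factors m" using assms by auto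
  then show ?thesis by (simp add: sqf_mult_def sq pf)
qed

lemma sqf_mult_prime_sq_dvd:
  assumes "prime p" "p dvd m"
  shows "sqf_mult a (p * m) = 0"
proof -
  have "p\<^sup>2 dvd p * m" using assms by (simp add: power2_eq_square)
  moreover have "\<not> is_unit p" using assms by auto
  ultimately have "\<not> squarefree (p * m)" by (meson squarefreeD)
  then show ?thesis by (simp add: sqf_mult_def)
qed

lemma sqf_mult_fun_upd_0:
  assumes "prime p"
  shows "sqf_mult (a(p := 0)) n = (if p dvd n then 0 else sqf_mult a n)"
proof (cases "p dvd n")
  case True
  then have "p \<in> prime_factors n" if "squarefree n"
    using assms that by (metis in_prime_factors_iff not_squarefree_0)
  with True show ?thesis by (auto simp: sqf_mult_def)
next
  case False
  then have "p \<notin> prime_factors n" by auto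
  with False show ?thesis
    unfolding sqf_mult_def by (auto intro!: prod.cong)
qed

lemma finite_pos_le_real [simp, intro]: "finite {n::nat. n > 0 \<and> real n \<le> x}"
  by (rule finite_subset[of _ "{..nat \<lfloor>x\<rfloor>}"]) (auto simp: le_nat_floor)

lemma summatory_eq_0: "x < 1 \<Longrightarrow> summatory f x = 0"
  unfolding summatory_def by (intro sum.neutral) auto

lemma summatory_sqf_mult_prime:
  assumes p: "prime p"
  shows "summatory (sqf_mult a) x =
    summatory (sqf_mult (a(p := 0))) x + a p * summatory (sqf_mult (a(p := 0))) (x / real p)"
proof -
  let ?A = "{n::nat. n > 0 \<and> real n \<le> x}" and ?B = "{n::nat. n > 0 \<and> real n \<le> x / real p}"
  have p0: "p > 0" using p by (simp add: prime_gt_0_nat)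
  have "summatory (sqf_mult a) x
      = (\<Sum>n\<in>{n\<in>?A. \<not> p dvd n}. sqf_mult a n) + (\<Sum>n\<in>{n\<in>?A. p dvd n}. sqf_mult a n)"
    unfolding summatory_def
    by (subst sum.union_disjoint[symmetric])
      (auto intro!: sum.cong intro: finite_subset[OF _ finite_pos_le_real])
  also have "(\<Sum>n\<in>{n\<in>?A. \<not> p dvd n}. sqf_mult a n) = summatory (sqf_mult (a(p := 0))) x"
    unfolding summatory_def sqf_mult_fun_upd_0[OF p]
    by (rule sum.mono_neutral_cong_left) auto
  also have "{n\<in>?A. p dvd n} = (\<lambda>m. p * m) ` ?B"
    using p0 by (auto simp: field_simps elim!: dvdE)
  also have "(\<Sum>n\<in>(\<lambda>m. p * m) ` ?B. sqf_mult a n) = (\<Sum>m\<in>?B. sqf_mult a (p * m))"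
    by (subst sum.reindex) (use p0 in \<open>auto simp: inj_on_def\<close>)
  also have "\<dots> = (\<Sum>m\<in>?B. a p * sqf_mult (a(p := 0)) m)"
    by (intro sum.cong refl)
      (auto simp: sqf_mult_fun_upd_0[OF p] sqf_mult_prime_sq_dvd[OF p] sqf_mult_prime_mult[OF p])
  finally show ?thesis unfolding summatory_def sum_distrib_left .
qed

text \<open>Solving M_f(x) = M(x) + f(p) M(x/p) for M gives a recursion from x to x/p. The constant
  K / (1 - \<theta>) is the fixed point of K' = K + \<theta> K', so the bound reproduces
  itself.\<close>

lemma summatory_sqf_mult_fun_upd_0_le:
  assumes p: "prime p" and a: "norm (a p) \<le> 1"
    and \<theta>: "0 \<le> \<theta>" "\<theta> < 1" and K: "K \<ge> 0" and W: "\<And>x. x \<ge> 1 \<Longrightarrow> W x \<ge> 0"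
    and W\<theta>: "\<And>x. x \<ge> real p \<Longrightarrow> W (x / real p) \<le> \<theta> * W x"
    and bd: "\<And>x. x \<ge> 1 \<Longrightarrow> norm (summatory (sqf_mult a) x) \<le> K * W x"
    and x: "x \<ge> 1"
  shows "norm (summatory (sqf_mult (a(p := 0))) x) \<le> K / (1 - \<theta>) * W x"
  using x
proof (induction "nat \<lfloor>x\<rfloor>" arbitrary: x rule: less_induct)
  case less
  let ?M = "summatory (sqf_mult (a(p := 0)))"
  have p2: "real p \<ge> 2" using prime_ge_2_nat[OF p] by simp
  have tail: "norm (?M (x / real p)) \<le> K / (1 - \<theta>) * (\<theta> * W x)"
  proof (cases "x \<ge> real p")
    case True
    \<comment> \<open>The induction runs over the integer part of x; p >= 2 and x >= p make it drop
      by at least 1.\<close>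
    have "x / real p \<le> x / 2" using p2 less.prems by (intro divide_left_mono) auto
    also have "x / 2 \<le> x - 1" using True p2 by simp
    finally have "\<lfloor>x / real p\<rfloor> \<le> \<lfloor>x\<rfloor> - 1" using floor_mono by fastforce
    then have "nat \<lfloor>x / real p\<rfloor> < nat \<lfloor>x\<rfloor>"
      using less.prems by (simp add: nat_less_iff)
    moreover have "x / real p \<ge> 1" using True p2 by simp
    ultimately have "norm (?M (x / real p)) \<le> K / (1 - \<theta>) * W (x / real p)"
      using less.hyps by blast
    also have "\<dots> \<le> K / (1 - \<theta>) * (\<theta> * W x)"
      using W\<theta>[OF True] K \<theta> by (intro mult_left_mono) auto
    finally show ?thesis .
  next
    case False
    then have "x / real p < 1" using p2 by simp
    then show ?thesis using K \<theta> W[OF less.prems] by (simp add: summatory_eq_0)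
  qed
  have "?M x = summatory (sqf_mult a) x - a p * ?M (x / real p)"
    by (subst summatory_sqf_mult_prime[OF p]) simp
  then have "norm (?M x) \<le> norm (summatory (sqf_mult a) x) + norm (a p) * norm (?M (x / real p))"
    by (metis norm_mult norm_triangle_ineq4)
  also have "\<dots> \<le> K * W x + 1 * (K / (1 - \<theta>) * (\<theta> * W x))"
    using bd[OF less.prems] tail a by (intro add_mono mult_mono) auto
  also have "\<dots> = K / (1 - \<theta>) * W x"
    using \<theta> by (simp add: field_simps)
  finally show ?case .
qed

text \<open>The value at p is first set to 0, at the price 1 / (1 - \<theta>), and then to b, at the
  price 1 + \<theta>; \<open>a\<close> and \<open>a(p := b)\<close> agree once p is switched
  off.\<close>

lemma summatory_sqf_mult_fun_upd_le:
  assumes p: "prime p" and a: "norm (a p) \<le> 1" and b: "norm b \<le> 1"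
    and \<theta>: "0 \<le> \<theta>" "\<theta> < 1" and K: "K \<ge> 0" and W: "\<And>x. x \<ge> 1 \<Longrightarrow> W x \<ge> 0"
    and W\<theta>: "\<And>x. x \<ge> real p \<Longrightarrow> W (x / real p) \<le> \<theta> * W x"
    and bd: "\<And>x. x \<ge> 1 \<Longrightarrow> norm (summatory (sqf_mult a) x) \<le> K * W x"
    and x: "x \<ge> 1"
  shows "norm (summatory (sqf_mult (a(p := b))) x) \<le> K * ((1 + \<theta>) / (1 - \<theta>)) * W x"
proof -
  let ?M = "summatory (sqf_mult (a(p := 0)))"
  note M = summatory_sqf_mult_fun_upd_0_le[where W = W, OF p a \<theta> K W W\<theta> bd]
  have p0: "real p > 0" using prime_gt_0_nat[OF p] by simp
  have tail: "norm (?M (x / real p)) \<le> K / (1 - \<theta>) * (\<theta> * W x)"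
  proof (cases "x \<ge> real p")
    case True
    then have "norm (?M (x / real p)) \<le> K / (1 - \<theta>) * W (x / real p)"
      by (intro M) (use p0 in auto)
    also have "\<dots> \<le> K / (1 - \<theta>) * (\<theta> * W x)"
      using W\<theta>[OF True] K \<theta> by (intro mult_left_mono) auto
    finally show ?thesis .
  next
    case False
    then have "x / real p < 1" using p0 by simp
    then show ?thesis using K \<theta> W[OF x] by (simp add: summatory_eq_0)
  qed
  have "norm (summatory (sqf_mult (a(p := b))) x) \<le> norm (?M x) + norm b * norm (?M (x / real p))"
    by (subst summatory_sqf_mult_prime[OF p]) (simp, metis norm_mult norm_triangle_ineq)
  also have "\<dots> \<le> K / (1 - \<theta>) * W x + 1 * (K / (1 - \<theta>) * (\<theta> * W x))"
    using M[OF _ _ _ x] tail b by (intro add_mono mult_mono) auto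
  also have "\<dots> = K * ((1 + \<theta>) / (1 - \<theta>)) * W x"
    by (simp add: field_simps add_divide_distrib)
  finally show ?thesis .
qed

text \<open>The product of the factors is kept explicit, so that it can be bounded later by a
  constant independent of P.\<close>

lemma summatory_sqf_mult_change_finite:
  assumes "finite P" "\<And>p. p \<in> P \<Longrightarrow> prime p"
    and a: "\<And>p. norm (a p) \<le> 1" and b: "\<And>p. norm (b p) \<le> 1"
    and \<theta>: "\<And>p. p \<in> P \<Longrightarrow> 0 \<le> \<theta> p" "\<And>p. p \<in> P \<Longrightarrow> \<theta> p < 1"
    and K: "K \<ge> 0" and W: "\<And>x. x \<ge> 1 \<Longrightarrow> W x \<ge> 0"
    and W\<theta>: "\<And>p x. p \<in> P \<Longrightarrow> x \<ge> real p \<Longrightarrow> W (x / real p) \<le> \<theta> p * W x"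
    and bd: "\<And>x. x \<ge> 1 \<Longrightarrow> norm (summatory (sqf_mult a) x) \<le> K * W x"
  shows "x \<ge> 1 \<Longrightarrow> norm (summatory (sqf_mult (\<lambda>p. if p \<in> P then b p else a p)) x)
    \<le> K * (\<Prod>p\<in>P. (1 + \<theta> p) / (1 - \<theta> p)) * W x"
  using assms(1,2) \<theta> W\<theta>
proof (induction P arbitrary: x rule: finite_induct)
  case empty
  then show ?case using bd by simp
next
  case (insert q P)
  let ?a = "\<lambda>p. if p \<in> P then b p else a p" and ?C = "\<Prod>p\<in>P. (1 + \<theta> p) / (1 - \<theta> p)"
  have C: "?C \<ge> 0"
    by (intro prod_nonneg ballI divide_nonneg_nonneg) (use insert.prems(3,4) in \<open>force+\<close>)
  have eq: "(\<lambda>p. if p \<in> insert q P then b p else a p) = ?a(q := b q)" by auto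
  have "norm (summatory (sqf_mult (?a(q := b q))) x) \<le> K * ?C * ((1 + \<theta> q) / (1 - \<theta> q)) * W x"
  proof (rule summatory_sqf_mult_fun_upd_le)
    show "norm (summatory (sqf_mult ?a) y) \<le> K * ?C * W y" if "y \<ge> 1" for y
      by (rule insert.IH) (use insert.prems that in auto)
  qed (use insert.prems a b K W C in auto)
  then show ?case using insert.hyps unfolding eq by (simp add: mult_ac)
qed

section \<open>Local bounds for logarithmic derivatives\<close>

text \<open>F / (2M - F) has values in the unit disc, because a point of the half plane Re < M is
  closer to 0 than to 2M; the Schwarz lemma applies to it after rescaling. The derivative bound is
  the first bound divided by |z - s|, as z tends to s.\<close>

lemma Borel_Caratheodory:
  assumes holF: "F holomorphic_on ball s r" and r: "r > 0" and F0: "F s = 0"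
    and Re: "\<And>z. z \<in> ball s r \<Longrightarrow> Re (F z) < M"
  shows "z \<in> ball s r \<Longrightarrow> norm (F z) \<le> 2 * M * norm (z - s) / (r - norm (z - s))"
    and "norm (deriv F s) \<le> 2 * M / r"
proof -
  have M: "M > 0" using Re[of s] r F0 by simp
  define \<phi> where "\<phi> w = F (s + of_real r * w) / (2 * of_real M - F (s + of_real r * w))" for w
  have in_ball: "s + of_real r * w \<in> ball s r" if "norm w < 1" for w
    using that r by (simp add: dist_norm norm_mult)
  have ne: "2 * of_real M - F z \<noteq> 0" if "z \<in> ball s r" for z
  proof
    assume "2 * of_real M - F z = 0"
    then have "Re (F z) = 2 * M" by (simp add: complex_eq_iff)
    with Re[OF that] M show False by simp
  qed
  have less: "norm (F z) < norm (2 * of_real M - F z)" if "z \<in> ball s r" for z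
  proof -
    have "(norm (2 * of_real M - F z))\<^sup>2 = (norm (F z))\<^sup>2 + 4 * M * (M - Re (F z))"
      unfolding cmod_power2 by (simp add: power2_eq_square algebra_simps)
    moreover have "4 * M * (M - Re (F z)) > 0" using M Re[OF that] by simp
    ultimately have "(norm (F z))\<^sup>2 < (norm (2 * of_real M - F z))\<^sup>2" by simp
    then show ?thesis by (rule power_less_imp_less_base) simp
  qed
  have "\<phi> holomorphic_on ball 0 1"
    unfolding \<phi>_def
    by (intro holomorphic_intros holomorphic_on_compose_gen[OF _ holF, unfolded o_def])
      (use in_ball ne in auto)
  moreover have "\<phi> 0 = 0" by (simp add: \<phi>_def F0)
  moreover have "norm (\<phi> w) < 1" if "norm w < 1" for w
    using less[OF in_ball[OF that]] ne[OF in_ball[OF that]] by (simp add: \<phi>_def norm_divide)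
  ultimately have \<phi>: "norm (\<phi> w) \<le> norm w" if "norm w < 1" for w
    using Schwarz_Lemma(1) that by blast
  have bound: "norm (F z) \<le> 2 * M * norm (z - s) / (r - norm (z - s))" if z: "z \<in> ball s r" for z
  proof -
    define w where "w = (z - s) / of_real r"
    have w: "norm w < 1" and zw: "z = s + of_real r * w" and nw: "norm w = norm (z - s) / r"
      using z r by (auto simp: w_def norm_divide dist_norm norm_minus_commute)
    have "norm (F z) / norm (2 * of_real M - F z) \<le> norm w"
      using \<phi>[OF w] by (simp add: \<phi>_def zw norm_divide)
    then have "norm (F z) \<le> norm w * norm (2 * of_real M - F z)"
      using ne[OF z] by (simp add: field_simps)
    also have "\<dots> \<le> norm w * (2 * M + norm (F z))"
      using norm_triangle_ineq4[of "2 * of_real M" "F z"] M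
      by (intro mult_left_mono) auto
    finally have "norm (F z) * (r - norm (z - s)) \<le> 2 * M * norm (z - s)"
      using r unfolding nw by (simp add: field_simps)
    then show ?thesis
      using z by (simp add: dist_norm norm_minus_commute field_simps)
  qed
  then show "z \<in> ball s r \<Longrightarrow> norm (F z) \<le> 2 * M * norm (z - s) / (r - norm (z - s))" .
  have "(F has_field_derivative deriv F s) (at s)"
    using holF r by (intro holomorphic_derivI[where S = "ball s r"]) auto
  then have "((\<lambda>z. norm ((F z - F s) / (z - s))) \<longlongrightarrow> norm (deriv F s)) (at s)"
    unfolding has_field_derivative_iff by (rule tendsto_norm)
  moreover have "((\<lambda>z. 2 * M / (r - norm (z - s))) \<longlongrightarrow> 2 * M / (r - norm (s - s))) (at s)"
    using r by (intro tendsto_intros) auto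
  moreover have "\<forall>\<^sub>F z in at s. norm ((F z - F s) / (z - s)) \<le> 2 * M / (r - norm (z - s))"
  proof -
    have "\<forall>\<^sub>F z in at s. z \<in> ball s r - {s}"
      using r by (intro eventually_at_in_open) auto
    then show ?thesis
    proof eventually_elim
      case (elim z)
      then have "norm (F z) / norm (z - s) \<le> (2 * M * norm (z - s) / (r - norm (z - s))) / norm (z - s)"
        using bound[of z] by (intro divide_right_mono) auto
      then show ?case using elim by (simp add: F0 norm_divide)
    qed
  qed
  ultimately show "norm (deriv F s) \<le> 2 * M / r"
    using tendsto_le[of "at s"] by fastforce
qed

text \<open>On a disc without zeros f / f(s) has a logarithm F with F(s) = 0, and the upper bound
  for f becomes Re F < ln (B / |f(s)|), the input of Borel-Caratheodory. One conclusion serves the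
  zero-free region, the other the lower bound for zeta inside it.\<close>

lemma nonzero_disc_bounds:
  assumes hol: "f holomorphic_on ball s r" and r: "r > 0"
    and nz: "\<And>z. z \<in> ball s r \<Longrightarrow> f z \<noteq> 0"
    and B: "\<And>z. z \<in> ball s r \<Longrightarrow> norm (f z) < B"
  shows "norm (deriv f s / f s) \<le> 2 * ln (B / norm (f s)) / r"
    and "z \<in> ball s r \<Longrightarrow>
      norm (f z) \<ge> norm (f s) * exp (- (2 * ln (B / norm (f s)) * norm (z - s) / (r - norm (z - s))))"
proof -
  have s: "s \<in> ball s r" using r by simp
  obtain g where holg: "g holomorphic_on ball s r" and g: "\<And>z. z \<in> ball s r \<Longrightarrow> f z = exp (g z)"
    using contractible_imp_holomorphic_log[OF hol convex_imp_contractible[OF convex_ball] nz] by metis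
  define F where "F z = g z - g s" for z
  have holF: "F holomorphic_on ball s r" unfolding F_def by (intro holomorphic_intros holg)
  have "F s = 0" by (simp add: F_def)
  have fF: "f z = f s * exp (F z)" if "z \<in> ball s r" for z
    using g[OF that] g[OF s] by (simp add: F_def exp_diff)
  have ReF: "Re (F z) = ln (norm (f z) / norm (f s))" if "z \<in> ball s r" for z
    using fF[OF that] nz[OF s] by (simp add: norm_mult)
  have "Re (F z) < ln (B / norm (f s))" if "z \<in> ball s r" for z
  proof -
    have "0 < norm (f z) / norm (f s)" "norm (f z) / norm (f s) < B / norm (f s)"
      using nz[OF s] nz[OF that] B[OF that] by (auto simp: divide_strict_right_mono)
    then show ?thesis unfolding ReF[OF that] by simp
  qed
  note BC = Borel_Caratheodory[OF holF r _ this]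
  have "deriv f s = f s * deriv F s"
  proof -
    have "(F has_field_derivative deriv F s) (at s)"
      using holF r by (intro holomorphic_derivI[where S = "ball s r"]) auto
    then have D: "((\<lambda>z. f s * exp (F z)) has_field_derivative f s * (exp (F s) * deriv F s)) (at s)"
      by (intro DERIV_cmult DERIV_fun_exp)
    have "\<forall>\<^sub>F z in nhds s. f z = f s * exp (F z)"
      by (rule eventually_mono[OF eventually_nhds_in_open[OF open_ball s]]) (rule fF)
    then have "deriv f s = deriv (\<lambda>z. f s * exp (F z)) s" by (rule deriv_cong_ev) simp
    also have "\<dots> = f s * (exp (F s) * deriv F s)" using D by (rule DERIV_imp_deriv)
    finally show ?thesis unfolding \<open>F s = 0\<close> by simp
  qed
  then show "norm (deriv f s / f s) \<le> 2 * ln (B / norm (f s)) / r"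
    using BC(2)[OF \<open>F s = 0\<close>] nz[OF s] by simp
  assume z: "z \<in> ball s r"
  have "- (2 * ln (B / norm (f s)) * norm (z - s) / (r - norm (z - s))) \<le> Re (F z)"
    using BC(1)[OF \<open>F s = 0\<close> _ z] abs_Re_le_cmod[of "F z"] by simp
  then show "norm (f z) \<ge> norm (f s) * exp (- (2 * ln (B / norm (f s)) * norm (z - s) / (r - norm (z - s))))"
    by (subst fF[OF z]) (simp add: norm_mult mult_left_mono)
qed

text \<open>The zero is removed by the factor (s - \<rho>) / (z - \<rho>): it is 1 at the centre and
  at most r / (2r) = 1/2 in modulus on the circle of radius 3r.\<close>

lemma divide_out_zero:
  assumes hol: "f holomorphic_on ball s R" and r: "0 < r" "3 * r < R"
    and B: "\<And>z. z \<in> sphere s (3 * r) \<Longrightarrow> norm (f z) \<le> B"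
    and f0: "f s \<noteq> 0" and \<rho>: "\<rho> \<in> cball s r" "f \<rho> = 0"
  obtains g where "g holomorphic_on ball s R" "\<And>z. z \<in> sphere s (3 * r) \<Longrightarrow> norm (g z) \<le> B / 2"
    "g s = f s" "\<And>z. z \<noteq> \<rho> \<Longrightarrow> g z = 0 \<longleftrightarrow> f z = 0"
    "deriv f s / f s = deriv g s / g s + 1 / (s - \<rho>)"
proof -
  \<comment> \<open>The value at \<rho> fills in the removable singularity, as
    \<open>pole_lemma\<close> expects.\<close>
  define g where "g z = (s - \<rho>) * (if z = \<rho> then deriv f \<rho> else (f z - f \<rho>) / (z - \<rho>))" for z
  have \<rho>s: "\<rho> \<noteq> s" using f0 \<rho> by auto
  have \<rho>R: "\<rho> \<in> ball s R" and sR: "s \<in> ball s R" using \<rho> r by auto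
  have holg: "g holomorphic_on ball s R"
    unfolding g_def by (intro holomorphic_intros pole_lemma[OF hol]) (use \<rho>R in auto)
  have gs: "g s = f s" using \<rho>s \<rho> by (simp add: g_def)
  have mult: "(z - \<rho>) * g z = (s - \<rho>) * f z" for z
    using \<rho> by (simp add: g_def)
  have gb: "norm (g z) \<le> B / 2" if z: "z \<in> sphere s (3 * r)" for z
  proof -
    have "dist s \<rho> \<le> r" "dist s z = 3 * r" using \<rho> z by auto
    then have d: "norm (s - \<rho>) \<le> r" "norm (z - \<rho>) \<ge> 2 * r"
      using norm_triangle_ineq4[of "z - \<rho>" "s - \<rho>"] by (auto simp: dist_norm norm_minus_commute)
    have "2 * r * norm (g z) \<le> norm (z - \<rho>) * norm (g z)"
      using d by (intro mult_right_mono) auto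
    also have "\<dots> = norm (s - \<rho>) * norm (f z)" using mult[of z] by (metis norm_mult)
    also have "\<dots> \<le> r * B" using d B[OF z] r by (intro mult_mono) auto
    finally show ?thesis using r by simp
  qed
  have "deriv f s / f s = deriv g s / g s + 1 / (s - \<rho>)"
  proof -
    have df: "(f has_field_derivative deriv f s) (at s)" and dg: "(g has_field_derivative deriv g s) (at s)"
      using hol holg sR by (auto intro!: holomorphic_derivI[where S = "ball s R"])
    have "((\<lambda>z. (z - \<rho>) * g z) has_field_derivative g s + (s - \<rho>) * deriv g s) (at s)"
      by (auto intro!: derivative_eq_intros dg)
    moreover have "((\<lambda>z. (s - \<rho>) * f z) has_field_derivative (s - \<rho>) * deriv f s) (at s)"
      by (auto intro!: derivative_eq_intros df)
    ultimately have "g s + (s - \<rho>) * deriv g s = (s - \<rho>) * deriv f s"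
      unfolding mult by (metis DERIV_unique)
    then have "deriv f s = deriv g s + f s / (s - \<rho>)" using \<rho>s gs by (simp add: field_simps)
    then show ?thesis using f0 gs by (simp add: add_divide_distrib)
  qed
  moreover have "g z = 0 \<longleftrightarrow> f z = 0" if "z \<noteq> \<rho>" for z using that \<rho> \<rho>s by (simp add: g_def)
  ultimately show ?thesis using that holg gb gs by blast
qed

text \<open>Dividing out a zero in the inner disc halves the bound on the outer circle without changing
  the value at the centre, so the induction stops without counting zeros.\<close>

lemma Re_logderiv_ge:
  assumes r: "0 < r" "3 * r < R"
    and "f holomorphic_on ball s R"
    and "\<And>z. z \<in> sphere s (3 * r) \<Longrightarrow> norm (f z) \<le> B"
    and "f s \<noteq> 0" and "\<And>z. z \<in> cball s r \<Longrightarrow> f z = 0 \<Longrightarrow> Re z \<le> Re s"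
  shows "Re (deriv f s / f s) \<ge> - (2 * ln (2 * B / norm (f s)) / r)"
proof -
  \<comment> \<open>k bounds the number of possible halvings: with B < |f(s)| the maximum modulus
    principle would be violated.\<close>
  obtain k :: nat where "B / norm (f s) < 2 ^ k" using real_arch_pow[of 2] by auto
  then have "B < 2 ^ k * norm (f s)" using \<open>f s \<noteq> 0\<close> by (simp add: field_simps)
  then show ?thesis using assms(3-)
  proof (induction k arbitrary: f B)
    case (0 f B)
    have "norm (f s) \<le> B"
    proof (rule maximum_modulus_frontier[of f "cball s (3 * r)"])
      show "f holomorphic_on interior (cball s (3 * r))"
        using 0(2) r by (auto intro: holomorphic_on_subset)
      show "continuous_on (closure (cball s (3 * r))) f"
        using 0(2) r by (intro holomorphic_on_imp_continuous_on) (auto intro: holomorphic_on_subset)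
    qed (use 0(3) r in \<open>auto simp: frontier_cball\<close>)
    with 0(1) show ?case by simp
  next
    case (Suc k f B)
    show ?case
    proof (cases "\<exists>\<rho>\<in>cball s r. f \<rho> = 0")
      case True
      then obtain \<rho> where \<rho>: "\<rho> \<in> cball s r" "f \<rho> = 0" by auto
      from divide_out_zero[OF Suc.prems(2) r Suc.prems(3,4) \<rho>]
      obtain g where g: "g holomorphic_on ball s R" "\<And>z. z \<in> sphere s (3 * r) \<Longrightarrow> norm (g z) \<le> B / 2"
        "g s = f s" "\<And>z. z \<noteq> \<rho> \<Longrightarrow> g z = 0 \<longleftrightarrow> f z = 0"
        "deriv f s / f s = deriv g s / g s + 1 / (s - \<rho>)" by metis
      have le: "- (2 * ln (2 * (B / 2) / norm (g s)) / r) \<le> Re (deriv g s / g s)"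
      proof (rule Suc.IH)
        show "Re z \<le> Re s" if "z \<in> cball s r" "g z = 0" for z
          using that g(4) \<rho> Suc.prems(5) by (cases "z = \<rho>") auto
      qed (use g Suc.prems in auto)
      \<comment> \<open>Zeros do not lie to the right of s, so their terms have nonnegative real
        part and may be dropped from a lower bound.\<close>
      have "Re (1 / (s - \<rho>)) \<ge> 0"
        using Suc.prems(5)[OF \<rho>] by (simp add: Re_divide)
      then have "Re (deriv f s / f s) \<ge> Re (deriv g s / g s)" unfolding g(5) by simp
      moreover have "B > 0"
      proof -
        have "norm (g s) \<le> B / 2"
        proof (rule maximum_modulus_frontier[of g "cball s (3 * r)"])
          show "g holomorphic_on interior (cball s (3 * r))"
            using g(1) r by (auto intro: holomorphic_on_subset)
          show "continuous_on (closure (cball s (3 * r))) g"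
            using g(1) r by (intro holomorphic_on_imp_continuous_on) (auto intro: holomorphic_on_subset)
        qed (use g(2) r in \<open>auto simp: frontier_cball\<close>)
        moreover have "norm (g s) > 0" using Suc.prems(4) g(3) by simp
        ultimately show ?thesis by linarith
      qed
      then have "ln (2 * (B / 2) / norm (g s)) \<le> ln (2 * B / norm (f s))"
        using Suc.prems(4) g(3) by (subst ln_le_cancel_iff) (auto simp: divide_right_mono)
      then have "- (2 * ln (2 * B / norm (f s)) / r) \<le> - (2 * ln (2 * (B / 2) / norm (g s)) / r)"
        using r by (simp add: divide_right_mono)
      ultimately show ?thesis using le by linarith
    next
      case False
      have ge: "norm (f z) \<le> B" if "z \<in> cball s (3 * r)" for z
      proof (rule maximum_modulus_frontier[of f "cball s (3 * r)"])
        show "f holomorphic_on interior (cball s (3 * r))"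
          using Suc.prems(2) r by (auto intro: holomorphic_on_subset)
        show "continuous_on (closure (cball s (3 * r))) f"
          using Suc.prems(2) r by (intro holomorphic_on_imp_continuous_on) (auto intro: holomorphic_on_subset)
      qed (use Suc.prems(3) r that in \<open>auto simp: frontier_cball\<close>)
      have "norm (f s) > 0" using Suc.prems(4) by simp
      moreover have "norm (f s) \<le> B" using ge[of s] r by simp
      ultimately have B: "B > 0" by linarith
      \<comment> \<open>\<open>nonzero_disc_bounds\<close> asks for a strict bound on f; passing
        from B to 2B provides it and is the origin of the 2 in the statement.\<close>
      have "norm (deriv f s / f s) \<le> 2 * ln (2 * B / norm (f s)) / r"
      proof (rule nonzero_disc_bounds(1))
        show "f holomorphic_on ball s r" using Suc.prems(2) r by (auto intro: holomorphic_on_subset)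
        show "norm (f z) < 2 * B" if "z \<in> ball s r" for z
          using ge[of z] that r B by auto
      qed (use False r in auto)
      then show ?thesis using abs_Re_le_cmod[of "deriv f s / f s"] by linarith
    qed
  qed
qed

text \<open>Here the term of one chosen zero is kept. Dividing that zero out before
  \<open>Re_logderiv_ge\<close> is applied halves B, which cancels the factor 2 there.\<close>

lemma Re_logderiv_ge_zero:
  assumes r: "0 < r" "3 * r < R"
    and hol: "f holomorphic_on ball s R"
    and B: "\<And>z. z \<in> sphere s (3 * r) \<Longrightarrow> norm (f z) \<le> B"
    and f0: "f s \<noteq> 0" and zeros: "\<And>z. z \<in> cball s r \<Longrightarrow> f z = 0 \<Longrightarrow> Re z \<le> Re s"
    and \<rho>: "\<rho> \<in> cball s r" "f \<rho> = 0"
  shows "Re (deriv f s / f s) \<ge> - (2 * ln (B / norm (f s)) / r) + Re (1 / (s - \<rho>))"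
proof -
  from divide_out_zero[OF hol r B f0 \<rho>] obtain g where
    g: "g holomorphic_on ball s R" "\<And>z. z \<in> sphere s (3 * r) \<Longrightarrow> norm (g z) \<le> B / 2"
       "g s = f s" "\<And>z. z \<noteq> \<rho> \<Longrightarrow> g z = 0 \<longleftrightarrow> f z = 0"
       "deriv f s / f s = deriv g s / g s + 1 / (s - \<rho>)" by metis
  have "- (2 * ln (2 * (B / 2) / norm (g s)) / r) \<le> Re (deriv g s / g s)"
  proof (rule Re_logderiv_ge[OF r g(1,2)])
    show "Re z \<le> Re s" if "z \<in> cball s r" "g z = 0" for z
      using that g(4) \<rho> zeros by (cases "z = \<rho>") auto
  qed (use g f0 in auto)
  then show ?thesis unfolding g(5) using g(3) by simp
qed

section \<open>Dirichlet series\<close>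

lemma norm_of_nat_powr: "norm (of_nat n powr s :: complex) = real n powr Re s"
  using norm_powr_real_powr[of "of_nat n" s] by simp

text \<open>Absolute convergence allows the double series to be regrouped. Both indices are
  restricted to positive integers, where (m, n) -> (mn, m) is a bijection onto pairs of a number and
  a divisor of it; at 0 this fails, since everything divides 0.\<close>

lemma Dirichlet_product_sums:
  fixes f g :: "nat \<Rightarrow> complex"
  assumes f: "summable (\<lambda>n. norm (f n))" "f 0 = 0" and g: "summable (\<lambda>n. norm (g n))" "g 0 = 0"
  shows "(\<lambda>n. if n = 0 then 0 else \<Sum>d | d dvd n. f d * g (n div d)) sums (suminf f * suminf g)"
proof -
  define A where "A = {1::nat..}"
  have on_A: "(h has_sum suminf h) A" if "summable (\<lambda>n. norm (h n))" "h 0 = 0" for h :: "nat \<Rightarrow> complex"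
  proof -
    have "(h has_sum suminf h) UNIV"
      using that by (intro norm_summable_imp_has_sum) (auto intro: summable_sums summable_norm_cancel)
    then show ?thesis
      by (rule has_sum_cong_neutral[THEN iffD1, rotated -1])
         (use that in \<open>auto simp: A_def Suc_le_eq not_le\<close>)
  qed
  have abs_A: "(\<lambda>n. norm (h n)) summable_on A" if "summable (\<lambda>n. norm (h n))" for h :: "nat \<Rightarrow> complex"
    using that by (intro summable_on_subset_banach[OF norm_summable_imp_summable_on]) auto
  have "(\<lambda>mn. norm (case mn of (m, n) \<Rightarrow> f m * g n)) summable_on A \<times> A"
    unfolding Infinite_Sum.abs_summable_on_Sigma_iff
    using abs_A[OF f(1)] abs_A[OF g(1)]
    by (auto simp: norm_mult infsum_cmult_right intro!: summable_on_cmult_right summable_on_cmult_left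
        simp: abs_mult infsum_nonneg)
  then have "(\<lambda>(m, n). f m * g n) summable_on A \<times> A" by (rule Infinite_Sum.abs_summable_summable)
  then obtain S where S: "((\<lambda>(m, n). f m * g n) has_sum S) (A \<times> A)"
    using summable_iff_has_sum_infsum by blast
  have "((\<lambda>m. f m * suminf g) has_sum S) A"
    by (rule has_sum_Sigma'[OF S]) (auto intro!: has_sum_cmult_right on_A g)
  moreover have "((\<lambda>m. f m * suminf g) has_sum suminf f * suminf g) A"
    by (intro has_sum_cmult_left on_A f)
  ultimately have "S = suminf f * suminf g" using has_sum_unique by blast
  moreover have "((\<lambda>(m, n). f m * g n) has_sum S) (A \<times> A) \<longleftrightarrow>
    ((\<lambda>(n, d). f d * g (n div d)) has_sum S) (Sigma A (\<lambda>n. {d. d dvd n}))"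
    by (rule has_sum_reindex_bij_witness[of _ "\<lambda>(n, d). (d, n div d)" "\<lambda>(m, n). (m * n, m)"])
       (auto simp: A_def Suc_le_eq elim!: dvdE)
  ultimately have "((\<lambda>(n, d). f d * g (n div d)) has_sum suminf f * suminf g) (Sigma A (\<lambda>n. {d. d dvd n}))"
    using S by simp
  then have "((\<lambda>n. \<Sum>d | d dvd n. f d * g (n div d)) has_sum suminf f * suminf g) A"
    by (rule has_sum_Sigma') (auto simp: A_def intro!: has_sum_finite)
  then have "((\<lambda>n. if n = 0 then 0 else \<Sum>d | d dvd n. f d * g (n div d)) has_sum suminf f * suminf g) UNIV"
    by (rule has_sum_cong_neutral[THEN iffD1, rotated -1]) (auto simp: A_def)
  then show ?thesis by (rule has_sum_imp_sums)
qed

text \<open>Since \<open>0 powr z = 0\<close>, the summand at n = 0 vanishes whatever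
  \<open>a 0\<close> is.\<close>

definition fds :: "(nat \<Rightarrow> complex) \<Rightarrow> complex \<Rightarrow> complex" where
  "fds a s = (\<Sum>n. a n * of_nat n powr (- s))"

lemma summable_fds:
  assumes "\<And>n. n > 0 \<Longrightarrow> norm (a n) \<le> C * real n powr e" and s: "Re s > 1 + e"
  shows "summable (\<lambda>n. norm (a n * of_nat n powr (- s)))"
proof (rule summable_comparison_test')
  show "summable (\<lambda>n. C * real n powr (e - Re s))"
    using s by (intro summable_mult) (simp add: summable_real_powr_iff)
  fix n :: nat assume n: "n \<ge> 1"
  then have "norm (a n) * real n powr (- Re s) \<le> (C * real n powr e) * real n powr (- Re s)"
    using assms(1)[of n] by (intro mult_right_mono) auto
  also have "\<dots> = C * real n powr (e - Re s)" by (simp add: powr_diff powr_minus divide_inverse)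
  finally show "norm (norm (a n * of_nat n powr (- s))) \<le> C * real n powr (e - Re s)"
    by (simp add: norm_mult norm_of_nat_powr)
qed

lemma summable_fds_bounded:
  assumes "\<And>n. n > 0 \<Longrightarrow> norm (a n) \<le> 1" and s: "Re s > 1"
  shows "summable (\<lambda>n. norm (a n * of_nat n powr (- s)))"
  using assms by (intro summable_fds[where C = 1 and e = 0]) auto

lemma summable_fds_ln:
  assumes a: "\<And>n. n > 0 \<Longrightarrow> norm (a n) \<le> ln (real n)" and s: "Re s > 1"
  shows "summable (\<lambda>n. norm (a n * of_nat n powr (- s)))"
proof (rule summable_fds)
  define e where "e = (Re s - 1) / 2"
  have e: "e > 0" using s by (simp add: e_def)
  show "Re s > 1 + (Re s - 1) / 2" using s by (simp add: field_simps)
  fix n :: nat assume "n > 0"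
  then have "norm (a n) \<le> real n powr e / e" using a[of n] ln_powr_bound[of "real n" e] e by auto
  then show "norm (a n) \<le> (1 / e) * real n powr ((Re s - 1) / 2)" by (simp add: e_def mult.commute)
qed

lemma fds_mult:
  assumes "summable (\<lambda>n. norm (a n * of_nat n powr (- s)))" "summable (\<lambda>n. norm (b n * of_nat n powr (- s)))"
    and c: "\<And>n. n > 0 \<Longrightarrow> (\<Sum>d | d dvd n. a d * b (n div d)) = c n"
  shows "fds c s = fds a s * fds b s"
proof -
  let ?t = "\<lambda>a n. a n * of_nat n powr (- s) :: complex"
  have "(\<lambda>n. if n = 0 then 0 else \<Sum>d | d dvd n. ?t a d * ?t b (n div d)) sums (suminf (?t a) * suminf (?t b))"
    by (rule Dirichlet_product_sums) (use assms in auto)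
  moreover have "(if n = 0 then 0 else \<Sum>d | d dvd n. ?t a d * ?t b (n div d)) = ?t c n" for n
  proof (cases "n = 0")
    case False
    have "?t a d * ?t b (n div d) = a d * b (n div d) * of_nat n powr (- s)" if "d dvd n" for d
    proof -
      from that obtain k where k: "n = d * k" by auto
      have "(of_nat d * of_nat k) powr (- s) = of_nat d powr (- s) * (of_nat k powr (- s) :: complex)"
        by (rule powr_times_real) auto
      then show ?thesis using False k by simp
    qed
    then have "(\<Sum>d | d dvd n. ?t a d * ?t b (n div d))
        = (\<Sum>d | d dvd n. a d * b (n div d) * of_nat n powr (- s))" by (intro sum.cong) auto
    also have "\<dots> = ?t c n" using c[of n] False by (simp flip: sum_distrib_right)
    finally show ?thesis using False by simp
  qed auto
  ultimately show ?thesis unfolding fds_def by (simp add: sums_iff)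
qed

section \<open>The Moebius and von Mangoldt functions as coefficients\<close>

definition mu :: "nat \<Rightarrow> complex" where "mu = sqf_mult (\<lambda>_. -1)"

lemma mu_0 [simp]: "mu 0 = 0" and mu_1 [simp]: "mu (Suc 0) = 1" by (simp_all add: mu_def)

lemma norm_mu_le: "norm (mu n) \<le> 1"
  unfolding mu_def by (rule norm_sqf_mult_le) simp

text \<open>For one prime p dividing n, a divisor d prime to p cancels against p d, and multiples of
  p^2 contribute 0.\<close>

lemma sum_mu_divisors:
  assumes "n > 0"
  shows "(\<Sum>d | d dvd n. mu d) = (if n = 1 then 1 else 0)"
proof (cases "n = 1")
  case False
  then obtain p where p: "prime p" "p dvd n" using prime_factor_nat by blast
  let ?D = "{d. d dvd n}"
  have fin: "finite ?D" using assms by simp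
  have p0: "p > 0" using p prime_gt_0_nat by blast
  have "(\<Sum>d\<in>?D. mu d) = (\<Sum>d\<in>{d\<in>?D. \<not> p dvd d}. mu d) + (\<Sum>d\<in>{d\<in>?D. p dvd d}. mu d)"
    by (subst sum.union_disjoint[symmetric])
      (use fin in \<open>auto intro!: sum.cong intro: finite_subset[OF _ fin]\<close>)
  also have "(\<Sum>d\<in>{d\<in>?D. p dvd d}. mu d) = (\<Sum>d\<in>(\<lambda>e. p * e) ` {d\<in>?D. \<not> p dvd d}. mu d)"
  proof (rule sum.mono_neutral_right)
    show "(\<lambda>e. p * e) ` {d \<in> ?D. \<not> p dvd d} \<subseteq> {d \<in> ?D. p dvd d}"
    proof clarsimp
      fix e assume "e dvd n" "\<not> p dvd e"
      then show "p * e dvd n" using p by (intro divides_mult) (auto simp: prime_imp_coprime_nat)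
    qed
    show "\<forall>d\<in>{d \<in> ?D. p dvd d} - (\<lambda>e. p * e) ` {d \<in> ?D. \<not> p dvd d}. mu d = 0"
    proof clarify
      fix d assume d: "d dvd n" "p dvd d" "d \<notin> (\<lambda>e. p * e) ` {d \<in> ?D. \<not> p dvd d}"
      then obtain e where e: "d = p * e" by auto
      with d have "p dvd e" by (auto dest: dvd_mult_right)
      then show "mu d = 0" unfolding e mu_def by (rule sqf_mult_prime_sq_dvd[OF p(1)])
    qed
  qed (use fin in auto)
  also have "\<dots> = (\<Sum>e\<in>{d\<in>?D. \<not> p dvd d}. mu (p * e))"
    by (subst sum.reindex) (use p0 in \<open>auto simp: inj_on_def\<close>)
  also have "\<dots> = (\<Sum>e\<in>{d\<in>?D. \<not> p dvd d}. - mu e)"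
    by (intro sum.cong) (auto simp: mu_def sqf_mult_prime_mult[OF p(1)])
  finally show ?thesis using False by (simp add: sum_negf)
qed simp

lemma summable_fds_mu: "Re s > 1 \<Longrightarrow> summable (\<lambda>n. norm (mu n * of_nat n powr (- s)))"
  by (rule summable_fds_bounded) (auto simp: norm_mu_le)

lemma summable_fds_1: "Re s > 1 \<Longrightarrow> summable (\<lambda>n. norm (1 * of_nat n powr (- s) :: complex))"
  by (rule summable_fds_bounded) auto

lemma fds_mu_times_zeta:
  assumes "Re s > 1"
  shows "fds mu s * fds (\<lambda>_. 1) s = 1"
proof -
  have "fds (\<lambda>n. if n = 1 then 1 else 0) s = fds mu s * fds (\<lambda>_. 1) s"
    using assms by (intro fds_mult summable_fds_mu summable_fds_1) (simp_all add: sum_mu_divisors)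
  moreover have "fds (\<lambda>n. if n = 1 then 1 else 0) s = 1"
    unfolding fds_def by (subst suminf_finite[of "{1}"]) auto
  ultimately show ?thesis by simp
qed

lemma summable_fds_mangoldt: "Re s > 1 \<Longrightarrow> summable (\<lambda>n. norm (mangoldt n * of_nat n powr (- s) :: complex))"
proof (rule summable_fds_ln)
  fix n :: nat assume "n > 0"
  then have "norm (mangoldt n :: real) \<le> ln (real n)"
    using mangoldt_le[of n] mangoldt_nonneg[of n] by simp
  then show "norm (mangoldt n :: complex) \<le> ln (real n)"
    using norm_of_real[of "mangoldt n :: real", where 'a = complex] by simp
qed

lemma fds_mangoldt_times_zeta:
  assumes "Re s > 1"
  shows "fds mangoldt s * fds (\<lambda>_. 1) s = fds (\<lambda>n. of_real (ln (real n))) s"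
  using assms by (intro fds_mult[symmetric] summable_fds_mangoldt summable_fds_1) (simp_all add: mangoldt_sum)

text \<open>Termwise this is 3 + 4 cos a + cos 2a = 2 (1 + cos a)^2 >= 0 with a = t ln n, weighted
  by nonnegative coefficients. A zero of zeta close to Re s = 1 at height t would make the middle
  term too negative.\<close>

lemma mangoldt_3_4_1:
  assumes \<sigma>: "\<sigma> > 1"
  shows "0 \<le> 3 * Re (fds mangoldt (of_real \<sigma>)) + 4 * Re (fds mangoldt (Complex \<sigma> t))
    + Re (fds mangoldt (Complex \<sigma> (2 * t)))"
proof -
  let ?m = "\<lambda>u n. Re (mangoldt n * of_nat n powr (- Complex \<sigma> u) :: complex)"
  have m: "?m u n = mangoldt n * real n powr (- \<sigma>) * cos (u * ln (real n))" for u n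
  proof (cases "n = 0")
    case False
    have "of_nat n powr (- Complex \<sigma> u) = exp (- (of_real (ln (real n)) * Complex \<sigma> u) :: complex)"
      using False by (simp add: powr_def Ln_of_nat mult.commute)
    then have "Re (of_nat n powr (- Complex \<sigma> u) :: complex) = real n powr (- \<sigma>) * cos (u * ln (real n))"
      using False by (simp add: Re_exp powr_def mult_ac)
    moreover have "?m u n = mangoldt n * Re (of_nat n powr (- Complex \<sigma> u) :: complex)"
    proof -
      have "Re (complex_of_real r * z) = r * Re z" for r z by simp
      from this[of "mangoldt n"] show ?thesis by (simp only: of_real_mangoldt)
    qed
    ultimately show ?thesis by simp
  qed simp
  have sums: "?m u sums Re (fds mangoldt (Complex \<sigma> u))" for u
  proof -
    have "summable (\<lambda>n. norm (mangoldt n * of_nat n powr (- Complex \<sigma> u) :: complex))"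
      using \<sigma> by (intro summable_fds_mangoldt) simp
    then have "summable (\<lambda>n. mangoldt n * of_nat n powr (- Complex \<sigma> u) :: complex)"
      by (rule summable_norm_cancel)
    from sums_Re[OF summable_sums[OF this]] show ?thesis unfolding fds_def .
  qed
  have S: "(\<lambda>n. 3 * ?m 0 n + 4 * ?m t n + ?m (2 * t) n) sums
    (3 * Re (fds mangoldt (Complex \<sigma> 0)) + 4 * Re (fds mangoldt (Complex \<sigma> t)) + Re (fds mangoldt (Complex \<sigma> (2 * t))))"
    by (intro sums_add sums_mult sums)
  have "3 * ?m 0 n + 4 * ?m t n + ?m (2 * t) n \<ge> 0" for n
  proof -
    have "3 * ?m 0 n + 4 * ?m t n + ?m (2 * t) n
      = mangoldt n * real n powr (- \<sigma>) * (2 * (1 + cos (t * ln (real n)))\<^sup>2)"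
    proof -
      have "cos (2 * t * ln (real n)) = 2 * (cos (t * ln (real n)))\<^sup>2 - 1"
        using cos_double_cos[of "t * ln (real n)"] by (simp add: mult.assoc)
      moreover have "3 * M + 4 * (M * c) + M * c2 = M * (2 * (1 + c)\<^sup>2)"
        if "c2 = 2 * c\<^sup>2 - 1" for M c c2 :: real
        unfolding that by (simp add: algebra_simps power2_eq_square)
      ultimately show ?thesis unfolding m by simp
    qed
    then show ?thesis by (simp add: mangoldt_nonneg)
  qed
  then have "0 \<le> 3 * Re (fds mangoldt (Complex \<sigma> 0)) + 4 * Re (fds mangoldt (Complex \<sigma> t))
      + Re (fds mangoldt (Complex \<sigma> (2 * t)))"
    by (rule sums_le[OF _ sums_zero S])
  then show ?thesis by (simp add: complex_of_real_def)
qed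

text \<open>The mean value theorem stands in for the integral of z^(-1-x) over [n, n+1]; on
  summation over n the right side telescopes.\<close>

lemma powr_diff_ge:
  assumes x: "x > 0" and n: "n \<ge> (1::nat)"
  shows "real (Suc n) powr (- 1 - x) \<le> (real n powr (- x) - real (Suc n) powr (- x)) / x"
proof -
  have "\<exists>z. real n < z \<and> z < real (Suc n) \<and>
    real (Suc n) powr (- x) - real n powr (- x) = (real (Suc n) - real n) * (- x * z powr (- x - 1))"
    using n by (intro MVT2) (auto intro!: derivative_eq_intros)
  then obtain z where z: "real n < z" "z < real (Suc n)"
    "real (Suc n) powr (- x) - real n powr (- x) = - x * z powr (- x - 1)" by auto
  have "real (Suc n) powr (- 1 - x) \<le> z powr (- 1 - x)"
    using z x n by (intro powr_mono2') auto
  moreover have "(real n powr (- x) - real (Suc n) powr (- x)) / x = z powr (- 1 - x)"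
    unfolding minus_diff_commute[of 1 x] using z(3) x by (simp add: field_simps)
  ultimately show ?thesis by simp
qed

text \<open>For s = 1 + z the bound reads N^(-Re z) / Re z. In Newman's argument the factor N^z
  cancels the numerator, and the kernel takes care of the denominator.\<close>

lemma fds_tail_le:
  assumes a: "\<And>n. n > 0 \<Longrightarrow> norm (a n) \<le> 1" and s: "Re s > 1" and N: "N \<ge> 1"
  shows "norm (fds a s - (\<Sum>n\<le>N. a n * of_nat n powr (- s))) \<le> real N powr (1 - Re s) / (Re s - 1)"
proof -
  define x where "x = Re s - 1"
  have x: "x > 0" using s by (simp add: x_def)
  let ?t = "\<lambda>n. a n * of_nat n powr (- s)"
  have S: "summable (\<lambda>n. norm (?t n))" by (rule summable_fds_bounded[OF a s])
  have tail: "fds a s - (\<Sum>n\<le>N. ?t n) = (\<Sum>n. ?t (n + Suc N))"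
    unfolding fds_def using suminf_minus_initial_segment[OF summable_norm_cancel[OF S], of "Suc N"]
    by (simp add: lessThan_Suc_atMost)
  have tele: "(\<lambda>n. (real (n + N) powr (- x) - real (Suc n + N) powr (- x)) / x) sums ((real N powr (- x) - 0) / x)"
  proof (intro sums_divide)
    have "(\<lambda>n. real (n + N) powr (- x)) \<longlonglongrightarrow> 0"
      using x by (intro tendsto_neg_powr filterlim_compose[OF filterlim_real_sequentially filterlim_add_const_nat_at_top]) auto
    from telescope_sums'[OF this] show "(\<lambda>n. real (n + N) powr (- x) - real (Suc n + N) powr (- x)) sums (real N powr (- x) - 0)"
      by simp
  qed
  have le: "norm (?t (n + Suc N)) \<le> (real (n + N) powr (- x) - real (Suc n + N) powr (- x)) / x" for n
  proof -
    have "norm (?t (n + Suc N)) \<le> 1 * real (n + Suc N) powr (- Re s)"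
      unfolding norm_mult norm_of_nat_powr using a[of "n + Suc N"] by (intro mult_mono) auto
    also have "\<dots> = real (Suc (n + N)) powr (- 1 - x)" by (simp add: x_def)
    also have "\<dots> \<le> (real (n + N) powr (- x) - real (Suc (n + N)) powr (- x)) / x"
      by (rule powr_diff_ge) (use x N in auto)
    finally show ?thesis by simp
  qed
  have "norm (\<Sum>n. ?t (n + Suc N)) \<le> (\<Sum>n. (real (n + N) powr (- x) - real (Suc n + N) powr (- x)) / x)"
    by (rule norm_suminf_le[OF le]) (use tele sums_summable in blast)
  also have "\<dots> = real N powr (- x) / x" using tele by (simp add: sums_iff)
  finally show ?thesis unfolding tail by (simp add: x_def)
qed

lemma norm_fds_le:
  assumes a: "\<And>n. n > 0 \<Longrightarrow> norm (a n) \<le> 1" and s: "Re s > 1"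
  shows "norm (fds a s) \<le> Re s / (Re s - 1)"
proof -
  have "norm (fds a s) \<le> norm (fds a s - (\<Sum>n\<le>1. a n * of_nat n powr (- s)))
      + norm (\<Sum>n\<le>1. a n * of_nat n powr (- s))"
    using norm_triangle_ineq[of "fds a s - (\<Sum>n\<le>1. a n * of_nat n powr (- s))"
      "\<Sum>n\<le>1. a n * of_nat n powr (- s)"] by simp
  also have "\<dots> \<le> 1 / (Re s - 1) + 1"
    using fds_tail_le[where a = a and N = 1, OF a s] a[of 1] by (intro add_mono) (auto simp: atMost_Suc)
  also have "\<dots> = Re s / (Re s - 1)" using s by (simp add: field_simps)
  finally show ?thesis .
qed

section \<open>The zeta function\<close>

text \<open>First-order Taylor expansion of z^(1-s) at n, evaluated at n + 1. The remainder has size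
  n^(-Re s - 1), one power better than the terms of the zeta series, so it is summable for Re s >
  0.\<close>

lemma of_nat_powr_complex_Taylor:
  assumes n: "n \<ge> (1::nat)" and s: "Re s \<ge> 0"
  shows "norm ((s - 1) * of_nat n powr (- s) + of_nat (Suc n) powr (1 - s) - of_nat n powr (1 - s))
    \<le> norm (s - 1) * norm s * real n powr (- Re s - 1)"
proof -
  define h :: "nat \<Rightarrow> complex \<Rightarrow> complex" where
    "h i z = (if i = 0 then z powr (1 - s) else if i = 1 then (1 - s) * z powr (- s)
      else (1 - s) * (- s) * z powr (- s - 1))" for i z
  have h: "h 0 = (\<lambda>z. z powr (1 - s))" "h 1 = (\<lambda>z. (1 - s) * z powr (- s))"
    "h (Suc 0) z = (1 - s) * z powr (1 - s - 1)" "h (Suc 1) z = (1 - s) * (- s * z powr (- s - 1))" for z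
    unfolding h_def by simp_all
  let ?S = "closed_segment (of_nat n) (of_nat (Suc n)) :: complex set"
  have S: "\<exists>t\<ge>real n. z = of_real t" if z: "z \<in> ?S" for z
  proof -
    from z obtain u where u: "0 \<le> u" "u \<le> 1" "z = (1 - u) *\<^sub>R of_nat n + u *\<^sub>R of_nat (Suc n)"
      by (auto simp: closed_segment_def)
    have "z = of_real (real n + u)" unfolding u(3) by (simp add: scaleR_conv_of_real algebra_simps)
    with u show ?thesis by (intro exI[of _ "real n + u"]) auto
  qed
  have "norm (h 0 (of_nat (Suc n)) - (\<Sum>i\<le>1. h i (of_nat n) * (of_nat (Suc n) - of_nat n) ^ i / fact i))
    \<le> (norm (s - 1) * norm s * real n powr (- Re s - 1)) * norm (of_nat (Suc n) - of_nat n :: complex) ^ Suc 1 / fact 1"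
  proof (rule complex_Taylor)
    fix i z assume z: "z \<in> ?S" and i: "i \<le> (1::nat)"
    obtain t where t: "t \<ge> real n" "z = of_real t" using S[OF z] by blast
    then have nz: "z \<notin> \<real>\<^sub>\<le>\<^sub>0" using n by auto
    consider "i = 0" | "i = 1" using i by linarith
    then show "(h i has_field_derivative h (Suc i) z) (at z within ?S)"
    proof cases
      case 1
      show ?thesis unfolding 1 h
        by (rule has_field_derivative_at_within[OF has_field_derivative_powr[OF nz]])
    next
      case 2
      show ?thesis unfolding 2 h
        by (rule has_field_derivative_at_within[OF DERIV_cmult[OF has_field_derivative_powr[OF nz]]])
    qed
  next
    fix z assume "z \<in> ?S"
    then obtain t where t: "t \<ge> real n" "z = of_real t" using S by blast
    have "norm (z powr (- s - 1)) = t powr (- Re s - 1)"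
      using t n norm_powr_real_powr[of "of_real t" "- s - 1"] by simp
    also have "\<dots> \<le> real n powr (- Re s - 1)" using t n s by (intro powr_mono2') auto
    finally show "norm (h (Suc 1) z) \<le> norm (s - 1) * norm s * real n powr (- Re s - 1)"
      by (simp add: h_def norm_mult mult_left_mono norm_minus_commute)
  qed auto
  then show ?thesis by (simp add: h_def algebra_simps)
qed

text \<open>For Re s > 1 the added difference telescopes to -1, which the summand 1 in
  \<open>zeta1\<close> compensates. The index is shifted by one to keep the bases positive.\<close>

definition zeta1_term :: "nat \<Rightarrow> complex \<Rightarrow> complex" where
  "zeta1_term n s = (s - 1) * of_nat (Suc n) powr (- s)
     + of_nat (Suc (Suc n)) powr (1 - s) - of_nat (Suc n) powr (1 - s)"

text \<open>This is \<open>(s - 1) \<zeta>(s)\<close>, continued analytically to \<open>Re s > 0\<close>.\<close>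

definition zeta1 :: "complex \<Rightarrow> complex" where
  "zeta1 s = 1 + (\<Sum>n. zeta1_term n s)"

lemma norm_zeta1_term_le:
  assumes "Re s \<ge> d" "d \<ge> 0"
  shows "norm (zeta1_term n s) \<le> norm (s - 1) * norm s * real (Suc n) powr (- d - 1)"
proof -
  have "norm (zeta1_term n s) \<le> norm (s - 1) * norm s * real (Suc n) powr (- Re s - 1)"
    unfolding zeta1_term_def by (rule of_nat_powr_complex_Taylor) (use assms in auto)
  also have "\<dots> \<le> norm (s - 1) * norm s * real (Suc n) powr (- d - 1)"
    using assms by (intro mult_left_mono powr_mono) auto
  finally show ?thesis .
qed

lemma summable_Suc_powr: "e < - 1 \<Longrightarrow> summable (\<lambda>n. real (Suc n) powr e)"
  using summable_ignore_initial_segment[of "\<lambda>n. real n powr e" 1] summable_real_powr_iff[of e] by simp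

lemma zeta1_holomorphic: "zeta1 holomorphic_on {s. Re s > 0}"
proof (rule holomorphic_uniform_sequence)
  show "open {s. Re s > 0}" by (rule open_halfspace_Re_gt)
  show "(\<lambda>s. 1 + (\<Sum>k<n. zeta1_term k s)) holomorphic_on {s. 0 < Re s}" for n
    unfolding zeta1_term_def by (intro holomorphic_intros) (auto simp del: of_nat_Suc)
  fix z assume z: "z \<in> {s. 0 < Re s}"
  define d where "d = Re z / 2"
  have d: "d > 0" using z by (simp add: d_def)
  have Re: "Re s \<ge> d" if "s \<in> cball z d" for s
    using that abs_Re_le_cmod[of "z - s"] by (auto simp: d_def dist_norm)
  have "uniform_limit (cball z d) (\<lambda>n s. \<Sum>k<n. zeta1_term k s) (\<lambda>s. \<Sum>k. zeta1_term k s) sequentially"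
  proof (rule Weierstrass_m_test)
    show "summable (\<lambda>n. (norm z + d + 1) * (norm z + d) * real (Suc n) powr (- d - 1))"
      using d by (intro summable_mult summable_Suc_powr) auto
    fix n s assume s: "s \<in> cball z d"
    have "norm s \<le> norm z + d" using s norm_triangle_ineq4[of z "z - s"] by (simp add: dist_norm)
    moreover have "norm (s - 1) \<le> norm s + 1" using norm_triangle_ineq4[of s 1] by simp
    ultimately have "norm (s - 1) * norm s \<le> (norm z + d + 1) * (norm z + d)"
      using d by (intro mult_mono) auto
    then show "norm (zeta1_term n s) \<le> (norm z + d + 1) * (norm z + d) * real (Suc n) powr (- d - 1)"
      using norm_zeta1_term_le[OF Re[OF s], of n] d
      by (intro order.trans[OF norm_zeta1_term_le[OF Re[OF s]] mult_right_mono]) auto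
  qed
  then have "uniform_limit (cball z d) (\<lambda>n s. 1 + (\<Sum>k<n. zeta1_term k s)) zeta1 sequentially"
    unfolding zeta1_def[abs_def] by (intro uniform_limit_intros)
  moreover have "cball z d \<subseteq> {s. Re s > 0}" using Re d by fastforce
  ultimately show "\<exists>d>0. cball z d \<subseteq> {s. 0 < Re s} \<and>
      uniform_limit (cball z d) (\<lambda>n s. 1 + (\<Sum>k<n. zeta1_term k s)) zeta1 sequentially"
    using d by blast
qed

text \<open>Keeping the factor |s - 1| lets one estimate serve twice: it shows that
  \<open>zeta1\<close> is close to 1 around the pole of zeta, and it gives polynomial growth in Im s
  elsewhere.\<close>

lemma norm_zeta1_minus_1_le:
  assumes "Re s \<ge> d" "d > 0"
  shows "norm (zeta1 s - 1) \<le> norm (s - 1) * norm s * (1 + 1 / d)"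
proof -
  have S: "summable (\<lambda>n. norm (s - 1) * norm s * real (Suc n) powr (- d - 1))"
    using assms by (intro summable_mult summable_Suc_powr) auto
  have "norm (\<Sum>n. zeta1_term n s) \<le> (\<Sum>n. norm (s - 1) * norm s * real (Suc n) powr (- d - 1))"
    by (rule norm_suminf_le[OF norm_zeta1_term_le S]) (use assms in auto)
  also have "\<dots> = norm (s - 1) * norm s * (\<Sum>n. real (Suc n) powr (- d - 1))"
    using assms by (intro suminf_mult summable_Suc_powr) auto
  also have "(\<Sum>n. real (Suc n) powr (- d - 1)) \<le> 1 + 1 / d"
  proof (rule suminf_le_const)
    show "summable (\<lambda>n. real (Suc n) powr (- d - 1))" using assms by (intro summable_Suc_powr) auto
    fix N
    \<comment> \<open>The subtracted term is the tail of the comparison integral; with it the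
      induction step is a telescoping.\<close>
    have "(\<Sum>n<N. real (Suc n) powr (- d - 1)) \<le> 1 + 1 / d - (if N = 0 then 0 else real N powr (- d) / d)"
    proof (induction N)
      case (Suc N)
      show ?case
      proof (cases "N = 0")
        case False
        have "real (Suc N) powr (- 1 - d) \<le> (real N powr (- d) - real (Suc N) powr (- d)) / d"
          by (rule powr_diff_ge) (use assms False in auto)
        then show ?thesis using Suc False by (simp add: diff_divide_distrib minus_diff_commute)
      qed simp
    qed (use assms in simp)
    moreover have "(if N = 0 then 0 else real N powr (- d) / d) \<ge> 0" using assms by simp
    ultimately show "(\<Sum>n<N. real (Suc n) powr (- d - 1)) \<le> 1 + 1 / d" by linarith
  qed
  finally show ?thesis unfolding zeta1_def by (simp add: mult_left_mono)
qed

lemma zeta1_eq: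
  assumes s: "Re s > 1"
  shows "zeta1 s = (s - 1) * fds (\<lambda>_. 1) s"
proof -
  have S: "summable (\<lambda>n. of_nat n powr (- s) :: complex)"
    using summable_norm_cancel[OF summable_fds_1[OF s]] by simp
  have "(\<lambda>n. of_nat (Suc n) powr (- s)) sums (fds (\<lambda>_. 1) s)"
    using S sums_Suc_iff[of "\<lambda>n. of_nat n powr (- s) :: complex"] by (simp add: fds_def summable_sums)
  moreover have "(\<lambda>n. of_nat (Suc (Suc n)) powr (1 - s) - of_nat (Suc n) powr (1 - s) :: complex) sums (0 - 1)"
  proof -
    have "(\<lambda>n. norm (of_nat (Suc n) powr (1 - s) :: complex)) \<longlonglongrightarrow> 0"
      unfolding norm_of_nat_powr using s
      by (intro tendsto_neg_powr filterlim_compose[OF filterlim_real_sequentially filterlim_Suc]) auto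
    then have "(\<lambda>n. of_nat (Suc n) powr (1 - s) :: complex) \<longlonglongrightarrow> 0" by (rule tendsto_norm_zero_cancel)
    from telescope_sums[OF this] show ?thesis by simp
  qed
  ultimately have "(\<lambda>n. (s - 1) * of_nat (Suc n) powr (- s)
      + (of_nat (Suc (Suc n)) powr (1 - s) - of_nat (Suc n) powr (1 - s))) sums
      ((s - 1) * fds (\<lambda>_. 1) s + (0 - 1))"
    by (intro sums_add sums_mult)
  then show ?thesis by (simp add: zeta1_def zeta1_term_def sums_iff algebra_simps)
qed

lemma fds_1_ne_0: "Re s > 1 \<Longrightarrow> fds (\<lambda>_. 1) s \<noteq> 0"
  using fds_mu_times_zeta by fastforce

text \<open>The reciprocal of zeta is the Dirichlet series of \<open>mu\<close>; its coefficients
  are bounded by 1, so zeta cannot be smaller than (Re s - 1) / Re s in modulus.\<close>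

lemma norm_zeta1_ge:
  assumes s: "Re s > 1"
  shows "norm (zeta1 s) \<ge> norm (s - 1) * (Re s - 1) / Re s"
proof -
  let ?z = "fds (\<lambda>_. 1) s"
  have "1 = norm (fds mu s) * norm ?z" using fds_mu_times_zeta[OF s] by (metis norm_mult norm_one)
  also have "\<dots> \<le> (Re s / (Re s - 1)) * norm ?z"
    using norm_fds_le[where a = mu, OF norm_mu_le s] by (intro mult_right_mono) auto
  finally have "(Re s - 1) / Re s \<le> norm ?z" using s by (simp add: field_simps)
  then have "norm (s - 1) * ((Re s - 1) / Re s) \<le> norm (s - 1) * norm ?z" by (intro mult_left_mono) auto
  then show ?thesis by (simp add: zeta1_eq[OF s] norm_mult)
qed

lemma zeta1_ne_0: "Re s > 1 \<Longrightarrow> zeta1 s \<noteq> 0"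
  using zeta1_eq fds_1_ne_0 by fastforce

lemma fds_1_has_derivative:
  assumes s: "Re s > 1"
  shows "(fds (\<lambda>_. 1) has_field_derivative - fds (\<lambda>n. of_real (ln (real n))) s) (at s)"
proof -
  define f :: "nat \<Rightarrow> complex \<Rightarrow> complex" where "f N s = (\<Sum>n<N. of_nat n powr (- s))" for N s
  define f' :: "nat \<Rightarrow> complex \<Rightarrow> complex" where
    "f' N s = (\<Sum>n<N. - (of_real (ln (real n)) * of_nat n powr (- s)))" for N s
  have "\<exists>g'. \<forall>x \<in> {s. Re s > 1}. (fds (\<lambda>_. 1) has_field_derivative g' x) (at x) \<and> (\<lambda>n. f' n x) \<longlonglongrightarrow> g' x"
  proof (rule has_complex_derivative_uniform_sequence)
    show "open {s. Re s > 1}" by (rule open_halfspace_Re_gt)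
    fix N x assume "x \<in> {s. Re s > 1}"
    have "((\<lambda>s. of_nat n powr (- s)) has_field_derivative - (of_real (ln (real n)) * of_nat n powr (- x))) (at x)"
      for n :: nat
    proof (cases "n = 0")
      case False
      then have "((\<lambda>s. of_nat n powr (- s)) has_field_derivative (Ln (of_nat n) * of_nat n powr (- x)) * (- 1)) (at x)"
        by (intro DERIV_chain2[OF has_field_derivative_powr_right] derivative_eq_intros) auto
      with False show ?thesis by (simp add: Ln_of_nat)
    qed simp
    then show "(f N has_field_derivative f' N x) (at x)"
      unfolding f_def f'_def by (intro DERIV_sum)
  next
    fix z :: complex assume z: "z \<in> {s. Re s > 1}"
    define d where "d = (Re z - 1) / 2"
    have d: "d > 0" using z by (simp add: d_def)
    have Re: "Re s \<ge> 1 + d" if "s \<in> cball z d" for s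
      using that abs_Re_le_cmod[of "z - s"] by (auto simp: d_def dist_norm abs_le_iff field_simps)
    have "uniform_limit (cball z d) f (fds (\<lambda>_. 1)) sequentially"
      unfolding f_def fds_def[abs_def] mult_1
    proof (rule Weierstrass_m_test)
      show "summable (\<lambda>n. real n powr (- 1 - d))" using d by (simp add: summable_real_powr_iff)
      fix n :: nat and s assume s: "s \<in> cball z d"
      show "norm (of_nat n powr (- s) :: complex) \<le> real n powr (- 1 - d)"
        unfolding norm_of_nat_powr using Re[OF s] by (cases "n = 0") (auto intro!: powr_mono)
    qed
    moreover have "cball z d \<subseteq> {s. Re s > 1}" using Re d by fastforce
    ultimately show "\<exists>d>0. cball z d \<subseteq> {s. 1 < Re s} \<and> uniform_limit (cball z d) f (fds (\<lambda>_. 1)) sequentially"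
      using d by blast
  qed
  then obtain g' where g': "(fds (\<lambda>_. 1) has_field_derivative g' s) (at s)" "(\<lambda>n. f' n s) \<longlonglongrightarrow> g' s"
    using s by blast
  have "summable (\<lambda>n. norm (of_real (ln (real n)) * of_nat n powr (- s) :: complex))"
    using s by (intro summable_fds_ln) auto
  from tendsto_minus[OF summable_LIMSEQ[OF summable_norm_cancel[OF this]]]
  have "(\<lambda>n. f' n s) \<longlonglongrightarrow> - fds (\<lambda>n. of_real (ln (real n))) s"
    unfolding f'_def sum_negf fds_def .
  from LIMSEQ_unique[OF g'(2) this] g'(1) show ?thesis by simp
qed

lemma logderiv_zeta1:
  assumes s: "Re s > 1"
  shows "deriv zeta1 s / zeta1 s = 1 / (s - 1) - fds mangoldt s"
proof -
  let ?z = "fds (\<lambda>_. 1)"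
  have nz: "?z s \<noteq> 0" "s - 1 \<noteq> 0" using fds_1_ne_0[OF s] s by auto
  have D: "((\<lambda>s. (s - 1) * ?z s) has_field_derivative (?z s + (s - 1) * (- fds (\<lambda>n. of_real (ln (real n))) s))) (at s)"
    by (auto intro!: derivative_eq_intros fds_1_has_derivative[OF s])
  have "\<forall>\<^sub>F x in nhds s. zeta1 x = (x - 1) * ?z x"
    by (rule eventually_mono[OF eventually_nhds_in_open[OF open_halfspace_Re_gt[of 1]]])
      (use s in \<open>auto simp: zeta1_eq\<close>)
  then have "deriv zeta1 s = deriv (\<lambda>s. (s - 1) * ?z s) s" by (rule deriv_cong_ev) simp
  also have "\<dots> = ?z s + (s - 1) * (- fds (\<lambda>n. of_real (ln (real n))) s)"
    using D by (rule DERIV_imp_deriv)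
  also have "\<dots> = ?z s - (s - 1) * (fds mangoldt s * ?z s)"
    by (simp add: fds_mangoldt_times_zeta[OF s])
  finally show ?thesis using nz by (simp add: zeta1_eq[OF s] divide_simps) (simp add: algebra_simps)
qed

section \<open>The zero-free region\<close>

text \<open>The circles used below have radius 3/4 and centres with real part above 1, so they stay
  in Re z > 1/4. This abscissa yields 1 + 1 / (1/4) = 5, and absorbing the value 1 makes it
  6.\<close>

lemma norm_zeta1_le:
  assumes "Re z \<ge> 1 / 4" "Re z \<le> 3" "\<bar>Im z\<bar> \<le> \<tau>"
  shows "norm (zeta1 z) \<le> 6 * (\<tau> + 3)\<^sup>2"
proof -
  have \<tau>: "\<tau> \<ge> 0" using assms(3) by linarith
  have 1: "norm z \<le> \<tau> + 3" using cmod_le[of z] assms by linarith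
  have 2: "norm (z - 1) \<le> \<tau> + 3" using cmod_le[of "z - 1"] assms by (simp add: abs_if split: if_splits)
  have "norm (zeta1 z) \<le> norm (zeta1 z - 1) + norm (1 :: complex)" using norm_triangle_sub[of "zeta1 z" 1] by (simp add: add.commute)
  also have "\<dots> \<le> norm (z - 1) * norm z * (1 + 1 / (1 / 4)) + 1"
    using norm_zeta1_minus_1_le[of "1 / 4" z] assms by simp
  also have "\<dots> \<le> ((\<tau> + 3) * (\<tau> + 3)) * 5 + 1"
    using 1 2 \<tau> by (intro add_right_mono mult_mono) auto
  also have "\<dots> \<le> ((\<tau> + 3) * (\<tau> + 3)) * 5 + (\<tau> + 3) * (\<tau> + 3)"
    using mult_mono[of 1 "\<tau> + 3" 1 "\<tau> + 3"] \<tau> by simp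
  finally show ?thesis by (simp add: power2_eq_square)
qed

lemma zeta1_zero_Re_le: "zeta1 z = 0 \<Longrightarrow> Re z \<le> 1"
  using zeta1_ne_0 by force

lemma ln_5_ge: "1 \<le> ln (5::real)"
  using ln_ge_iff[of 5 1] exp_le by simp

text \<open>The local lemmas cost the logarithm of B over the value at the centre, which
  \<open>norm_zeta1_ge\<close> keeps away from 0. The shift 5 makes (\<tau> + 5)^2 at least 24,
  which absorbs the factor 12 / (1/2).\<close>

lemma ln_zeta1_ratio_le:
  assumes \<sigma>: "1 < \<sigma>" "\<sigma> \<le> 2" and \<tau>: "\<bar>t\<bar> \<le> \<tau>" and B: "B \<le> 12 * (\<tau> + 5)\<^sup>2" "B > 0"
  shows "ln (B / norm (zeta1 (Complex \<sigma> t))) \<le> 4 * ln (\<tau> + 5) + 2 * ln (1 / (\<sigma> - 1))"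
proof -
  let ?Z = "norm (zeta1 (Complex \<sigma> t))"
  have \<tau>0: "\<tau> \<ge> 0" using \<tau> by linarith
  have "\<sigma> - 1 \<le> norm (Complex \<sigma> t - 1)" using abs_Re_le_cmod[of "Complex \<sigma> t - 1"] \<sigma> by simp
  then have "(\<sigma> - 1) * (\<sigma> - 1) / 2 \<le> norm (Complex \<sigma> t - 1) * (\<sigma> - 1) / \<sigma>"
    using \<sigma> by (intro frac_le mult_right_mono) auto
  also have "\<dots> \<le> ?Z" using norm_zeta1_ge[of "Complex \<sigma> t"] \<sigma> by simp
  finally have Z: "(\<sigma> - 1)\<^sup>2 / 2 \<le> ?Z" by (simp add: power2_eq_square)
  have pos: "(\<sigma> - 1)\<^sup>2 / 2 > 0" using \<sigma> by simp
  have Zpos: "?Z > 0" using Z pos by linarith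
  have "B / ?Z \<le> 12 * (\<tau> + 5)\<^sup>2 / ((\<sigma> - 1)\<^sup>2 / 2)"
    using Z pos B by (intro frac_le) auto
  also have "\<dots> \<le> (\<tau> + 5) ^ 4 * (1 / (\<sigma> - 1))\<^sup>2"
  proof -
    have "(24::real) \<le> (\<tau> + 5)\<^sup>2" using power_mono[of 5 "\<tau> + 5" 2] \<tau>0 by simp
    then have "24 * (\<tau> + 5)\<^sup>2 \<le> (\<tau> + 5)\<^sup>2 * (\<tau> + 5)\<^sup>2" by (intro mult_right_mono) auto
    also have "\<dots> = (\<tau> + 5) ^ 4" by (simp flip: power_add)
    finally show ?thesis using \<sigma> by (simp add: power_divide divide_right_mono)
  qed
  finally have "ln (B / ?Z) \<le> ln ((\<tau> + 5) ^ 4 * (1 / (\<sigma> - 1))\<^sup>2)"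
    using Zpos B by (intro ln_mono) auto
  also have "\<dots> = 4 * ln (\<tau> + 5) + 2 * ln (1 / (\<sigma> - 1))"
    using \<sigma> \<tau>0 by (simp add: ln_mult ln_realpow)
  finally show ?thesis .
qed

lemma sphere_zeta1_le:
  assumes \<sigma>: "1 < \<sigma>" "\<sigma> \<le> 2" and z: "z \<in> sphere (Complex \<sigma> t) (3 * (1 / 4))"
  shows "norm (zeta1 z) \<le> 6 * (\<bar>t\<bar> + 5)\<^sup>2"
proof -
  have "norm (z - Complex \<sigma> t) = 3 / 4" using z by (simp add: dist_norm norm_minus_commute)
  then have "\<bar>Re z - \<sigma>\<bar> \<le> 3 / 4" "\<bar>Im z - t\<bar> \<le> 3 / 4"
    using abs_Re_le_cmod[of "z - Complex \<sigma> t"] abs_Im_le_cmod[of "z - Complex \<sigma> t"] by auto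
  then have "norm (zeta1 z) \<le> 6 * (\<bar>t\<bar> + 1 + 3)\<^sup>2" using \<sigma> by (intro norm_zeta1_le) linarith+
  also have "\<dots> \<le> 6 * (\<bar>t\<bar> + 5)\<^sup>2" by (intro mult_left_mono power_mono) auto
  finally show ?thesis .
qed

lemma ball_zeta1_holomorphic:
  assumes "\<sigma> > 1" shows "zeta1 holomorphic_on ball (Complex \<sigma> t) 1"
proof (rule holomorphic_on_subset[OF zeta1_holomorphic], rule subsetI)
  fix z assume "z \<in> ball (Complex \<sigma> t) 1"
  then have "\<bar>Re (Complex \<sigma> t - z)\<bar> < 1"
    using abs_Re_le_cmod[of "Complex \<sigma> t - z"] by (simp add: dist_norm)
  then show "z \<in> {s. 0 < Re s}" using assms by auto
qed

lemma Re_divide_of_real: "Re (1 / of_real x) = 1 / x"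
proof -
  have "1 / complex_of_real x = complex_of_real (1 / x)" by simp
  then show ?thesis by (simp only: Re_complex_of_real)
qed

text \<open>\<open>Re_logderiv_ge\<close> with r = 1/4 and R = 1: the factor 2 / r = 8 turns the 4
  and 2 of \<open>ln_zeta1_ratio_le\<close> into 32 and 16.\<close>

lemma Re_logderiv_zeta1_ge:
  assumes \<sigma>: "1 < \<sigma>" "\<sigma> \<le> 2"
  shows "- Re (deriv zeta1 (Complex \<sigma> t) / zeta1 (Complex \<sigma> t))
    \<le> 32 * ln (\<bar>t\<bar> + 5) + 16 * ln (1 / (\<sigma> - 1))"
proof -
  let ?s = "Complex \<sigma> t"
  have nz: "zeta1 ?s \<noteq> 0" using \<sigma> by (intro zeta1_ne_0) auto
  have "- (2 * ln (2 * (6 * (\<bar>t\<bar> + 5)\<^sup>2) / norm (zeta1 ?s)) / (1 / 4)) \<le> Re (deriv zeta1 ?s / zeta1 ?s)"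
  proof (rule Re_logderiv_ge[where R = 1])
    show "zeta1 holomorphic_on ball ?s 1" by (rule ball_zeta1_holomorphic[OF \<sigma>(1)])
    show "norm (zeta1 z) \<le> 6 * (\<bar>t\<bar> + 5)\<^sup>2" if "z \<in> sphere ?s (3 * (1 / 4))" for z
      using sphere_zeta1_le[OF \<sigma> that] .
    show "Re z \<le> Re ?s" if "zeta1 z = 0" for z using zeta1_zero_Re_le[OF that] \<sigma> by simp
  qed (use nz in auto)
  moreover have "ln (2 * (6 * (\<bar>t\<bar> + 5)\<^sup>2) / norm (zeta1 ?s)) \<le> 4 * ln (\<bar>t\<bar> + 5) + 2 * ln (1 / (\<sigma> - 1))"
    by (rule ln_zeta1_ratio_le[OF \<sigma>]) auto
  ultimately show ?thesis by simp
qed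

text \<open>For a zero at the same height as the centre the difference of the two is real, so the
  retained term is exactly 1 / (\<sigma> - \<beta>). The condition with 1/4 places the zero in the
  inner disc.\<close>

lemma Re_logderiv_zeta1_zero_ge:
  assumes \<sigma>: "1 < \<sigma>" "\<sigma> \<le> 2" and \<rho>: "zeta1 (Complex \<beta> t) = 0" "\<sigma> - \<beta> \<le> 1 / 4"
  shows "- Re (deriv zeta1 (Complex \<sigma> t) / zeta1 (Complex \<sigma> t))
    \<le> 32 * ln (\<bar>t\<bar> + 5) + 16 * ln (1 / (\<sigma> - 1)) - 1 / (\<sigma> - \<beta>)"
proof -
  let ?s = "Complex \<sigma> t" and ?\<rho> = "Complex \<beta> t"
  have nz: "zeta1 ?s \<noteq> 0" using \<sigma> by (intro zeta1_ne_0) auto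
  have \<beta>: "\<beta> \<le> 1" using zeta1_zero_Re_le[OF \<rho>(1)] by simp
  have diff: "?s - ?\<rho> = of_real (\<sigma> - \<beta>)" by (simp add: complex_eq_iff)
  have "- (2 * ln ((6 * (\<bar>t\<bar> + 5)\<^sup>2) / norm (zeta1 ?s)) / (1 / 4)) + Re (1 / (?s - ?\<rho>))
      \<le> Re (deriv zeta1 ?s / zeta1 ?s)"
  proof (rule Re_logderiv_ge_zero[where R = 1])
    show "zeta1 holomorphic_on ball ?s 1" by (rule ball_zeta1_holomorphic[OF \<sigma>(1)])
    show "norm (zeta1 z) \<le> 6 * (\<bar>t\<bar> + 5)\<^sup>2" if "z \<in> sphere ?s (3 * (1 / 4))" for z
      using sphere_zeta1_le[OF \<sigma> that] .
    show "Re z \<le> Re ?s" if "zeta1 z = 0" for z using zeta1_zero_Re_le[OF that] \<sigma> by simp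
    show "?\<rho> \<in> cball ?s (1 / 4)"
      using \<rho>(2) \<beta> \<sigma> unfolding mem_cball dist_norm diff norm_of_real by simp
  qed (use nz \<rho> in auto)
  moreover have "Re (1 / (?s - ?\<rho>)) = 1 / (\<sigma> - \<beta>)"
    unfolding diff by (rule Re_divide_of_real)
  moreover have "ln ((6 * (\<bar>t\<bar> + 5)\<^sup>2) / norm (zeta1 ?s)) \<le> 4 * ln (\<bar>t\<bar> + 5) + 2 * ln (1 / (\<sigma> - 1))"
    by (rule ln_zeta1_ratio_le[OF \<sigma>]) auto
  ultimately show ?thesis by simp
qed

text \<open>Away from the real axis this bounds the contribution of the pole of zeta uniformly as
  \<sigma> tends to 1.\<close>

lemma Re_inverse_le:
  assumes "a > 0" "t \<noteq> 0"
  shows "Re (1 / Complex a t) \<le> 1 / (2 * \<bar>t\<bar>)"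
proof -
  have "2 * a * \<bar>t\<bar> \<le> a\<^sup>2 + t\<^sup>2"
    using sum_squares_bound[of a "\<bar>t\<bar>"] by simp
  then have "a / (a\<^sup>2 + t\<^sup>2) \<le> 1 / (2 * \<bar>t\<bar>)"
    using assms by (simp add: field_simps add_pos_pos)
  then show ?thesis by (simp add: Re_divide)
qed

text \<open>Close to the real axis the pole term at height t can be as large as the one at height 0,
  and the 3-4-1 inequality gives nothing. There \<open>zeta1\<close> is compared with its value 1 at
  s = 1 instead.\<close>

lemma zeta1_ne_0_near_1:
  assumes "\<bar>Im s\<bar> \<le> 1 / 8" "Re s \<ge> 1 - 1 / 32"
  shows "zeta1 s \<noteq> 0"
proof
  assume 0: "zeta1 s = 0"
  then have "Re s \<le> 1" by (rule zeta1_zero_Re_le)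
  then have "norm (s - 1) \<le> 5 / 32" "norm s \<le> 9 / 8"
    using cmod_le[of "s - 1"] cmod_le[of s] assms by auto
  then have "norm (s - 1) * norm s * (1 + 1 / (1 / 2)) \<le> (5 / 32 * (9 / 8)) * 3"
    by (intro mult_mono) auto
  moreover have "norm (zeta1 s - 1) \<le> norm (s - 1) * norm s * (1 + 1 / (1 / 2))"
    by (rule norm_zeta1_minus_1_le) (use assms in auto)
  moreover have "norm (zeta1 s - 1) = 1" using 0 by simp
  ultimately show False by linarith
qed

text \<open>The 3-4-1 inequality is used at \<sigma> = 1 + 1 / (A \<open>\<l>\<close>). The pole
  contributes 3 A \<open>\<l>\<close>, the zero contributes -4 / (\<sigma> - \<beta>), and all the
  rest is a fixed multiple of \<open>\<l>\<close>. Since 3 < 4, a large A forces \<sigma> - \<beta>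
  to exceed \<sigma> - 1 by a fixed factor.\<close>

lemma zeta1_zero_free:
  assumes zero: "zeta1 s = 0"
  shows "Re s \<le> 1 - 1 / (65536 * ln (\<bar>Im s\<bar> + 5))"
proof -
  define t \<beta> \<l> where "t = Im s" "\<beta> = Re s" "\<l> = ln (\<bar>t\<bar> + 5)"
  note defs = this
  have s: "s = Complex \<beta> t" by (simp add: defs complex_eq_iff)
  have "ln 5 \<le> \<l>" by (simp add: defs)
  then have \<l>: "\<l> \<ge> 1" using ln_5_ge by linarith
  show ?thesis
  proof (cases "\<bar>t\<bar> \<le> 1 / 8")
    case True
    with zeta1_ne_0_near_1[of s] zero have "Re s < 1 - 1 / 32" by (force simp: defs)
    moreover have "1 / (65536 * \<l>) \<le> 1 / 32" using \<l> by (intro divide_left_mono) auto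
    ultimately show ?thesis unfolding defs by linarith
  next
    case False
    \<comment> \<open>A = 8192 makes the remaining terms at most A \<open>\<l>\<close> / 2 in total,
      so that 4 / (\<sigma> - \<beta>) is at most (7/2) A \<open>\<l>\<close>. This is the origin of
      28672 and of 8/7.\<close>
    define \<sigma> where "\<sigma> = 1 + 1 / (8192 * \<l>)"
    have inv: "1 / (\<sigma> - 1) = 8192 * \<l>" using \<l> by (simp add: \<sigma>_def)
    have "1 / (8192 * \<l>) \<le> 1 / 8192" using \<l> by (intro divide_left_mono) auto
    then have \<sigma>: "1 < \<sigma>" "\<sigma> \<le> 1 + 1 / 8192" using \<l> by (auto simp: \<sigma>_def)
    have \<sigma>2: "\<sigma> \<le> 2" using \<sigma> by simp
    have \<beta>1: "\<beta> \<le> 1" using zeta1_zero_Re_le[OF zero] by (simp add: defs)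
    have "\<sigma> - \<beta> \<ge> 8 / 7 * (1 / (8192 * \<l>))"
    proof (cases "\<sigma> - \<beta> \<le> 1 / 4")
      case le: True
      have ln_inv: "ln (1 / (\<sigma> - 1)) \<le> 14 * \<l>"
      proof -
        have "ln (1 / (\<sigma> - 1)) = ln (2 ^ 13) + ln \<l>" unfolding inv using \<l> ln_mult[of "2 ^ 13" \<l>] by simp
        also have "ln (2 ^ 13 :: real) = 13 * ln 2" by (subst ln_realpow) auto
        finally show ?thesis using \<l> ln_le_minus_one[of \<l>] ln_le_minus_one[of "2::real"] by simp
      qed
      define D where "D u = Re (deriv zeta1 (Complex \<sigma> u) / zeta1 (Complex \<sigma> u))" for u
      have mang: "Re (fds mangoldt (Complex \<sigma> u)) = Re (1 / Complex (\<sigma> - 1) u) - D u" for u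
      proof -
        have "Complex \<sigma> u - 1 = Complex (\<sigma> - 1) u" by (simp add: complex_eq_iff)
        then show ?thesis using logderiv_zeta1[of "Complex \<sigma> u"] \<sigma> by (simp add: D_def)
      qed
      have "0 \<le> 3 * Re (fds mangoldt (Complex \<sigma> 0)) + 4 * Re (fds mangoldt (Complex \<sigma> t))
        + Re (fds mangoldt (Complex \<sigma> (2 * t)))"
        using mangoldt_3_4_1[OF \<sigma>(1), of t] by (simp add: complex_of_real_def)
      moreover have "Re (1 / Complex (\<sigma> - 1) 0) = 8192 * \<l>"
      proof -
        have "Complex (\<sigma> - 1) 0 = of_real (\<sigma> - 1)" by (simp add: complex_eq_iff)
        then show ?thesis using inv by (simp only: Re_divide_of_real)
      qed
      moreover have "Re (1 / Complex (\<sigma> - 1) t) \<le> 4 * \<l>"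
      proof -
        have "Re (1 / Complex (\<sigma> - 1) t) \<le> 1 / (2 * \<bar>t\<bar>)"
          using \<sigma> False by (intro Re_inverse_le) auto
        also have "\<dots> \<le> 1 / (2 * (1 / 8))" using False by (intro divide_left_mono) auto
        finally show ?thesis using \<l> by simp
      qed
      moreover have "Re (1 / Complex (\<sigma> - 1) (2 * t)) \<le> 4 * \<l>"
      proof -
        have "Re (1 / Complex (\<sigma> - 1) (2 * t)) \<le> 1 / (2 * \<bar>2 * t\<bar>)"
          using \<sigma> False by (intro Re_inverse_le) auto
        also have "\<dots> \<le> 1 / (2 * (1 / 8))" using False by (intro divide_left_mono) auto
        finally show ?thesis using \<l> by simp
      qed
      moreover have "- D 0 \<le> 32 * \<l> + 16 * (14 * \<l>)"
        using Re_logderiv_zeta1_ge[OF \<sigma>(1) \<sigma>2, of 0] ln_inv \<open>ln 5 \<le> \<l>\<close> by (simp add: D_def)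
      moreover have "- D (2 * t) \<le> 64 * \<l> + 16 * (14 * \<l>)"
      proof -
        have "\<bar>2 * t\<bar> + 5 \<le> (\<bar>t\<bar> + 5) ^ 2" by (simp add: power2_eq_square algebra_simps abs_mult)
        then have "ln (\<bar>2 * t\<bar> + 5) \<le> ln ((\<bar>t\<bar> + 5) ^ 2)" by (intro ln_mono) auto
        also have "\<dots> = 2 * \<l>" unfolding defs by (subst ln_realpow) auto
        finally show ?thesis
          using Re_logderiv_zeta1_ge[OF \<sigma>(1) \<sigma>2, of "2 * t"] ln_inv unfolding D_def by linarith
      qed
      moreover have "- D t \<le> 32 * \<l> + 16 * (14 * \<l>) - 1 / (\<sigma> - \<beta>)"
        using Re_logderiv_zeta1_zero_ge[OF \<sigma>(1) \<sigma>2 _ le, of t] zero ln_inv s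
        unfolding D_def defs(3) by simp
      ultimately have "4 / (\<sigma> - \<beta>) \<le> 28672 * \<l>" using \<l> unfolding mang by simp
      then show ?thesis using \<sigma> \<beta>1 \<l> by (simp add: field_simps)
    next
      case False
      have "8 / 7 * (1 / (8192 * \<l>)) \<le> 8 / 7 * (1 / 8192)" using \<l> by (intro mult_left_mono divide_left_mono) auto
      then show ?thesis using False by linarith
    qed
    then have "1 - \<beta> \<ge> 1 / 7 * (1 / (8192 * \<l>))" unfolding \<sigma>_def by linarith
    moreover have "1 / (65536 * \<l>) \<le> 1 / 7 * (1 / (8192 * \<l>))" using \<l> by (simp add: field_simps)
    ultimately show ?thesis unfolding defs by linarith
  qed
qed

text \<open>The quotient (s - 1) / \<open>zeta1 s\<close> is 1 / zeta. The point \<open>s0\<close>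
  lies at distance d to the right of Re s = 1, where the series of \<open>mu\<close> bounds
  \<open>zeta1\<close> from below. The disc of radius q + d about it stays inside the zero-free
  region of width q, and Borel-Caratheodory carries the lower bound from \<open>s0\<close> to
  s.\<close>

lemma inverse_zeta1_bound:
  defines "\<kappa> \<equiv> 1 / 2 ^ 30 :: real"
  assumes T: "T \<ge> 1" and t: "\<bar>Im s\<bar> \<le> T" and \<sigma>: "\<bar>Re s - 1\<bar> \<le> \<kappa> / ln (T + 6)"
  shows "zeta1 s \<noteq> 0" and "norm ((s - 1) / zeta1 s) \<le> 6 / \<kappa> * ln (T + 6) * sqrt (T + 6)"
proof -
  define \<l> where "\<l> = ln (T + 6)"
  define d where "d = \<kappa> / \<l>"
  \<comment> \<open>b is the constant of \<open>zeta1_zero_free\<close>, and \<kappa> is b /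
    2^14.\<close>
  define b where "b = 1 / (65536::real)"
  define q where "q = b / \<l>"
  have "ln 5 \<le> \<l>" using T by (simp add: \<l>_def)
  then have \<l>: "\<l> \<ge> 1" using ln_5_ge by linarith
  have \<kappa>: "\<kappa> > 0" by (simp add: \<kappa>_def)
  have d: "0 < d" "d \<le> 1 / 2 ^ 30" using \<l> \<kappa> by (auto simp: d_def \<kappa>_def field_simps)
  have bl: "q \<le> b" using \<l> by (simp add: q_def b_def field_simps)
  define s0 where "s0 = Complex (1 + d) (Im s)"
  define r where "r = q + d"
  have bpos: "q > 0" using \<l> by (simp add: q_def b_def)
  have d8: "d \<le> 1 / 8" using d(2) by simp
  then have r0: "r > 0" "r \<le> 1 / 4"
    using d(1) bl bpos b_def unfolding r_def by linarith+
  have ball: "Re z > 1 - q" "Re z \<le> 2" "\<bar>Im z\<bar> \<le> T + 1" if "z \<in> ball s0 r" for z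
  proof -
    have "norm (s0 - z) < r" using that by (simp add: dist_norm)
    then have "\<bar>1 + d - Re z\<bar> < r" "\<bar>Im s - Im z\<bar> < r"
      using abs_Re_le_cmod[of "s0 - z"] abs_Im_le_cmod[of "s0 - z"] by (auto simp: s0_def)
    moreover have "r = q + d" by (simp add: r_def)
    ultimately show "Re z > 1 - q" "Re z \<le> 2" "\<bar>Im z\<bar> \<le> T + 1"
      using r0 t d(1) d8 by linarith+
  qed
  have nz: "zeta1 z \<noteq> 0" if "z \<in> ball s0 r" for z
  proof
    assume "zeta1 z = 0"
    then have "Re z \<le> 1 - 1 / (65536 * ln (\<bar>Im z\<bar> + 5))" by (rule zeta1_zero_free)
    moreover have "1 / (65536 * \<l>) \<le> 1 / (65536 * ln (\<bar>Im z\<bar> + 5))"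
      unfolding \<l>_def using ball(3)[OF that] T by (intro divide_left_mono mult_left_mono ln_mono mult_pos_pos) auto
    ultimately show False using ball(1)[OF that] by (simp add: q_def b_def)
  qed
  have hol: "zeta1 holomorphic_on ball s0 r"
    by (rule holomorphic_on_subset[OF ball_zeta1_holomorphic[of "1 + d" "Im s"]])
       (use d r0 in \<open>auto simp: s0_def\<close>)
  define B where "B = 6 * (T + 6)\<^sup>2"
  have B: "norm (zeta1 z) < B" if "z \<in> ball s0 r" for z
  proof -
    have "norm (zeta1 z) \<le> 6 * (T + 1 + 3)\<^sup>2"
      using ball[OF that] bl by (intro norm_zeta1_le) (auto simp: b_def)
    also have "\<dots> < B" unfolding B_def using T by (intro mult_strict_left_mono power_strict_mono) auto
    finally show ?thesis .
  qed
  define M where "M = ln (B / norm (zeta1 s0))"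
  have M: "M \<le> \<l> * 66"
  proof -
    have "M \<le> 4 * ln (T + 1 + 5) + 2 * ln (1 / (1 + d - 1))"
      unfolding M_def s0_def
    proof (rule ln_zeta1_ratio_le)
      have eq: "T + 1 + 5 = T + 6" by simp
      show "B \<le> 12 * (T + 1 + 5)\<^sup>2" unfolding B_def eq by simp
      show "B > 0" using T by (simp add: B_def)
    qed (use d t in auto)
    also have "ln (1 / (1 + d - 1)) = ln (\<l> * 2 ^ 30)" using \<l> by (simp add: d_def \<kappa>_def)
    also have "\<dots> = ln \<l> + ln (2 ^ 30)" using \<l> ln_mult[of \<l> "2 ^ 30"] by simp
    also have "ln (2 ^ 30 :: real) = 30 * ln 2" by (subst ln_realpow) auto
    also have "ln \<l> + 30 * ln 2 \<le> 31 * \<l>" using \<l> ln_le_minus_one[of \<l>] ln_le_minus_one[of "2::real"] by simp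
    finally show ?thesis by (simp add: \<l>_def add.commute)
  qed
  have s_s0: "s - s0 = of_real (Re s - 1 - d)" by (simp add: s0_def complex_eq_iff)
  have \<rho>: "norm (s - s0) \<le> 2 * d" using \<sigma> d unfolding s_s0 norm_of_real by (simp add: d_def \<l>_def abs_le_iff)
  have db: "d = q / 2 ^ 14" using \<l> by (simp add: q_def d_def b_def \<kappa>_def)
  have "d = q / 16384" unfolding db by simp
  then have gap: "r - norm (s - s0) \<ge> q / 2" using \<rho> bpos unfolding r_def by linarith
  have s: "s \<in> ball s0 r" using gap bpos by (simp add: dist_norm norm_minus_commute)
  show "zeta1 s \<noteq> 0" by (rule nz[OF s])
  have M0: "M \<ge> 0" using B[of s0] nz[of s0] r0 by (simp add: M_def)
  \<comment> \<open>The ratio d / q = 2^-14 outweighs the factor 66, so the exponent is at most half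
    of ln (T + 6); this costs a factor sqrt (T + 6).\<close>
  have "2 * M * norm (s - s0) / (r - norm (s - s0)) \<le> 2 * (\<l> * 66) * (2 * d) / (q / 2)"
    using M M0 \<rho> gap bpos \<l> d(1) by (intro frac_le mult_mono) auto
  also have "\<dots> = 2 * (\<l> * 66) * 4 / 2 ^ 14" unfolding db using bpos by simp
  also have "\<dots> \<le> \<l> / 2" using \<l> by simp
  finally have E: "exp (- (\<l> / 2)) \<le> exp (- (2 * M * norm (s - s0) / (r - norm (s - s0))))" by simp
  have "norm (zeta1 s0) * exp (- (\<l> / 2)) \<le> norm (zeta1 s)"
    using nonzero_disc_bounds(2)[OF hol r0(1) nz B s] E
    by (intro order.trans[OF mult_left_mono[OF E]]) (auto simp: M_def)
  moreover have "norm (s0 - 1) * (d / 2) \<le> norm (zeta1 s0)"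
  proof -
    have "norm (s0 - 1) * d / 2 \<le> norm (s0 - 1) * d / (1 + d)" using d by (intro divide_left_mono) auto
    also have "\<dots> \<le> norm (zeta1 s0)" using norm_zeta1_ge[of s0] d by (simp add: s0_def)
    finally show ?thesis by simp
  qed
  ultimately have Z: "norm (s0 - 1) * (d / 2) * exp (- (\<l> / 2)) \<le> norm (zeta1 s)"
    by (meson exp_ge_zero mult_right_mono order.trans)
  have s01: "d \<le> norm (s0 - 1)" using abs_Re_le_cmod[of "s0 - 1"] d by (simp add: s0_def)
  have "norm (s - 1) \<le> norm (s - s0) + norm (s0 - 1)" using norm_triangle_ineq[of "s - s0" "s0 - 1"] by simp
  \<comment> \<open>Numerator and denominator are both measured by |s0 - 1|, which then
    cancels.\<close>
  then have s1: "norm (s - 1) \<le> 3 * norm (s0 - 1)" using \<rho> s01 by linarith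
  have "norm (s - 1) / norm (zeta1 s) \<le> 3 * norm (s0 - 1) / (norm (s0 - 1) * (d / 2) * exp (- (\<l> / 2)))"
  proof (rule frac_le[OF _ s1 _ Z])
    show "0 < norm (s0 - 1) * (d / 2) * exp (- (\<l> / 2))"
      by (intro mult_pos_pos) (use s01 d in linarith, use d in auto)
  qed auto
  also have "\<dots> = 6 / d * exp (\<l> / 2)"
  proof -
    have "norm (s0 - 1) > 0" using s01 d by linarith
    then show ?thesis by (simp add: exp_minus field_simps)
  qed
  also have "exp (\<l> / 2) = sqrt (T + 6)"
  proof -
    have "exp (\<l> / 2) ^ 2 = T + 6" using T by (simp add: \<l>_def flip: exp_double)
    then show ?thesis by (metis exp_ge_zero real_sqrt_unique)
  qed
  also have "6 / d = 6 / \<kappa> * \<l>" using \<l> by (simp add: d_def)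
  finally show "norm ((s - 1) / zeta1 s) \<le> 6 / \<kappa> * ln (T + 6) * sqrt (T + 6)"
    by (simp add: norm_divide \<l>_def)
qed

section \<open>Newman's contour argument\<close>

lemma powr_MVT:
  assumes "n \<ge> (1::nat)"
  obtains z where "real n < z" "z < real (Suc n)" "real (Suc n) powr y - real n powr y = y * z powr (y - 1)"
proof -
  have "\<exists>z. real n < z \<and> z < real (Suc n) \<and>
    real (Suc n) powr y - real n powr y = (real (Suc n) - real n) * (y * z powr (y - 1))"
    using assms by (intro MVT2) (auto intro!: derivative_eq_intros)
  then show ?thesis using that by auto
qed

text \<open>Comparison with the integral of z^(y-1). For y <= 1 the summands do not increase and N^y
  / y suffices; for y > 1 they increase and the last one, N^y / N, is added.\<close>

lemma sum_powr_le:
  assumes y: "y > 0" and N: "N \<ge> (1::nat)"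
  shows "(\<Sum>n=1..N. real n powr (y - 1)) \<le> real N powr y * (1 / y + 1 / real N)"
proof -
  have eq: "real N powr y * (1 / y + 1 / real N) = real N powr y / y + real N powr (y - 1)"
    using N by (simp add: powr_diff field_simps)
  show ?thesis
  proof (cases "y \<le> 1")
    case True
    have "(\<Sum>n=1..N. real n powr (y - 1)) \<le> real N powr y / y"
      using N
    proof (induction N rule: dec_induct)
      case base
      then show ?case using y True by simp
    next
      case (step N)
      obtain z where z: "real N < z" "z < real (Suc N)" "real (Suc N) powr y - real N powr y = y * z powr (y - 1)"
        using powr_MVT step.hyps by blast
      have "real (Suc N) powr (y - 1) \<le> z powr (y - 1)" using z True step.hyps by (intro powr_mono2') auto
      also have "\<dots> = real (Suc N) powr y / y - real N powr y / y" using z(3) y by (simp flip: diff_divide_distrib)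
      finally show ?case using step.IH step.hyps by (simp del: of_nat_Suc)
    qed
    then show ?thesis unfolding eq using powr_ge_zero[of "real N" "y - 1"] by linarith
  next
    case False
    have "(\<Sum>n=1..N. real n powr (y - 1)) \<le> real N powr y / y + real N powr (y - 1)"
      using N
    proof (induction N rule: dec_induct)
      case base
      then show ?case using y by simp
    next
      case (step N)
      obtain z where z: "real N < z" "z < real (Suc N)" "real (Suc N) powr y - real N powr y = y * z powr (y - 1)"
        using powr_MVT step.hyps by blast
      have "real N powr (y - 1) \<le> z powr (y - 1)" using z False step.hyps by (intro powr_mono2) auto
      also have "\<dots> = real (Suc N) powr y / y - real N powr y / y" using z(3) y by (simp flip: diff_divide_distrib)
      finally show ?case using step.IH step.hyps by (simp del: of_nat_Suc)
    qed
    then show ?thesis unfolding eq .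
  qed
qed

text \<open>A rectangle cut along the imaginary axis, in place of the usual circle. The left part
  has its own width d, because two integrands will be followed to the left over different
  distances.\<close>

definition right_int :: "real \<Rightarrow> (complex \<Rightarrow> complex) \<Rightarrow> complex" where
  "right_int R f = contour_integral (linepath (Complex 0 (- R)) (Complex R (- R))) f
    + contour_integral (linepath (Complex R (- R)) (Complex R R)) f
    + contour_integral (linepath (Complex R R) (Complex 0 R)) f"

definition left_int :: "real \<Rightarrow> real \<Rightarrow> (complex \<Rightarrow> complex) \<Rightarrow> complex" where
  "left_int d R f = contour_integral (linepath (Complex 0 R) (Complex (- d) R)) f
    + contour_integral (linepath (Complex (- d) R) (Complex (- d) (- R))) f
    + contour_integral (linepath (Complex (- d) (- R)) (Complex 0 (- R))) f"

lemma closed_segment_horizontal: "closed_segment (Complex a c) (Complex b c) = {z. Im z = c \<and> min a b \<le> Re z \<and> Re z \<le> max a b}"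
  by (subst closed_segment_same_Im) (auto simp: closed_segment_eq_real_ivl)

lemma closed_segment_vertical: "closed_segment (Complex c a) (Complex c b) = {z. Re z = c \<and> min a b \<le> Im z \<and> Im z \<le> max a b}"
  by (subst closed_segment_same_Re) (auto simp: closed_segment_eq_real_ivl)

lemma contour_integral_rectpath_split:
  assumes d: "d > 0" and R: "R > 0"
    and cont: "continuous_on (cbox (Complex (- d) (- R)) (Complex R R) - {0}) f"
  shows "contour_integral (rectpath (Complex (- d) (- R)) (Complex R R)) f = right_int R f + left_int d R f"
proof -
  let ?S = "cbox (Complex (- d) (- R)) (Complex R R) - {0}"
  have c: "continuous_on (closed_segment a b) f" if "closed_segment a b \<subseteq> ?S" for a b
    using continuous_on_subset[OF cont that] .
  note int = contour_integrable_continuous_linepath[OF c]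
  have sub: "closed_segment (Complex (- d) (- R)) (Complex R (- R)) \<subseteq> ?S"
    "closed_segment (Complex R (- R)) (Complex R R) \<subseteq> ?S"
    "closed_segment (Complex R R) (Complex (- d) R) \<subseteq> ?S"
    "closed_segment (Complex (- d) R) (Complex (- d) (- R)) \<subseteq> ?S"
    unfolding closed_segment_horizontal closed_segment_vertical using d R by (auto simp: in_cbox_complex_iff)
  have "contour_integral (rectpath (Complex (- d) (- R)) (Complex R R)) f
    = contour_integral (linepath (Complex (- d) (- R)) (Complex R (- R))) f
    + contour_integral (linepath (Complex R (- R)) (Complex R R)) f
    + contour_integral (linepath (Complex R R) (Complex (- d) R)) f
    + contour_integral (linepath (Complex (- d) R) (Complex (- d) (- R))) f"
    unfolding rectpath_def Let_def
    using int[OF sub(1)] int[OF sub(2)] int[OF sub(3)] int[OF sub(4)]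
    by (simp add: contour_integrable_joinI valid_path_join)
  also have "contour_integral (linepath (Complex (- d) (- R)) (Complex R (- R))) f
    = contour_integral (linepath (Complex (- d) (- R)) (Complex 0 (- R))) f
    + contour_integral (linepath (Complex 0 (- R)) (Complex R (- R))) f"
    by (rule contour_integral_split_linepath[OF c[OF sub(1)]]) (use d R in \<open>auto simp: closed_segment_horizontal\<close>)
  also have "contour_integral (linepath (Complex R R) (Complex (- d) R)) f
    = contour_integral (linepath (Complex R R) (Complex 0 R)) f
    + contour_integral (linepath (Complex 0 R) (Complex (- d) R)) f"
    by (rule contour_integral_split_linepath[OF c[OF sub(3)]]) (use d R in \<open>auto simp: closed_segment_horizontal\<close>)
  finally show ?thesis by (simp add: right_int_def left_int_def)
qed

lemma norm_right_int_le:
  assumes R: "R > 0" and cont: "continuous_on {z. 0 \<le> Re z \<and> \<bar>Im z\<bar> \<le> R \<and> z \<noteq> 0} f" and B: "B \<ge> 0"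
    and h: "\<And>z. 0 \<le> Re z \<Longrightarrow> Re z \<le> R \<Longrightarrow> \<bar>Im z\<bar> = R \<Longrightarrow> norm (f z) \<le> B"
    and v: "\<And>z. Re z = R \<Longrightarrow> \<bar>Im z\<bar> \<le> R \<Longrightarrow> norm (f z) \<le> B"
  shows "norm (right_int R f) \<le> 4 * R * B"
proof -
  have int: "f contour_integrable_on linepath a b" if "closed_segment a b \<subseteq> {z. 0 \<le> Re z \<and> \<bar>Im z\<bar> \<le> R \<and> z \<noteq> 0}" for a b
    using contour_integrable_continuous_linepath[OF continuous_on_subset[OF cont that]] .
  have "norm (contour_integral (linepath (Complex 0 (- R)) (Complex R (- R))) f)
      \<le> B * norm (Complex R (- R) - Complex 0 (- R))"
    by (intro contour_integral_bound_linepath int B)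
       (use R h in \<open>auto simp: closed_segment_horizontal\<close>)
  moreover have "norm (contour_integral (linepath (Complex R (- R)) (Complex R R)) f)
      \<le> B * norm (Complex R R - Complex R (- R))"
    by (intro contour_integral_bound_linepath int B)
       (use R v in \<open>auto simp: closed_segment_vertical\<close>)
  moreover have "norm (contour_integral (linepath (Complex R R) (Complex 0 R)) f)
      \<le> B * norm (Complex 0 R - Complex R R)"
    by (intro contour_integral_bound_linepath int B)
       (use R h in \<open>auto simp: closed_segment_horizontal\<close>)
  moreover have "Complex R (- R) - Complex 0 (- R) = of_real R" "Complex 0 R - Complex R R = of_real (- R)"
    "Complex R R - Complex R (- R) = of_real (2 * R) * \<i>" by (simp_all add: complex_eq_iff)
  ultimately have 1: "norm (contour_integral (linepath (Complex 0 (- R)) (Complex R (- R))) f) \<le> B * R"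
    "norm (contour_integral (linepath (Complex R (- R)) (Complex R R)) f) \<le> B * (2 * R)"
    "norm (contour_integral (linepath (Complex R R) (Complex 0 R)) f) \<le> B * R"
    using R by (simp_all add: norm_mult)
  have "norm (right_int R f) \<le> B * R + B * (2 * R) + B * R"
    unfolding right_int_def by (intro norm_triangle_le add_mono 1)
  then show ?thesis by (simp add: algebra_simps)
qed

lemma norm_left_int_le:
  assumes d: "d > 0" and R: "R > 0"
    and cont: "continuous_on {z. - d \<le> Re z \<and> Re z \<le> 0 \<and> \<bar>Im z\<bar> \<le> R \<and> z \<noteq> 0} f" and B: "B \<ge> 0" "C \<ge> 0"
    and h: "\<And>z. - d \<le> Re z \<Longrightarrow> Re z \<le> 0 \<Longrightarrow> \<bar>Im z\<bar> = R \<Longrightarrow> norm (f z) \<le> B"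
    and v: "\<And>z. Re z = - d \<Longrightarrow> \<bar>Im z\<bar> \<le> R \<Longrightarrow> norm (f z) \<le> C"
  shows "norm (left_int d R f) \<le> 2 * d * B + 2 * R * C"
proof -
  let ?S = "{z. - d \<le> Re z \<and> Re z \<le> 0 \<and> \<bar>Im z\<bar> \<le> R \<and> z \<noteq> 0}"
  have int: "f contour_integrable_on linepath a b" if "closed_segment a b \<subseteq> ?S" for a b
    using contour_integrable_continuous_linepath[OF continuous_on_subset[OF cont that]] .
  have "norm (contour_integral (linepath (Complex 0 R) (Complex (- d) R)) f)
      \<le> B * norm (Complex (- d) R - Complex 0 R)"
    by (intro contour_integral_bound_linepath int B)
       (use R d h in \<open>auto simp: closed_segment_horizontal\<close>)
  moreover have "norm (contour_integral (linepath (Complex (- d) R) (Complex (- d) (- R))) f)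
      \<le> C * norm (Complex (- d) (- R) - Complex (- d) R)"
    by (intro contour_integral_bound_linepath int B)
       (use R d v in \<open>auto simp: closed_segment_vertical\<close>)
  moreover have "norm (contour_integral (linepath (Complex (- d) (- R)) (Complex 0 (- R))) f)
      \<le> B * norm (Complex 0 (- R) - Complex (- d) (- R))"
    by (intro contour_integral_bound_linepath int B)
       (use R d h in \<open>auto simp: closed_segment_horizontal\<close>)
  moreover have "Complex (- d) R - Complex 0 R = of_real (- d)" "Complex 0 (- R) - Complex (- d) (- R) = of_real d"
    "Complex (- d) (- R) - Complex (- d) R = of_real (- 2 * R) * \<i>" by (simp_all add: complex_eq_iff)
  ultimately have 1: "norm (contour_integral (linepath (Complex 0 R) (Complex (- d) R)) f) \<le> B * d"
    "norm (contour_integral (linepath (Complex (- d) R) (Complex (- d) (- R))) f) \<le> C * (2 * R)"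
    "norm (contour_integral (linepath (Complex (- d) (- R)) (Complex 0 (- R))) f) \<le> B * d"
    using R d by (simp_all add: norm_mult)
  have "norm (left_int d R f) \<le> B * d + C * (2 * R) + B * d"
    unfolding left_int_def by (intro norm_triangle_le add_mono 1)
  then show ?thesis by (simp add: algebra_simps)
qed

lemma right_int_diff:
  assumes R: "R > 0" and cont: "continuous_on {z. 0 \<le> Re z \<and> \<bar>Im z\<bar> \<le> R \<and> z \<noteq> 0} f" "continuous_on {z. 0 \<le> Re z \<and> \<bar>Im z\<bar> \<le> R \<and> z \<noteq> 0} g"
  shows "right_int R (\<lambda>z. f z - g z) = right_int R f - right_int R g"
proof -
  have int: "f contour_integrable_on linepath a b" "g contour_integrable_on linepath a b"
    if "closed_segment a b \<subseteq> {z. 0 \<le> Re z \<and> \<bar>Im z\<bar> \<le> R \<and> z \<noteq> 0}" for a b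
    using contour_integrable_continuous_linepath[OF continuous_on_subset[OF cont(1) that]]
      contour_integrable_continuous_linepath[OF continuous_on_subset[OF cont(2) that]] .
  have sub: "closed_segment (Complex 0 (- R)) (Complex R (- R)) \<subseteq> {z. 0 \<le> Re z \<and> \<bar>Im z\<bar> \<le> R \<and> z \<noteq> 0}"
    "closed_segment (Complex R (- R)) (Complex R R) \<subseteq> {z. 0 \<le> Re z \<and> \<bar>Im z\<bar> \<le> R \<and> z \<noteq> 0}"
    "closed_segment (Complex R R) (Complex 0 R) \<subseteq> {z. 0 \<le> Re z \<and> \<bar>Im z\<bar> \<le> R \<and> z \<noteq> 0}"
    using R by (auto simp: closed_segment_horizontal closed_segment_vertical)
  show ?thesis unfolding right_int_def
    by (simp add: contour_integral_diff[OF int[OF sub(1)]] contour_integral_diff[OF int[OF sub(2)]]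
        contour_integral_diff[OF int[OF sub(3)]])
qed

text \<open>Newman's kernel \<open>1/z + z/R\<^sup>2\<close>: it vanishes at \<open>\<plusminus>iR\<close>, which compensates the factor \<open>1/Re z\<close> in
  the estimates of partial sums and tails near the imaginary axis.\<close>

definition newman_kernel :: "real \<Rightarrow> complex \<Rightarrow> complex" where
  "newman_kernel R z = (z\<^sup>2 + of_real R ^ 2) / (z * of_real R ^ 2)"

text \<open>On the edges |Im z| = R the numerator z^2 + R^2 equals x (x + 2it) with x = Re z and t =
  Im z, so it vanishes linearly in x.\<close>

lemma newman_kernel_horizontal:
  assumes R: "R > 0" and z: "\<bar>Re z\<bar> \<le> R" "\<bar>Im z\<bar> = R"
  shows "norm (newman_kernel R z) \<le> 3 * \<bar>Re z\<bar> / R\<^sup>2"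
proof -
  define x t where "x = Re z" "t = Im z"
  let ?z = "Complex x t"
  have z_eq: "z = ?z" and x: "\<bar>x\<bar> \<le> R" and t: "\<bar>t\<bar> = R" using z by (auto simp: x_t_def)
  have t2: "t\<^sup>2 = R\<^sup>2" using t by (metis power2_abs)
  have "?z\<^sup>2 + of_real R ^ 2 = of_real x * Complex x (2 * t)"
    using t2 by (simp add: complex_eq_iff power2_eq_square algebra_simps)
  moreover have "norm (Complex x (2 * t)) \<le> 3 * R"
    using cmod_le[of "Complex x (2 * t)"] x t by (simp add: abs_mult)
  ultimately have num: "norm (?z\<^sup>2 + of_real R ^ 2) \<le> \<bar>x\<bar> * (3 * R)"
    by (simp add: norm_mult mult_left_mono)
  have den: "R * R\<^sup>2 \<le> norm (?z * of_real R ^ 2)"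
    using abs_Im_le_cmod[of ?z] t R by (simp add: norm_mult norm_power mult_right_mono)
  have "norm (newman_kernel R ?z) \<le> (\<bar>x\<bar> * (3 * R)) / (R * R\<^sup>2)"
    unfolding newman_kernel_def norm_divide using num den R by (intro frac_le) auto
  also have "\<dots> = 3 * \<bar>x\<bar> / R\<^sup>2" using R by (simp add: field_simps)
  finally show ?thesis unfolding z_eq by simp
qed

lemma newman_kernel_le:
  assumes R: "R > 0" and z: "norm z ^ 2 \<le> 2 * R\<^sup>2" and m: "m > 0" "m \<le> norm z"
  shows "norm (newman_kernel R z) \<le> 3 / m"
proof -
  have num: "norm (z\<^sup>2 + of_real R ^ 2) \<le> 3 * R\<^sup>2"
    using norm_triangle_ineq[of "z\<^sup>2" "of_real R ^ 2"] z R by (simp add: norm_power)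
  have den: "m * R\<^sup>2 \<le> norm (z * of_real R ^ 2)" using m R by (simp add: norm_mult norm_power mult_right_mono)
  have "norm (newman_kernel R z) \<le> (3 * R\<^sup>2) / (m * R\<^sup>2)"
    unfolding newman_kernel_def norm_divide using num den R m by (intro frac_le) auto
  then show ?thesis using R by simp
qed

text \<open>The pole of \<open>\<zeta>\<close> cancels the pole of the kernel in \<open>H\<close>, so only the partial sum \<open>S\<close>
  contributes a residue.\<close>

lemma newman_mu_bound:
  assumes R: "R \<ge> 1" and N: "N \<ge> (1::nat)" and \<delta>: "0 < \<delta>" "\<delta> < 1"
    and nz: "\<And>z. - \<delta> \<le> Re z \<Longrightarrow> Re z \<le> 0 \<Longrightarrow> \<bar>Im z\<bar> \<le> R \<Longrightarrow> zeta1 (1 + z) \<noteq> 0"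
    and Bd: "\<And>z. - \<delta> \<le> Re z \<Longrightarrow> Re z \<le> 0 \<Longrightarrow> \<bar>Im z\<bar> \<le> R \<Longrightarrow> norm (z / zeta1 (1 + z)) \<le> Bd"
  shows "2 * pi * norm (\<Sum>n\<le>N. mu n / of_nat n)
    \<le> 24 / R + 12 / real N + 6 * Bd / R\<^sup>2 + 6 * R * Bd * real N powr (- \<delta>) / \<delta>"
proof -
  let ?K = "newman_kernel R"
  define S where "S z = (\<Sum>n\<le>N. mu n * of_nat n powr (- (1 + z)))" for z
  define Nz where "Nz z = (of_nat N powr z :: complex)" for z
  \<comment> \<open>For z different from 0 this is N^z / zeta(1 + z) times the kernel, with z
    cancelled so that the formula is holomorphic at 0 as well.\<close>
  define H where "H z = (z\<^sup>2 + of_real R ^ 2) / (of_real R ^ 2 * zeta1 (1 + z)) * Nz z" for z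
  define P where "P z = S z * Nz z * ?K z" for z
  have R0: "R > 0" using R by simp
  have Bd0: "Bd \<ge> 0" using Bd[of 0] \<delta> R norm_ge_zero order.trans by fastforce
  have Nz: "norm (Nz z) = real N powr Re z" for z unfolding Nz_def by (rule norm_of_nat_powr)
  have holN: "Nz holomorphic_on A" for A unfolding Nz_def[abs_def] by (cases "N = 0") (auto intro!: holomorphic_intros)
  have holS: "S holomorphic_on A" for A
  proof -
    have "(\<lambda>z. mu n * of_nat n powr (- (1 + z))) holomorphic_on A" for n
      by (cases "n = 0") (auto intro!: holomorphic_intros)
    then show ?thesis unfolding S_def[abs_def] by (intro holomorphic_on_sum)
  qed
  have S0: "S 0 = (\<Sum>n\<le>N. mu n / of_nat n)"
    unfolding S_def by (intro sum.cong refl) (simp add: powr_minus divide_inverse)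

  have K_eq: "z \<noteq> 0 \<Longrightarrow> H z = z / zeta1 (1 + z) * Nz z * ?K z" for z
    unfolding H_def newman_kernel_def by (simp add: divide_simps)
  \<comment> \<open>To the right of the imaginary axis \<open>zeta1 (1 + z)\<close> has no zeros at
    any height; on the axis and to the left only the rectangle of the hypotheses is safe.\<close>
  define D where "D = {z. - \<delta> \<le> Re z \<and> (Re z \<le> 0 \<longrightarrow> \<bar>Im z\<bar> \<le> R)}"
  have holH: "H holomorphic_on D"
  proof -
    have "(\<lambda>z. zeta1 (1 + z)) holomorphic_on D"
      by (rule holomorphic_on_compose_gen[OF _ zeta1_holomorphic, unfolded o_def])
         (use \<delta> in \<open>auto simp: D_def intro!: holomorphic_intros\<close>)
    moreover have "zeta1 (1 + z) \<noteq> 0" if "z \<in> D" for z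
      using that nz[of z] zeta1_ne_0[of "1 + z"] by (cases "Re z \<le> 0") (auto simp: D_def)
    ultimately show ?thesis unfolding H_def[abs_def] using R0
      by (intro holomorphic_intros holN) auto
  qed
  have contH: "continuous_on D H" using holH by (rule holomorphic_on_imp_continuous_on)
  have holP: "P holomorphic_on - {0}"
    unfolding P_def[abs_def] newman_kernel_def using R0 by (intro holomorphic_intros holN holS) auto
  have contP: "continuous_on A P" if "0 \<notin> A" for A
    using holomorphic_on_imp_continuous_on[OF holP] by (rule continuous_on_subset) (use that in auto)

  have left_H: "right_int R H + left_int \<delta> R H = 0"
  proof -
    let ?b = "cbox (Complex (- \<delta>) (- R)) (Complex R R)"
    have sub: "?b \<subseteq> D" using R \<delta> by (auto simp: D_def in_cbox_complex_iff)
    have "(H has_contour_integral 0) (rectpath (Complex (- \<delta>) (- R)) (Complex R R))"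
      by (rule Cauchy_theorem_convex_simple[OF holomorphic_on_subset[OF holH sub] convex_box(1)])
         (use R0 \<delta> path_image_rectpath_subset_cbox[of "Complex (- \<delta>) (- R)" "Complex R R"] in auto)
    then have "contour_integral (rectpath (Complex (- \<delta>) (- R)) (Complex R R)) H = 0"
      by (rule contour_integral_unique)
    then show ?thesis
      using contour_integral_rectpath_split[OF \<delta>(1) R0, of H] continuous_on_subset[OF contH, of "?b - {0}"] sub
      by auto
  qed
  \<comment> \<open>S is a finite sum, hence entire, so the contour for P may go left to Re z = -R,
    far beyond the zero-free region. The residue at 0 is \<open>S 0\<close>.\<close>
  have P_int: "right_int R P + left_int R R P = 2 * of_real pi * \<i> * S 0"
  proof -
    let ?r = "rectpath (Complex (- R) (- R)) (Complex R R)"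
    define f where "f z = S z * Nz z * ((z\<^sup>2 + of_real R ^ 2) / of_real R ^ 2)" for z
    have in_box: "0 \<in> box (Complex (- R) (- R)) (Complex R R)" using R0 by (simp add: in_box_complex_iff)
    have "((\<lambda>w. f w / (w - 0)) has_contour_integral (2 * pi * \<i> * winding_number ?r 0 * f 0)) ?r"
    proof (rule Cauchy_integral_formula_convex_simple)
      show "f holomorphic_on UNIV" unfolding f_def[abs_def] using R0
        by (intro holomorphic_intros holN holS) auto
      show "path_image ?r \<subseteq> UNIV - {0}"
        using in_box R0 path_image_rectpath_cbox_minus_box[of "Complex (- R) (- R)" "Complex R R"] by auto
    qed auto
    moreover have "(\<lambda>w. f w / (w - 0)) = P"
      by (rule ext) (simp add: f_def P_def newman_kernel_def)
    moreover have "f 0 = S 0" using R0 N by (simp add: f_def Nz_def)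
    ultimately have "contour_integral ?r P = 2 * of_real pi * \<i> * S 0"
      using winding_number_rectpath[OF in_box] contour_integral_unique by fastforce
    then show ?thesis using contour_integral_rectpath_split[OF R0 R0 contP] by simp
  qed

  have contH': "continuous_on {z. 0 \<le> Re z \<and> \<bar>Im z\<bar> \<le> R \<and> z \<noteq> 0} H"
    by (rule continuous_on_subset[OF contH]) (use \<delta> in \<open>auto simp: D_def\<close>)
  have contP': "continuous_on {z. 0 \<le> Re z \<and> \<bar>Im z\<bar> \<le> R \<and> z \<noteq> 0} P"
    by (rule contP) simp
  have right: "norm (right_int R (\<lambda>z. P z - H z)) \<le> 4 * R * (3 / R\<^sup>2)"
  proof (rule norm_right_int_le[OF R0])
    show "continuous_on {z. 0 \<le> Re z \<and> \<bar>Im z\<bar> \<le> R \<and> z \<noteq> 0} (\<lambda>z. P z - H z)"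
      by (intro continuous_on_diff contP' contH')
    have le: "norm (P z - H z) \<le> norm (?K z) / Re z" if z: "Re z > 0" for z
    proof -
      have z0: "z \<noteq> 0" using z by auto
      have G: "z / zeta1 (1 + z) = fds mu (1 + z)"
      proof -
        have "zeta1 (1 + z) = z * fds (\<lambda>_. 1) (1 + z)" using zeta1_eq[of "1 + z"] z by simp
        moreover have "fds mu (1 + z) * fds (\<lambda>_. 1) (1 + z) = 1" using fds_mu_times_zeta[of "1 + z"] z by simp
        moreover have "fds (\<lambda>_. 1) (1 + z) \<noteq> 0" using fds_1_ne_0[of "1 + z"] z by simp
        ultimately show ?thesis using z0 by (simp add: field_simps)
      qed
      have "norm (fds mu (1 + z) - S z) \<le> real N powr (1 - Re (1 + z)) / (Re (1 + z) - 1)"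
        unfolding S_def by (rule fds_tail_le[OF norm_mu_le]) (use z N in auto)
      then have tail: "norm (S z - fds mu (1 + z)) \<le> real N powr (- Re z) / Re z"
        by (simp add: norm_minus_commute)
      have "P z - H z = (S z - fds mu (1 + z)) * Nz z * ?K z"
        unfolding K_eq[OF z0] G P_def by (simp add: algebra_simps)
      then have "norm (P z - H z) = norm (S z - fds mu (1 + z)) * real N powr Re z * norm (?K z)"
        by (simp add: norm_mult Nz)
      also have "\<dots> \<le> (real N powr (- Re z) / Re z) * real N powr Re z * norm (?K z)"
        using tail by (intro mult_right_mono) auto
      also have "\<dots> = norm (?K z) / Re z" using N by (simp add: powr_minus field_simps)
      finally show ?thesis .
    qed
    show "norm (P z - H z) \<le> 3 / R\<^sup>2" if z: "0 \<le> Re z" "Re z \<le> R" "\<bar>Im z\<bar> = R" for z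
    \<comment> \<open>At iR and -iR the estimate by \<open>norm (?K z) / Re z\<close> breaks down,
      but the kernel vanishes there.\<close>
    proof (cases "Re z = 0")
      case True
      have "?K z = 0" using newman_kernel_horizontal[OF R0, of z] z True by simp
      moreover have "z \<noteq> 0" using z R0 by auto
      ultimately show ?thesis using R0 by (simp add: P_def K_eq)
    next
      case False
      then have "norm (P z - H z) \<le> norm (?K z) / Re z" using z by (intro le) auto
      also have "\<dots> \<le> (3 * \<bar>Re z\<bar> / R\<^sup>2) / Re z"
        using z by (intro divide_right_mono newman_kernel_horizontal R0) auto
      also have "\<dots> = 3 / R\<^sup>2" using z False by simp
      finally show ?thesis .
    qed
    show "norm (P z - H z) \<le> 3 / R\<^sup>2" if z: "Re z = R" "\<bar>Im z\<bar> \<le> R" for z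
    proof -
      have "(Im z)\<^sup>2 \<le> R\<^sup>2" using z R0 by (simp add: abs_le_square_iff[symmetric])
      then have "norm z ^ 2 \<le> 2 * R\<^sup>2" unfolding cmod_power2 using z by simp
      moreover have "R \<le> norm z" using complex_Re_le_cmod[of z] z by simp
      ultimately have "norm (?K z) \<le> 3 / R" using R0 by (intro newman_kernel_le) auto
      then have "norm (?K z) / R \<le> (3 / R) / R" using R0 by (intro divide_right_mono) auto
      moreover have "norm (P z - H z) \<le> norm (?K z) / R" using le[of z] z R0 by simp
      ultimately have "norm (P z - H z) \<le> (3 / R) / R" by linarith
      then show ?thesis by (simp add: power2_eq_square)
    qed
  qed (use R0 in auto)

  have left_P: "norm (left_int R R P) \<le> 2 * R * (3 / R\<^sup>2 + 3 / (R * real N)) + 2 * R * (3 / R\<^sup>2 + 3 / (R * real N))"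
  proof (rule norm_left_int_le[OF R0 R0])
    \<comment> \<open>Mirror image of the tail bound: for Re z < 0 the partial sum itself is bounded
      trivially by N^(-Re z) / (-Re z), with the correction 1/N of
      \<open>sum_powr_le\<close>.\<close>
    have le: "norm (P z) \<le> (1 / (- Re z) + 1 / real N) * norm (?K z)" if z: "Re z < 0" for z
    proof -
      have "norm (S z) \<le> (\<Sum>n\<le>N. real n powr (- Re z - 1))"
        unfolding S_def
      proof (rule sum_norm_le)
        fix n
        have "norm (mu n * of_nat n powr (- (1 + z))) \<le> 1 * real n powr (Re (- (1 + z)))"
          unfolding norm_mult norm_of_nat_powr by (intro mult_mono norm_mu_le) auto
        also have "Re (- (1 + z)) = - Re z - 1" by simp
        finally show "norm (mu n * of_nat n powr (- (1 + z))) \<le> real n powr (- Re z - 1)" by simp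
      qed
      also have "\<dots> = (\<Sum>n=1..N. real n powr (- Re z - 1))"
        by (rule sum.mono_neutral_right) auto
      also have "\<dots> \<le> real N powr (- Re z) * (1 / (- Re z) + 1 / real N)"
        by (rule sum_powr_le) (use z N in auto)
      finally have "norm (S z) * real N powr Re z * norm (?K z)
          \<le> real N powr (- Re z) * (1 / (- Re z) + 1 / real N) * real N powr Re z * norm (?K z)"
        by (intro mult_right_mono) auto
      also have "\<dots> = (1 / (- Re z) + 1 / real N) * norm (?K z)" using N by (simp add: powr_minus field_simps)
      finally show ?thesis by (simp add: P_def norm_mult Nz)
    qed
    show "norm (P z) \<le> 3 / R\<^sup>2 + 3 / (R * real N)" if z: "- R \<le> Re z" "Re z \<le> 0" "\<bar>Im z\<bar> = R" for z
    proof (cases "Re z = 0")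
      case True
      have "?K z = 0" using newman_kernel_horizontal[OF R0, of z] z True by simp
      then show ?thesis using R0 by (simp add: P_def)
    next
      case False
      define y where "y = - Re z"
      have y: "y > 0" "y \<le> R" using z False by (auto simp: y_def)
      have "norm (?K z) \<le> 3 * y / R\<^sup>2" using newman_kernel_horizontal[OF R0, of z] z by (simp add: y_def)
      then have "(1 / y + 1 / real N) * norm (?K z) \<le> (1 / y + 1 / real N) * (3 * y / R\<^sup>2)"
        using y by (intro mult_left_mono) auto
      also have "\<dots> = 3 / R\<^sup>2 + (3 / real N) * (y / R\<^sup>2)" using y N R0 by (simp add: field_simps)
      also have "\<dots> \<le> 3 / R\<^sup>2 + (3 / real N) * (R / R\<^sup>2)"
        using y by (intro add_left_mono mult_left_mono divide_right_mono) auto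
      also have "\<dots> = 3 / R\<^sup>2 + 3 / (R * real N)" using R0 by (simp add: power2_eq_square)
      finally show ?thesis using le[of z] y unfolding y_def by linarith
    qed
    show "norm (P z) \<le> 3 / R\<^sup>2 + 3 / (R * real N)" if z: "Re z = - R" "\<bar>Im z\<bar> \<le> R" for z
    proof -
      have "(Im z)\<^sup>2 \<le> R\<^sup>2" using z R0 by (simp add: abs_le_square_iff[symmetric])
      then have "norm z ^ 2 \<le> 2 * R\<^sup>2" unfolding cmod_power2 using z by simp
      moreover have "R \<le> norm z" using abs_Re_le_cmod[of z] z R0 by simp
      ultimately have "norm (?K z) \<le> 3 / R" using R0 by (intro newman_kernel_le) auto
      then have "(1 / R + 1 / real N) * norm (?K z) \<le> (1 / R + 1 / real N) * (3 / R)"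
        using R0 by (intro mult_left_mono) auto
      also have "\<dots> = 3 / R\<^sup>2 + 3 / (R * real N)" by (simp add: power2_eq_square algebra_simps)
      finally show ?thesis using le[of z] z R0 by simp
    qed
  qed (use R0 in \<open>auto intro: contP\<close>)

  have left_H': "norm (left_int \<delta> R H) \<le> 2 * \<delta> * (Bd * (3 * \<delta> / R\<^sup>2)) + 2 * R * (Bd * real N powr (- \<delta>) * (3 / \<delta>))"
  proof (rule norm_left_int_le[OF \<delta>(1) R0])
    have le: "norm (H z) \<le> Bd * real N powr (Re z) * norm (?K z)"
      if z: "- \<delta> \<le> Re z" "Re z \<le> 0" "\<bar>Im z\<bar> \<le> R" "z \<noteq> 0" for z
      unfolding K_eq[OF z(4)] norm_mult Nz using Bd[OF z(1-3)] by (intro mult_right_mono) auto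
    show "continuous_on {z. - \<delta> \<le> Re z \<and> Re z \<le> 0 \<and> \<bar>Im z\<bar> \<le> R \<and> z \<noteq> 0} H"
      by (rule continuous_on_subset[OF contH]) (auto simp: D_def)
    show "norm (H z) \<le> Bd * (3 * \<delta> / R\<^sup>2)" if z: "- \<delta> \<le> Re z" "Re z \<le> 0" "\<bar>Im z\<bar> = R" for z
    proof -
      have "norm (?K z) \<le> 3 * \<bar>Re z\<bar> / R\<^sup>2" using z \<delta> R by (intro newman_kernel_horizontal) auto
      also have "\<dots> \<le> 3 * \<delta> / R\<^sup>2" using z by (intro divide_right_mono) auto
      finally have K: "norm (?K z) \<le> 3 * \<delta> / R\<^sup>2" .
      have "z \<noteq> 0" using z R0 by auto
      then have "norm (H z) \<le> Bd * real N powr (Re z) * norm (?K z)" using z by (intro le) auto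
      also have "\<dots> \<le> Bd * 1 * (3 * \<delta> / R\<^sup>2)"
      proof (intro mult_mono K order.refl Bd0)
        show "real N powr Re z \<le> 1" using z N powr_mono[of "Re z" 0 "real N"] by simp
      qed (use Bd0 in auto)
      finally show ?thesis by simp
    qed
    show "norm (H z) \<le> Bd * real N powr (- \<delta>) * (3 / \<delta>)" if z: "Re z = - \<delta>" "\<bar>Im z\<bar> \<le> R" for z
    proof -
      have "(Im z)\<^sup>2 \<le> R\<^sup>2" "(Re z)\<^sup>2 \<le> R\<^sup>2"
        using z R \<delta> by (simp_all add: abs_le_square_iff[symmetric])
      then have "norm z ^ 2 \<le> 2 * R\<^sup>2" unfolding cmod_power2 by simp
      moreover have "\<delta> \<le> norm z" using abs_Re_le_cmod[of z] z \<delta> by simp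
      ultimately have K: "norm (?K z) \<le> 3 / \<delta>" using R0 \<delta> by (intro newman_kernel_le) auto
      have "z \<noteq> 0" using z \<delta> by auto
      then have "norm (H z) \<le> Bd * real N powr (- \<delta>) * norm (?K z)" using le[of z] z \<delta> by simp
      also have "\<dots> \<le> Bd * real N powr (- \<delta>) * (3 / \<delta>)" using K Bd0 by (intro mult_left_mono) auto
      finally show ?thesis .
    qed
  qed (use R0 \<delta> Bd0 in auto)

  \<comment> \<open>The closed integral of H is 0, so the right integral of P is the right integral
    of P - H minus the left integral of H.\<close>
  have "2 * of_real pi * \<i> * S 0 = right_int R (\<lambda>z. P z - H z) - left_int \<delta> R H + left_int R R P"
    using left_H P_int unfolding right_int_diff[OF R0 contP' contH'] by (simp add: algebra_simps add_eq_0_iff)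
  then have "norm (2 * of_real pi * \<i> * S 0) \<le> norm (right_int R (\<lambda>z. P z - H z)) + norm (left_int \<delta> R H) + norm (left_int R R P)"
    by (metis norm_triangle_ineq norm_triangle_ineq4 add_right_mono order.trans)
  then have "2 * pi * norm (S 0) \<le> 4 * R * (3 / R\<^sup>2) + (2 * \<delta> * (Bd * (3 * \<delta> / R\<^sup>2)) + 2 * R * (Bd * real N powr (- \<delta>) * (3 / \<delta>)))
      + (2 * R * (3 / R\<^sup>2 + 3 / (R * real N)) + 2 * R * (3 / R\<^sup>2 + 3 / (R * real N)))"
    using right left_P left_H' by (simp add: norm_mult)
  also have "\<dots> = 24 / R + 12 / real N + 6 * (Bd / R\<^sup>2) * \<delta>\<^sup>2 + 6 * R * Bd * real N powr (- \<delta>) / \<delta>"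
    using R0 N by (simp add: power2_eq_square distrib_left mult_ac)
  also have "6 * (Bd / R\<^sup>2) * \<delta>\<^sup>2 \<le> 6 * (Bd / R\<^sup>2) * 1"
    using \<delta> Bd0 by (intro mult_left_mono) (auto simp: power_le_one)
  finally show ?thesis unfolding S0 by simp
qed

text \<open>With L = sqrt (ln N) the height is R = exp (c L). The zero-free width \<delta> is then
  of order \<kappa> / (c L), so N^(-\<delta>) is exponentially small in L and beats a fixed power of
  R once c is small. This balance produces the square root of the logarithm.\<close>

lemma mu_harmonic_sum_bound:
  obtains C c :: real where "C > 0" "c > 0"
    "\<And>N. N \<ge> 1 \<Longrightarrow> norm (\<Sum>n\<le>N. mu n / of_nat n) \<le> C * exp (- c * sqrt (ln (real N)))"
proof -
  \<comment> \<open>The choice gives 16 c^2 = \<kappa>, which makes N^(-\<delta>) at most R^-8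
    below.\<close>
  define c \<kappa> :: real where "c = 1 / 2 ^ 17" and "\<kappa> = 1 / 2 ^ 30"
  have c: "c > 0" "c \<le> 1" and \<kappa>: "\<kappa> > 0" "\<kappa> < 1" by (simp_all add: c_def \<kappa>_def)
  define C1 where "C1 = 36 + 504 / \<kappa> + 7056 / \<kappa>\<^sup>2"
  define C2 where "C2 = 2 * exp ((6 / c)\<^sup>2 + 6)"
  have C1: "C1 \<ge> 0" and C2: "C2 > 0" using \<kappa> by (simp_all add: C1_def C2_def)
  have "norm (\<Sum>n\<le>N. mu n / of_nat n) \<le> (C1 + C2) * exp (- c * sqrt (ln (real N)))" if N: "N \<ge> 1" for N
  proof -
    define L where "L = sqrt (ln (real N))"
    have L0: "L \<ge> 0" and NL: "real N = exp (L\<^sup>2)" using N by (simp_all add: L_def)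
    show ?thesis
    \<comment> \<open>Below the threshold the trivial bound N + 1 and the constant \<open>C2\<close>
      suffice. Above it, ln 7 <= 6 <= c L gives ln (R + 6) <= 2 c L.\<close>
    proof (cases "c * L \<ge> 6")
      case False
      have "norm (\<Sum>n\<le>N. mu n / of_nat n) \<le> (\<Sum>n\<le>N. 1)"
      proof (rule sum_norm_le)
        fix n show "norm (mu n / of_nat n) \<le> 1"
        proof (cases "n = 0")
          case False
          then show ?thesis using norm_mu_le[of n] by (simp add: norm_divide field_simps)
        qed simp
      qed
      also have "\<dots> \<le> 2 * exp (L\<^sup>2)" using N NL by simp
      also have "\<dots> \<le> 2 * (exp ((6 / c)\<^sup>2 + 6) * exp (- c * L))"
      proof -
        have "L \<le> 6 / c" using False c by (simp add: field_simps)
        then have "L\<^sup>2 \<le> (6 / c)\<^sup>2" using L0 by (intro power_mono)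
        then have "L\<^sup>2 \<le> (6 / c)\<^sup>2 + 6 + (- c * L)" using False by simp
        then show ?thesis by (simp flip: exp_add)
      qed
      also have "\<dots> = C2 * exp (- c * L)" by (simp add: C2_def)
      also have "\<dots> \<le> (C1 + C2) * exp (- c * L)" using C1 by (intro mult_right_mono) auto
      finally show ?thesis by (simp add: L_def)
    next
      case True
      define R where "R = exp (c * L)"
      define \<l> where "\<l> = ln (R + 6)"
      define \<delta> where "\<delta> = \<kappa> / \<l>"
      define Bd where "Bd = 6 / \<kappa> * \<l> * sqrt (R + 6)"
      have R: "R \<ge> 1" using True by (simp add: R_def)
      have R6: "R + 6 \<le> 7 * R" using R by simp
      have "ln 5 \<le> \<l>" using R by (simp add: \<l>_def)
      then have \<l>: "\<l> \<ge> 1" using ln_5_ge by linarith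
      have \<l>_le: "\<l> \<le> 2 * (c * L)"
      proof -
        have "\<l> \<le> ln (7 * R)" unfolding \<l>_def using R R6 by (intro ln_mono) auto
        also have "\<dots> = ln 7 + c * L" using R by (simp add: ln_mult R_def)
        also have "ln (7::real) \<le> 7 - 1" by (rule ln_le_minus_one) simp
        finally show ?thesis using True by simp
      qed
      have \<l>_sqrt: "\<l> \<le> 2 * sqrt (R + 6)"
      proof -
        have "\<l> = 2 * ln (sqrt (R + 6))" unfolding \<l>_def using R by (simp add: ln_sqrt)
        also have "ln (sqrt (R + 6)) \<le> sqrt (R + 6)" using R ln_le_minus_one[of "sqrt (R + 6)"] by simp
        finally show ?thesis by simp
      qed
      have "sqrt (R + 6) \<le> R + 6" using R by (intro real_le_lsqrt) (auto simp: power2_eq_square)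
      then have \<l>_R: "\<l> \<le> 14 * R" using \<l>_sqrt R6 by linarith
      have "\<l> * sqrt (R + 6) \<le> 2 * sqrt (R + 6) * sqrt (R + 6)" using \<l>_sqrt R by (intro mult_right_mono) auto
      also have "\<dots> = 2 * (R + 6)" using R by (simp add: mult.assoc)
      also have "\<dots> \<le> 14 * R" using R6 by simp
      finally have "6 / \<kappa> * (\<l> * sqrt (R + 6)) \<le> 6 / \<kappa> * (14 * R)" using \<kappa> by (intro mult_left_mono) auto
      then have Bd: "Bd \<le> 84 / \<kappa> * R" by (simp add: Bd_def mult.assoc)
      have Bd0: "Bd \<ge> 0" using \<kappa> \<l> R by (simp add: Bd_def)
      have \<delta>: "0 < \<delta>" "\<delta> < 1" using \<l> \<kappa> by (simp_all add: \<delta>_def)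
      have main: "2 * pi * norm (\<Sum>n\<le>N. mu n / of_nat n)
        \<le> 24 / R + 12 / real N + 6 * Bd / R\<^sup>2 + 6 * R * Bd * real N powr (- \<delta>) / \<delta>"
      proof (rule newman_mu_bound[OF R N \<delta>])
        fix z assume "- \<delta> \<le> Re z" "Re z \<le> 0" "\<bar>Im z\<bar> \<le> R"
        then have *: "\<bar>Im (1 + z)\<bar> \<le> R" "\<bar>Re (1 + z) - 1\<bar> \<le> 1 / 2 ^ 30 / ln (R + 6)"
          by (simp_all add: \<delta>_def \<l>_def \<kappa>_def)
        show "zeta1 (1 + z) \<noteq> 0" by (rule inverse_zeta1_bound(1)[OF R *])
        show "norm (z / zeta1 (1 + z)) \<le> Bd"
          using inverse_zeta1_bound(2)[OF R *] by (simp add: Bd_def \<l>_def \<kappa>_def)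
      qed
      have E: "exp (- c * L) = 1 / R" by (simp add: R_def exp_minus divide_inverse)
      have "12 / real N \<le> 12 * exp (- c * L)"
      proof -
        have "c * L \<le> 1 * L" using c L0 by (intro mult_right_mono) auto
        moreover have "L \<ge> 1" using True c L0 mult_right_mono[of c 1 L] by simp
        then have "L \<le> L\<^sup>2" by (simp add: power2_eq_square)
        ultimately have "R \<le> real N" unfolding NL R_def by simp
        then show ?thesis unfolding E using R by (simp add: frac_le)
      qed
      moreover have "6 * Bd / R\<^sup>2 \<le> 504 / \<kappa> * exp (- c * L)"
      proof -
        have "6 * Bd / R\<^sup>2 \<le> 6 * (84 / \<kappa> * R) / R\<^sup>2" using Bd by (intro divide_right_mono mult_left_mono) auto
        also have "\<dots> = 504 / \<kappa> * (1 / R)" using R by (simp add: power2_eq_square)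
        finally show ?thesis unfolding E .
      qed
      moreover have "6 * R * Bd * real N powr (- \<delta>) / \<delta> \<le> 7056 / \<kappa>\<^sup>2 * exp (- c * L)"
      proof -
        have "\<delta> * L\<^sup>2 \<ge> 8 * (c * L)"
        proof -
          have "8 * c * (2 * c) \<le> \<kappa>" by (simp add: c_def \<kappa>_def)
          then have "(8 * c * (2 * c)) * L\<^sup>2 \<le> \<kappa> * L\<^sup>2" by (intro mult_right_mono) auto
          moreover have "8 * (c * L) * \<l> \<le> 8 * (c * L) * (2 * (c * L))" using True \<l>_le by (intro mult_left_mono) auto
          ultimately have "8 * (c * L) * \<l> \<le> \<kappa> * L\<^sup>2" by (simp add: power2_eq_square mult_ac)
          then show ?thesis using \<l> by (simp add: \<delta>_def field_simps)
        qed
        then have "real N powr (- \<delta>) \<le> exp (- (8 * (c * L)))"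
          using N by (simp add: powr_def NL)
        \<comment> \<open>These factors cost R^3 against the gain R^-8.\<close>
        moreover have "6 * R * Bd / \<delta> \<le> 7056 / \<kappa>\<^sup>2 * R ^ 3"
        proof -
          have "6 * R * Bd / \<delta> = 6 * R * Bd * \<l> / \<kappa>" by (simp add: \<delta>_def)
          also have "\<dots> \<le> 6 * R * (84 / \<kappa> * R) * (14 * R) / \<kappa>"
            using R Bd Bd0 \<l>_R \<l> \<kappa> by (intro divide_right_mono mult_mono mult_nonneg_nonneg) auto
          also have "\<dots> = 7056 / \<kappa>\<^sup>2 * R ^ 3" by (simp add: power2_eq_square power3_eq_cube)
          finally show ?thesis .
        qed
        ultimately have "6 * R * Bd / \<delta> * real N powr (- \<delta>) \<le> (7056 / \<kappa>\<^sup>2 * R ^ 3) * exp (- (8 * (c * L)))"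
          using R by (intro mult_mono) auto
        also have "R ^ 3 = exp (3 * (c * L))" unfolding R_def by (simp flip: exp_of_nat_mult)
        also have "7056 / \<kappa>\<^sup>2 * exp (3 * (c * L)) * exp (- (8 * (c * L))) = 7056 / \<kappa>\<^sup>2 * exp (- 5 * (c * L))"
          by (simp flip: exp_add add: mult.assoc)
        also have "\<dots> \<le> 7056 / \<kappa>\<^sup>2 * exp (- c * L)" using True by (intro mult_left_mono) (auto simp: mult.commute)
        finally show ?thesis by simp
      qed
      moreover have "24 / R = 24 * exp (- c * L)" unfolding E by simp
      ultimately have "2 * pi * norm (\<Sum>n\<le>N. mu n / of_nat n) \<le> C1 * exp (- c * L)"
        using main unfolding C1_def distrib_right by linarith
      moreover have "norm (\<Sum>n\<le>N. mu n / of_nat n) \<le> 2 * pi * norm (\<Sum>n\<le>N. mu n / of_nat n)"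
        using pi_ge_two mult_right_mono[of 1 "2 * pi" "norm (\<Sum>n\<le>N. mu n / of_nat n)"] by simp
      moreover have "C1 * exp (- c * L) \<le> (C1 + C2) * exp (- c * L)" using C2 by (intro mult_right_mono) auto
      ultimately show ?thesis unfolding L_def by linarith
    qed
  qed
  moreover have "C1 + C2 > 0" using C1 C2 by simp
  ultimately show ?thesis using that c by blast
qed

section \<open>Summatory functions\<close>

text \<open>Partial summation, from the weights 1/n of the contour argument to the plain
  sum.\<close>

lemma sum_mu_Abel:
  "(\<Sum>n\<le>N. mu n) = of_nat N * (\<Sum>n\<le>N. mu n / of_nat n) - (\<Sum>k<N. \<Sum>n\<le>k. mu n / of_nat n)"
proof (induction N)
  case (Suc N)
  have "(of_nat (Suc N) :: complex) * (mu (Suc N) / of_nat (Suc N)) = mu (Suc N)"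
    by (simp del: of_nat_Suc)
  then show ?case
    unfolding sum.atMost_Suc sum.lessThan_Suc Suc.IH distrib_left by (simp add: algebra_simps)
qed simp

lemma summatory_eq_sum_atMost:
  assumes "f 0 = 0" "x \<ge> 0"
  shows "summatory f x = (\<Sum>n\<le>nat \<lfloor>x\<rfloor>. f n)"
  unfolding summatory_def
proof (rule sum.mono_neutral_left)
  show "{n. n > 0 \<and> real n \<le> x} \<subseteq> {..nat \<lfloor>x\<rfloor>}" by (auto simp: le_nat_floor)
  show "\<forall>i\<in>{..nat \<lfloor>x\<rfloor>} - {n. n > 0 \<and> real n \<le> x}. f i = 0"
  proof
    fix i assume "i \<in> {..nat \<lfloor>x\<rfloor>} - {n. n > 0 \<and> real n \<le> x}"
    moreover have "real i \<le> x" if "i \<le> nat \<lfloor>x\<rfloor>" using that assms(2) by linarith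
    ultimately show "f i = 0" using assms(1) by (cases "i = 0") auto
  qed
qed simp

text \<open>Subadditivity of the square root. It controls how the weight exp (-c sqrt (ln x))
  changes when x is divided by y.\<close>

lemma sqrt_ln_divide_ge:
  assumes "1 \<le> y" "y \<le> x"
  shows "sqrt (ln x) - sqrt (ln y) \<le> sqrt (ln (x / y))"
proof -
  have "ln x = ln (x / y) + ln y" using assms by (simp add: ln_div)
  then have "sqrt (ln x) \<le> sqrt (ln (x / y)) + sqrt (ln y)"
    using sqrt_add_le_add_sqrt[of "ln (x / y)" "ln y"] assms by simp
  then show ?thesis by simp
qed

text \<open>In the partial summation the terms k <= sqrt N are bounded trivially; for larger k, sqrt
  (ln k) is at least half of sqrt (ln N), which halves the exponent. The bound 1/8 for c is recorded
  for \<open>prime_powr_exp_le\<close>.\<close>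

lemma summatory_mu_bound:
  obtains C c :: real where "C > 0" "0 < c" "c \<le> 1 / 8"
    "\<And>x. x \<ge> 1 \<Longrightarrow> norm (summatory mu x) \<le> C * (x * exp (- c * sqrt (ln x)))"
proof -
  obtain C0 c0 :: real where C0: "C0 > 0" "c0 > 0" and
    m: "\<And>N. N \<ge> 1 \<Longrightarrow> norm (\<Sum>n\<le>N. mu n / of_nat n) \<le> C0 * exp (- c0 * sqrt (ln (real N)))"
    using mu_harmonic_sum_bound by blast
  define c where "c = min (c0 / 2) (1 / 8)"
  have c: "0 < c" "c \<le> 1 / 8" "c \<le> c0 / 2" using C0 by (auto simp: c_def)
  define C where "C = C0 * (2 + exp 2)"
  have C: "C > 0" using C0 by (simp add: C_def add_pos_pos)
  have M: "norm (\<Sum>n\<le>N. mu n) \<le> C * (real N * exp (- c * sqrt (ln (real N))))" if N: "N \<ge> 1" for N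
  proof -
    define L where "L = sqrt (ln (real N))"
    have L: "L \<ge> 0" and L2: "ln (real N) = L\<^sup>2" using N by (simp_all add: L_def)
    have NL: "real N = exp (L\<^sup>2)" using N L2 by (metis exp_ln of_nat_0_less_iff less_le_trans zero_less_one)
    let ?E = "exp (- c * L)"
    have 1: "exp (- c0 * L) \<le> ?E" using c L C0 by (simp add: mult_right_mono)
    have tm: "norm (\<Sum>n\<le>k. mu n / of_nat n) \<le> C0 * ((if real k \<le> sqrt (real N) then 1 else 0) + ?E)" if k: "k < N" for k
    proof (cases "k = 0")
      case False
      then have mk: "norm (\<Sum>n\<le>k. mu n / of_nat n) \<le> C0 * exp (- c0 * sqrt (ln (real k)))" by (intro m) auto
      have "exp (- c0 * sqrt (ln (real k))) \<le> (if real k \<le> sqrt (real N) then 1 else 0) + ?E"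
      proof (cases "real k \<le> sqrt (real N)")
        case True
        have "exp (- c0 * sqrt (ln (real k))) \<le> 1" using C0 False by simp
        then show ?thesis using True by (simp add: add_increasing2)
      next
        case gt: False
        have "ln (sqrt (real N)) \<le> ln (real k)" using gt N False by (intro ln_mono) auto
        then have "L\<^sup>2 / 2 \<le> ln (real k)" using N by (simp add: ln_sqrt L2)
        moreover have "(L / 2)\<^sup>2 = L\<^sup>2 / 4" by (simp add: power_divide)
        ultimately have "(L / 2)\<^sup>2 \<le> ln (real k)" using zero_le_power2[of L] by linarith
        then have "L / 2 \<le> sqrt (ln (real k))" by (rule real_le_rsqrt)
        then have "c0 * (L / 2) \<le> c0 * sqrt (ln (real k))" using C0 by (intro mult_left_mono) auto
        moreover have "c * L \<le> c0 / 2 * L" using c L by (intro mult_right_mono) auto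
        ultimately show ?thesis using gt by simp
      qed
      then show ?thesis using mk C0 by (meson less_imp_le mult_left_mono order.trans)
    qed (use C0 in simp)
    have "norm (\<Sum>k<N. \<Sum>n\<le>k. mu n / of_nat n) \<le> (\<Sum>k<N. C0 * ((if real k \<le> sqrt (real N) then 1 else 0) + ?E))"
      by (rule sum_norm_le) (use tm in auto)
    also have "\<dots> = C0 * ((\<Sum>k<N. if real k \<le> sqrt (real N) then 1 else 0) + real N * ?E)"
      by (simp add: sum_distrib_left[symmetric] sum.distrib)
    also have "(\<Sum>k<N. if real k \<le> sqrt (real N) then 1 else 0 :: real) = real (card {k\<in>{..<N}. real k \<le> sqrt (real N)})"
      by (subst sum.inter_filter[symmetric]) auto
    also have "\<dots> \<le> sqrt (real N) + 1"
    proof -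
      have "card {k\<in>{..<N}. real k \<le> sqrt (real N)} \<le> card {..nat \<lfloor>sqrt (real N)\<rfloor>}"
        by (intro card_mono) (auto simp: le_nat_floor)
      then have "card {k\<in>{..<N}. real k \<le> sqrt (real N)} \<le> nat \<lfloor>sqrt (real N)\<rfloor> + 1" by simp
      moreover have "real (nat \<lfloor>sqrt (real N)\<rfloor>) \<le> sqrt (real N)" by simp
      ultimately show ?thesis by linarith
    qed
    also have "sqrt (real N) + 1 \<le> 2 * sqrt (real N)" using N by simp
    also have "2 * sqrt (real N) \<le> exp 2 * (real N * ?E)"
    proof -
      have "(2::real) \<le> exp 1" using exp_ge_add_one_self[of 1] by simp
      moreover have "sqrt (real N) = exp (L\<^sup>2 / 2)" using N
        by (simp add: NL real_sqrt_unique flip: exp_double)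
      ultimately have "2 * sqrt (real N) \<le> exp 1 * exp (L\<^sup>2 / 2)" by simp
      also have "\<dots> \<le> exp 2 * (exp (L\<^sup>2) * ?E)"
      proof -
        have "c * L \<le> 1 / 8 * L" using c L by (intro mult_right_mono) auto
        moreover have "0 \<le> (L - 1/8)\<^sup>2" by simp
        ultimately have "1 + L\<^sup>2 / 2 \<le> 2 + (L\<^sup>2 + - c * L)"
          by (simp add: power2_eq_square algebra_simps)
        then show ?thesis by (simp flip: exp_add)
      qed
      finally show ?thesis by (simp add: NL)
    qed
    finally have 2: "norm (\<Sum>k<N. \<Sum>n\<le>k. mu n / of_nat n) \<le> C0 * (exp 2 * (real N * ?E) + real N * ?E)"
      using C0 by (simp add: mult_left_mono)
    have 3: "norm (of_nat N * (\<Sum>n\<le>N. mu n / of_nat n)) \<le> real N * (C0 * ?E)"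
      unfolding norm_mult using m[OF N] 1 C0
      by (intro mult_mono) (auto simp: L_def intro: order.trans mult_left_mono)
    have "norm (\<Sum>n\<le>N. mu n) \<le> norm (of_nat N * (\<Sum>n\<le>N. mu n / of_nat n)) + norm (\<Sum>k<N. \<Sum>n\<le>k. mu n / of_nat n)"
      unfolding sum_mu_Abel by (rule norm_triangle_ineq4)
    also have "\<dots> \<le> real N * (C0 * ?E) + C0 * (exp 2 * (real N * ?E) + real N * ?E)" by (intro add_mono 2 3)
    also have "\<dots> = C * (real N * ?E)" by (simp add: C_def algebra_simps)
    finally show ?thesis by (simp add: L_def)
  qed
  have "norm (summatory mu x) \<le> (C * exp 1) * (x * exp (- c * sqrt (ln x)))" if x: "x \<ge> 1" for x
  proof -
    define N where "N = nat \<lfloor>x\<rfloor>"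
    have N12: "N \<ge> 1" "real N \<le> x" "x < real N + 1" using x unfolding N_def by linarith+
    then have N: "N \<ge> 1" "real N \<le> x" "x \<le> 2 * real N" by linarith+
    have "norm (summatory mu x) \<le> C * (real N * exp (- c * sqrt (ln (real N))))"
      using M[OF N(1)] x by (simp add: summatory_eq_sum_atMost N_def)
    also have "\<dots> \<le> C * (x * (exp 1 * exp (- c * sqrt (ln x))))"
    proof (intro mult_left_mono mult_mono N)
      \<comment> \<open>The integer part of x is at least x / 2, so the square root of the logarithm
        drops by at most 1; this is the factor exp 1.\<close>
      have "sqrt (ln x) - 1 \<le> sqrt (ln (real N))"
      proof (cases "x \<le> 2")
        case True
        have "sqrt (ln x) \<le> 1" using x True ln_le_minus_one[of x] by simp
        moreover have "sqrt (ln (real N)) \<ge> 0" using N by simp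
        ultimately show ?thesis by linarith
      next
        case False
        then have "sqrt (ln x) - sqrt (ln 2) \<le> sqrt (ln (x / 2))" by (intro sqrt_ln_divide_ge) auto
        moreover have "sqrt (ln 2) \<le> 1" using ln_le_minus_one[of "2::real"] by simp
        moreover have "sqrt (ln (x / 2)) \<le> sqrt (ln (real N))" using N x by (intro real_sqrt_le_mono ln_mono) auto
        ultimately show ?thesis by linarith
      qed
      then have "c * (sqrt (ln x) - 1) \<le> c * sqrt (ln (real N))" using c by (intro mult_left_mono) auto
      then have "- c * sqrt (ln (real N)) \<le> 1 + - c * sqrt (ln x)" using c by (simp add: algebra_simps)
      then show "exp (- c * sqrt (ln (real N))) \<le> exp 1 * exp (- c * sqrt (ln x))" by (simp flip: exp_add)
    qed (use C x in auto)
    finally show ?thesis by (simp add: mult_ac)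
  qed
  moreover have "C * exp 1 > 0" using C by simp
  ultimately show ?thesis using that c by blast
qed

lemma multiplicative_fun_squarefree:
  assumes f: "multiplicative_fun f" and n: "squarefree n"
  shows "f n = (\<Prod>p\<in>prime_factors n. f p)"
  using n
proof (induction n rule: less_induct)
  case (less n)
  show ?case
  proof (cases "n = 1")
    case True
    then show ?thesis using f by (simp add: multiplicative_fun_def)
  next
    case False
    then obtain p where p: "prime p" "p dvd n" using prime_factor_nat by blast
    then obtain m where m: "n = p * m" by auto
    have n0: "n > 0" using less.prems not_squarefree_0 by (metis gr0I)
    have m0: "m > 0" and p0: "p > 1" using n0 m prime_gt_1_nat[OF p(1)] by auto
    have ndvd: "\<not> p dvd m"
    proof
      assume "p dvd m"
      then have "p\<^sup>2 dvd n" unfolding m by (simp add: power2_eq_square)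
      then have "p dvd 1" using less.prems by (rule squarefreeD[rotated])
      then show False using p0 by simp
    qed
    have "coprime p m" using p ndvd by (simp add: prime_imp_coprime_nat)
    then have "f n = f p * f m" using f m0 p0 unfolding m multiplicative_fun_def by simp
    moreover have "squarefree m" by (rule squarefree_mono[of m n]) (use less.prems m in auto)
    then have "f m = (\<Prod>p\<in>prime_factors m. f p)"
      using p0 m0 by (intro less.IH) (auto simp: m)
    moreover have "prime_factors n = insert p (prime_factors m)"
      unfolding m using p m0 by (simp add: prime_factors_product prime_prime_factors)
    moreover have "p \<notin> prime_factors m" using ndvd by auto
    ultimately show ?thesis by simp
  qed
qed

section \<open>Dirichlet characters and their partial sums\<close>

lemma character_mult_fun: "dirichlet_character q \<chi> \<Longrightarrow> multiplicative_fun \<chi>"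
  by (simp add: dirichlet_character_def multiplicative_fun_def)

lemma character_add_mult: "dirichlet_character q \<chi> \<Longrightarrow> \<chi> (n + k * q) = \<chi> n"
proof (induction k)
  case (Suc k)
  have "\<chi> (n + Suc k * q) = \<chi> ((n + k * q) + q)" by (simp add: algebra_simps)
  also have "\<dots> = \<chi> n" using Suc unfolding dirichlet_character_def by metis
  finally show ?case .
qed simp

lemma character_mod: "dirichlet_character q \<chi> \<Longrightarrow> \<chi> (n mod q) = \<chi> n"
  using character_add_mult[of q \<chi> "n mod q" "n div q"] by (simp add: mult.commute)

lemma character_power:
  assumes "dirichlet_character q \<chi>"
  shows "\<chi> (n ^ k) = \<chi> n ^ k"
  using assms by (induction k) (simp_all add: dirichlet_character_def)

text \<open>By Euler's theorem \<open>\<chi> n\<close> is a root of unity.\<close>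

lemma norm_character:
  assumes \<chi>: "dirichlet_character q \<chi>" and n: "coprime n q"
  shows "norm (\<chi> n) = 1"
proof -
  have q: "q > 0" and 1: "\<chi> 1 = 1" using \<chi> by (simp_all add: dirichlet_character_def)
  have "[n ^ totient q = 1] (mod q)" using n by (rule euler_theorem)
  then have "n ^ totient q mod q = 1 mod q" by (simp add: cong_def)
  then have "\<chi> n ^ totient q = 1"
    using character_mod[OF \<chi>, of "n ^ totient q"] character_mod[OF \<chi>, of 1] character_power[OF \<chi>] 1 by metis
  then have "norm (\<chi> n) ^ totient q = 1" by (metis norm_one norm_power)
  then show ?thesis using power_eq_imp_eq_base[of "norm (\<chi> n)" "totient q" 1] q by simp
qed

lemma real_character_values:
  assumes \<chi>: "dirichlet_character q \<chi>" and real: "\<forall>n. \<chi> n \<in> \<real>"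
  shows "coprime n q \<Longrightarrow> \<chi> n \<in> {1, -1}" and "\<not> coprime n q \<Longrightarrow> \<chi> n = 0"
proof -
  show "\<not> coprime n q \<Longrightarrow> \<chi> n = 0" using \<chi> by (simp add: dirichlet_character_def)
  assume "coprime n q"
  then have "norm (\<chi> n) = 1" by (rule norm_character[OF \<chi>])
  moreover obtain r where "\<chi> n = of_real r" using real by (metis Reals_cases)
  ultimately show "\<chi> n \<in> {1, -1}" by (auto simp: abs_if split: if_splits)
qed

lemma norm_character_le:
  assumes \<chi>: "dirichlet_character q \<chi>"
  shows "norm (\<chi> n) \<le> 1"
proof (cases "coprime n q")
  case True
  then show ?thesis using norm_character[OF \<chi>] by simp
next
  case False
  then have "\<chi> n = 0" using \<chi> unfolding dirichlet_character_def by blast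
  then show ?thesis by simp
qed

text \<open>Multiplication by some a coprime to q with \<open>\<chi> a\<close> different from 1
  permutes the residues, so the sum equals \<open>\<chi> a\<close> times itself.\<close>

lemma sum_character_period:
  assumes \<chi>: "dirichlet_character q \<chi>" and np: "\<chi> \<noteq> principal_character q"
  shows "(\<Sum>n<q. \<chi> n) = 0"
proof -
  have q: "q > 0" using \<chi> by (simp add: dirichlet_character_def)
  obtain a where a: "coprime a q" "\<chi> a \<noteq> 1"
  proof -
    obtain n where "\<chi> n \<noteq> principal_character q n" using np by blast
    then show ?thesis using \<chi> that[of n]
      by (cases "coprime n q") (auto simp: principal_character_def dirichlet_character_def)
  qed
  have inj: "inj_on (\<lambda>n. a * n mod q) {..<q}"
  proof (rule inj_onI)
    fix x y assume xy: "x \<in> {..<q}" "y \<in> {..<q}" "a * x mod q = a * y mod q"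
    then have "[a * x = a * y] (mod q)" by (simp add: cong_def)
    then have "[x = y] (mod q)" using a(1) by (simp add: cong_mult_lcancel_nat)
    then show "x = y" using xy by (simp add: cong_def)
  qed
  have "(\<lambda>n. a * n mod q) ` {..<q} = {..<q}"
    by (rule endo_inj_surj[OF _ _ inj]) (use q in auto)
  then have "(\<Sum>n<q. \<chi> n) = (\<Sum>n<q. \<chi> (a * n mod q))"
    using sum.reindex[OF inj, of \<chi>] by simp
  also have "\<dots> = \<chi> a * (\<Sum>n<q. \<chi> n)"
    using \<chi> by (simp add: character_mod[OF \<chi>] dirichlet_character_def sum_distrib_left)
  finally show ?thesis using a(2) by simp
qed

lemma norm_sum_character_le:
  assumes \<chi>: "dirichlet_character q \<chi>" and np: "\<chi> \<noteq> principal_character q"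
  shows "norm (\<Sum>n<M. \<chi> n) \<le> real q"
proof -
  have q: "q > 0" using \<chi> by (simp add: dirichlet_character_def)
  have block: "(\<Sum>n<k * q + r. \<chi> n) = (\<Sum>n<r. \<chi> n)" for k r
  proof (induction k)
    case (Suc k)
    have "(\<Sum>n<Suc k * q + r. \<chi> n) = (\<Sum>n<q. \<chi> n) + (\<Sum>n<k * q + r. \<chi> (n + q))"
    proof -
      have "(\<Sum>n<q + M. \<chi> n) = (\<Sum>n<q. \<chi> n) + (\<Sum>n<M. \<chi> (n + q))" for M
        by (induction M) (simp_all add: algebra_simps)
      from this[of "k * q + r"] show ?thesis by (simp add: algebra_simps)
    qed
    also have "\<dots> = (\<Sum>n<k * q + r. \<chi> n)"
      using \<chi> sum_character_period[OF \<chi> np] by (simp add: dirichlet_character_def)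
    finally show ?case using Suc by simp
  qed simp
  have "(\<Sum>n<M. \<chi> n) = (\<Sum>n<M mod q. \<chi> n)"
    using block[of "M div q" "M mod q"] by simp
  also have "norm \<dots> \<le> (\<Sum>n<M mod q. 1)"
    by (rule sum_norm_le) (rule norm_character_le[OF \<chi>])
  also have "\<dots> \<le> real q" using q by (simp add: less_imp_le)
  finally show ?thesis .
qed

lemma norm_summatory_character_le:
  assumes \<chi>: "dirichlet_character q \<chi>" and np: "\<chi> \<noteq> principal_character q"
  shows "norm (summatory \<chi> x) \<le> real q + 1"
proof (cases "x < 1")
  case False
  \<comment> \<open>The sum over residues starts at 0 and \<open>summatory\<close> at 1; the
    difference \<open>\<chi> 0\<close> is the source of the \<open>+ 1\<close>.\<close>
  have "(\<Sum>n<Suc (nat \<lfloor>x\<rfloor>). \<chi> n) = \<chi> 0 + summatory \<chi> x"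
  proof -
    have "{..<Suc (nat \<lfloor>x\<rfloor>)} = insert 0 {n. n > 0 \<and> real n \<le> x}"
      using False by (auto simp: le_nat_floor less_Suc_eq_le) linarith+
    then show ?thesis by (simp add: summatory_def)
  qed
  then have "summatory \<chi> x = (\<Sum>n<Suc (nat \<lfloor>x\<rfloor>). \<chi> n) - \<chi> 0" by simp
  then have "norm (summatory \<chi> x) \<le> norm (\<Sum>n<Suc (nat \<lfloor>x\<rfloor>). \<chi> n) + norm (\<chi> 0)"
    by (metis norm_triangle_ineq4)
  then show ?thesis using norm_sum_character_le[OF assms, of "Suc (nat \<lfloor>x\<rfloor>)"] norm_character_le[OF \<chi>, of 0]
    by linarith
qed (simp add: summatory_eq_0)

text \<open>d^2 divides n exactly if d divides the square part of n, so this is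
  \<open>sum_mu_divisors\<close> for the square part.\<close>

lemma sum_mu_square_divisors:
  assumes n: "n > 0"
  shows "(\<Sum>d | d\<^sup>2 dvd n. mu d) = (if squarefree n then 1 else 0)"
proof -
  have "{d. d\<^sup>2 dvd n} = {d. d dvd square_part n}" by (simp add: dvd_square_part_iff)
  moreover have "square_part n > 0" using n by (metis gr0I less_numeral_extra(3) square_part_0_iff)
  moreover have "square_part n = 1 \<longleftrightarrow> squarefree n"
  proof
    assume "square_part n = 1"
    then have "d dvd 1" if "d\<^sup>2 dvd n" for d using that dvd_square_part_iff[of d n] by simp
    then show "squarefree n" by (auto intro: squarefreeI)
  next
    assume "squarefree n"
    then have "square_part n dvd 1" using square_part_square_dvd by (rule squarefreeD)
    then show "square_part n = 1" by simp
  qed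
  ultimately show ?thesis using sum_mu_divisors[of "square_part n"] by simp
qed

text \<open>The ratio \<theta> must stay below 1 even at p = 2, or the value at that prime could not
  be changed. For l = ln p >= 1/2 the exponent is at most -l/2 + l/4 <= -1/8.\<close>

lemma prime_powr_exp_le:
  assumes p: "prime p" and c: "0 < c" "c \<le> 1 / 8" and a: "a \<ge> 1 / 2"
  shows "real p powr (- a) * exp (c * sqrt (ln (real p))) \<le> 9 / 10"
proof -
  have p2: "real p \<ge> 2" using prime_ge_2_nat[OF p] by simp
  define l where "l = ln (real p)"
  have l2: "l \<ge> 1 / 2"
  proof -
    have "1 / 2 \<le> ln (2::real)" using ln2_ge_two_thirds by simp
    also have "\<dots> \<le> l" unfolding l_def using p2 by (intro ln_mono) auto
    finally show ?thesis .
  qed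
  have "sqrt l \<le> 2 * l" using l2 by (intro real_le_lsqrt) (auto simp: power2_eq_square)
  then have "c * sqrt l \<le> 1 / 8 * (2 * l)" using c l2 by (intro mult_mono) auto
  moreover have "1 / 2 * l \<le> a * l" using a l2 by (intro mult_right_mono) auto
  ultimately have "- a * l + c * sqrt l \<le> - (1 / 8)" using l2 by linarith
  then have "exp (- a * l + c * sqrt l) \<le> exp (- (1 / 8))" by simp
  also have "\<dots> \<le> 9 / 10"
  proof -
    have "9 / 8 \<le> exp (1 / 8 :: real)" using exp_ge_add_one_self[of "1 / 8"] by simp
    then show ?thesis by (simp add: exp_minus field_simps)
  qed
  finally have "exp (- a * l + c * sqrt l) \<le> 9 / 10" .
  moreover have "real p powr (- a) * exp (c * sqrt (ln (real p))) = exp (- a * l + c * sqrt l)"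
    unfolding exp_add l_def using p2 by (simp add: powr_def)
  ultimately show ?thesis by simp
qed

text \<open>This supplies the hypothesis on W in the lemmas on changing primes, with a = 1 for
  \<open>mu\<close> and a = 1/2 for the final weight.\<close>

lemma weight_divide_le:
  assumes p: "1 \<le> p" "p \<le> x" and c: "c \<ge> 0"
  shows "(x / p) powr a * exp (- c * sqrt (ln (x / p)))
    \<le> (p powr (- a) * exp (c * sqrt (ln p))) * (x powr a * exp (- c * sqrt (ln x)))"
proof -
  have "c * (sqrt (ln x) - sqrt (ln p)) \<le> c * sqrt (ln (x / p))"
    using sqrt_ln_divide_ge[OF p] c by (intro mult_left_mono)
  then have "exp (- c * sqrt (ln (x / p))) \<le> exp (c * sqrt (ln p)) * exp (- c * sqrt (ln x))"
    by (simp add: algebra_simps flip: exp_add)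
  then have "(x / p) powr a * exp (- c * sqrt (ln (x / p)))
      \<le> (x / p) powr a * (exp (c * sqrt (ln p)) * exp (- c * sqrt (ln x)))" by (intro mult_left_mono) auto
  also have "\<dots> = (p powr (- a) * exp (c * sqrt (ln p))) * (x powr a * exp (- c * sqrt (ln x)))"
    using p by (simp add: powr_divide powr_minus_divide)
  finally show ?thesis .
qed

text \<open>The restriction of \<open>mu\<close> to arguments coprime to q is \<open>mu\<close> with
  its values at the primes dividing q changed to 0, a first application of the change of
  primes.\<close>

lemma summatory_mu_coprime_bound:
  assumes q: "q > 0"
  obtains C c :: real where "C > 0" "0 < c" "c \<le> 1 / 8"
    "\<And>x. x \<ge> 1 \<Longrightarrow> norm (summatory (sqf_mult (\<lambda>p. if p \<in> prime_factors q then 0 else - 1)) x)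
      \<le> C * (x * exp (- c * sqrt (ln x)))"
proof -
  obtain C c :: real where C: "C > 0" "0 < c" "c \<le> 1 / 8" and
    bd: "\<And>x. x \<ge> 1 \<Longrightarrow> norm (summatory mu x) \<le> C * (x * exp (- c * sqrt (ln x)))"
    using summatory_mu_bound by blast
  define \<theta> where "\<theta> p = real p powr (- 1) * exp (c * sqrt (ln (real p)))" for p
  define D where "D = (\<Prod>p\<in>prime_factors q. (1 + \<theta> p) / (1 - \<theta> p))"
  have \<theta>: "0 < \<theta> p" "\<theta> p < 1" if "p \<in> prime_factors q" for p
  proof -
    have p: "prime p" using that by auto
    show "0 < \<theta> p" using prime_gt_0_nat[OF p] by (simp add: \<theta>_def)
    have "\<theta> p \<le> 9 / 10" unfolding \<theta>_def by (rule prime_powr_exp_le[OF p C(2,3)]) simp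
    then show "\<theta> p < 1" by linarith
  qed
  have D: "D > 0" unfolding D_def using \<theta> by (intro prod_pos) (simp add: add_pos_pos)
  have "norm (summatory (sqf_mult (\<lambda>p. if p \<in> prime_factors q then 0 else - 1)) x)
      \<le> C * D * (x * exp (- c * sqrt (ln x)))" if x: "x \<ge> 1" for x
    unfolding D_def
  proof (rule summatory_sqf_mult_change_finite[where W = "\<lambda>x. x * exp (- c * sqrt (ln x))"])
    show "x / real p * exp (- c * sqrt (ln (x / real p))) \<le> \<theta> p * (x * exp (- c * sqrt (ln x)))"
      if "p \<in> prime_factors q" "real p \<le> x" for p x
    proof -
      have "prime p" using that by auto
      then have p: "real p \<ge> 1" using prime_ge_1_nat[of p] by simp
      then show ?thesis using weight_divide_le[of "real p" x c 1] that C unfolding \<theta>_def by simp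
    qed
    show "norm (summatory (sqf_mult (\<lambda>_. - 1)) x) \<le> C * (x * exp (- c * sqrt (ln x)))" if "x \<ge> 1" for x
      using bd[OF that] unfolding mu_def .
  qed (use \<theta> C x less_imp_le in auto)
  then show ?thesis using that[of "C * D" c] C D by simp
qed

section \<open>The hyperbola method\<close>

lemma card_pos_le: "x \<ge> 0 \<Longrightarrow> real (card {n::nat. n > 0 \<and> real n \<le> x}) \<le> x"
proof -
  assume x: "x \<ge> 0"
  have "card {n::nat. n > 0 \<and> real n \<le> x} \<le> card {1..nat \<lfloor>x\<rfloor>}"
    by (intro card_mono) (auto simp: le_nat_floor)
  moreover have "real (nat \<lfloor>x\<rfloor>) \<le> x" using x by simp
  ultimately show ?thesis by simp
qed

lemma norm_summatory_le:
  assumes "\<And>n. norm (f n) \<le> 1" "x \<ge> 0"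
  shows "norm (summatory f x) \<le> x"
proof -
  have "norm (summatory f x) \<le> (\<Sum>n | n > 0 \<and> real n \<le> x. 1)"
    unfolding summatory_def by (rule sum_norm_le) (use assms in auto)
  then show ?thesis using card_pos_le[OF assms(2)] by simp
qed

definition hyp_region :: "real \<Rightarrow> (nat \<times> nat) set" where
  "hyp_region x = {(d, m). d > 0 \<and> m > 0 \<and> (real d)\<^sup>2 * real m \<le> x}"

lemma hyp_region_bounds:
  assumes "(d, m) \<in> hyp_region x"
  shows "real d \<le> x" "real m \<le> x"
proof -
  have d: "real d \<ge> 1" "real m \<ge> 1" "(real d)\<^sup>2 * real m \<le> x" using assms by (auto simp: hyp_region_def)
  have d2: "1 \<le> (real d)\<^sup>2" using power_mono[of 1 "real d" 2] d by simp
  have "real d \<le> (real d)\<^sup>2" using d by (simp add: power2_eq_square)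
  also have "\<dots> \<le> (real d)\<^sup>2 * real m" using d d2 mult_left_mono[of 1 "real m" "(real d)\<^sup>2"] by simp
  finally show "real d \<le> x" using d by simp
  have "1 * real m \<le> (real d)\<^sup>2 * real m" using d d2 by (intro mult_right_mono) auto
  then show "real m \<le> x" using d(3) by linarith
qed

lemma finite_hyp_region: "finite (hyp_region x)"
proof (rule finite_subset)
  show "hyp_region x \<subseteq> {n. n > 0 \<and> real n \<le> x} \<times> {n. n > 0 \<and> real n \<le> x}"
    using hyp_region_bounds by (fastforce simp: hyp_region_def)
qed auto

text \<open>Pairs with d <= D are summed over m first, each inner sum being at most Q. Pairs with d
  > D have m <= x / D^2 and are summed over d first; the inner sum is a difference of two values of
  \<open>summatory g\<close>, hence 2U. Its upper end sqrt (x / m) lies between D and sqrt x, the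
  range in which U is assumed.\<close>

lemma hyperbola_bound:
  fixes g \<psi> :: "nat \<Rightarrow> complex"
  assumes D: "1 \<le> D" "D \<le> sqrt x" and g: "\<And>n. norm (g n) \<le> 1" and \<psi>: "\<And>n. norm (\<psi> n) \<le> 1"
    and Q: "\<And>y. norm (summatory \<psi> y) \<le> Q"
    and U: "\<And>y. D \<le> y \<Longrightarrow> y \<le> sqrt x \<Longrightarrow> norm (summatory g y) \<le> U"
  shows "norm (\<Sum>(d, m)\<in>hyp_region x. g d * \<psi> m) \<le> D * Q + x / D\<^sup>2 * (2 * U)"
proof -
  have "1 \<le> sqrt x" using D by linarith
  then have x: "x \<ge> 1" by simp
  let ?A1 = "{d::nat. d > 0 \<and> real d \<le> D}" and ?A2 = "{m::nat. m > 0 \<and> real m \<le> x / D\<^sup>2}"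
  let ?R1 = "{(d, m)\<in>hyp_region x. real d \<le> D}" and ?R2 = "{(d, m)\<in>hyp_region x. \<not> real d \<le> D}"
  let ?h = "\<lambda>(d, m). g d * \<psi> m"
  have fin: "finite {d::nat. real d > D \<and> real d \<le> y}" for y
    by (rule finite_subset[OF _ finite_pos_le_real[of y]]) (use D in auto)
  have Q0: "Q \<ge> 0" and U0: "U \<ge> 0"
    using order.trans[OF norm_ge_zero Q[of 0]] order.trans[OF norm_ge_zero U[of D]] D by auto
  have "(\<Sum>dm\<in>hyp_region x. ?h dm) = (\<Sum>dm\<in>?R1. ?h dm) + (\<Sum>dm\<in>?R2. ?h dm)"
    by (subst sum.union_disjoint[symmetric])
       (auto intro: finite_subset[OF _ finite_hyp_region] intro!: sum.cong)
  moreover have "norm (\<Sum>dm\<in>?R1. ?h dm) \<le> D * Q"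
  proof -
    have "?R1 = Sigma ?A1 (\<lambda>d. {m. m > 0 \<and> real m \<le> x / (real d)\<^sup>2})"
      by (auto simp: hyp_region_def field_simps)
    then have "(\<Sum>dm\<in>?R1. ?h dm) = (\<Sum>d\<in>?A1. g d * summatory \<psi> (x / (real d)\<^sup>2))"
      by (simp add: sum.Sigma[symmetric] summatory_def sum_distrib_left)
    also have "norm \<dots> \<le> (\<Sum>d\<in>?A1. 1 * Q)"
    proof (rule sum_norm_le)
      show "norm (g d * summatory \<psi> (x / (real d)\<^sup>2)) \<le> 1 * Q" for d
        unfolding norm_mult by (intro mult_mono g Q) auto
    qed
    also have "\<dots> \<le> D * Q" using card_pos_le[of D] D Q0 by (simp add: mult_right_mono)
    finally show ?thesis .
  qed
  moreover have "norm (\<Sum>dm\<in>?R2. ?h dm) \<le> x / D\<^sup>2 * (2 * U)"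
  proof -
    have "(\<Sum>dm\<in>?R2. ?h dm) = (\<Sum>m\<in>?A2. \<psi> m * (\<Sum>d | real d > D \<and> real d \<le> sqrt (x / real m). g d))"
    proof -
      have 1: "m \<in> ?A2" "real d \<le> sqrt (x / real m)" if "(d, m) \<in> ?R2" for d m
      proof -
        have dm: "d > 0" "m > 0" "(real d)\<^sup>2 * real m \<le> x" "real d > D" using that by (auto simp: hyp_region_def)
        have "D\<^sup>2 * real m \<le> (real d)\<^sup>2 * real m" using dm D by (intro mult_right_mono power_mono) auto
        then have "D\<^sup>2 * real m \<le> x" using dm(3) by linarith
        then show "m \<in> ?A2" using D dm by (simp add: field_simps)
        show "real d \<le> sqrt (x / real m)" using dm by (intro real_le_rsqrt) (simp add: field_simps)
      qed
      have 2: "(d, m) \<in> ?R2" if "m \<in> ?A2" "real d > D" "real d \<le> sqrt (x / real m)" for d m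
      proof -
        have "(real d)\<^sup>2 \<le> (sqrt (x / real m))\<^sup>2" using that by (intro power_mono) auto
        then have "(real d)\<^sup>2 \<le> x / real m" using x by simp
        then show ?thesis using that D by (auto simp: hyp_region_def field_simps)
      qed
      let ?S = "Sigma ?A2 (\<lambda>m. {d. real d > D \<and> real d \<le> sqrt (x / real m)})"
      have "?R2 = prod.swap ` ?S"
      proof (intro equalityI subsetI)
        fix a assume a: "a \<in> ?R2"
        obtain d m where dm: "a = (d, m)" by (cases a)
        have "real d > D" using a dm by simp
        then have "(m, d) \<in> ?S" using 1[of d m] a unfolding dm by blast
        then show "a \<in> prod.swap ` ?S" unfolding dm by (intro image_eqI[of _ _ "(m, d)"]) simp_all
      next
        fix a assume "a \<in> prod.swap ` ?S"
        then obtain m d where md: "a = (d, m)" "(m, d) \<in> ?S" by auto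
        then show "a \<in> ?R2" using 2[of m d] unfolding md(1) by blast
      qed
      then have "(\<Sum>dm\<in>?R2. ?h dm) = (\<Sum>a\<in>prod.swap ` ?S. ?h a)" by (rule arg_cong)
      also have "\<dots> = (\<Sum>(m, d)\<in>?S. \<psi> m * g d)"
        by (subst sum.reindex) (auto simp: mult.commute intro!: sum.cong)
      also have "\<dots> = (\<Sum>m\<in>?A2. \<Sum>d | real d > D \<and> real d \<le> sqrt (x / real m). \<psi> m * g d)"
        by (rule sum.Sigma[symmetric]) (use fin in auto)
      finally show ?thesis by (simp add: sum_distrib_left)
    qed
    also have "norm \<dots> \<le> (\<Sum>m\<in>?A2. 1 * (2 * U))"
    proof (rule sum_norm_le)
      fix m assume m: "m \<in> ?A2"
      define y where "y = sqrt (x / real m)"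
      have m1: "real m \<ge> 1" using m by auto
      have "D\<^sup>2 \<le> x / real m" using m D by (auto simp: field_simps)
      then have y: "D \<le> y" unfolding y_def by (rule real_le_rsqrt)
      have "x / real m \<le> x / 1" using m1 x by (intro divide_left_mono) auto
      then have y': "y \<le> sqrt x" unfolding y_def by simp
      have "summatory g y = summatory g D + (\<Sum>d | real d > D \<and> real d \<le> y. g d)"
        unfolding summatory_def
        by (subst sum.union_disjoint[symmetric])
           (use y D in \<open>auto intro!: sum.cong intro: finite_subset[OF _ finite_pos_le_real[of y]]\<close>)
      then have "norm (\<Sum>d | real d > D \<and> real d \<le> y. g d) \<le> norm (summatory g y) + norm (summatory g D)"
        using norm_triangle_ineq4[of "summatory g y" "summatory g D"] by simp
      also have "\<dots> \<le> 2 * U" using U[OF y y'] U[of D] D by simp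
      finally show "norm (\<psi> m * (\<Sum>d | real d > D \<and> real d \<le> sqrt (x / real m). g d)) \<le> 1 * (2 * U)"
        unfolding norm_mult y_def[symmetric] using \<psi>[of m] U0 by (intro mult_mono) auto
    qed
    also have "\<dots> = real (card ?A2) * (2 * U)" by simp
    also have "\<dots> \<le> x / D\<^sup>2 * (2 * U)"
      using x U0 by (intro mult_right_mono card_pos_le) auto
    finally show ?thesis .
  qed
  ultimately show ?thesis
    using norm_triangle_ineq[of "\<Sum>dm\<in>?R1. ?h dm" "\<Sum>dm\<in>?R2. ?h dm"] by simp
qed

lemma summatory_sqf_character:
  assumes \<chi>: "dirichlet_character q \<chi>" and real: "\<forall>n. \<chi> n \<in> \<real>"
  defines "g \<equiv> sqf_mult (\<lambda>p. if p \<in> prime_factors q then 0 else - 1)"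
  shows "summatory (sqf_mult \<chi>) x = (\<Sum>(d, m)\<in>hyp_region x. g d * \<chi> m)"
proof -
  have q: "q > 0" and mult: "\<And>m n. \<chi> (m * n) = \<chi> m * \<chi> n" using \<chi> by (auto simp: dirichlet_character_def)
  \<comment> \<open>A real character has values 0, 1 and -1, so at primes its square is the
    indicator of not dividing q.\<close>
  have \<chi>p: "(\<chi> p)\<^sup>2 = (if p \<in> prime_factors q then 0 else 1)" if p: "prime p" for p
  proof (cases "p dvd q")
    case True
    then have "\<not> coprime p q" using p by (metis coprime_absorb_left not_prime_unit)
    then show ?thesis using True p q real_character_values(2)[OF \<chi> real] by (simp add: in_prime_factors_iff)
  next
    case False
    then have "coprime p q" using p by (simp add: prime_imp_coprime_nat)
    then show ?thesis using False real_character_values(1)[OF \<chi> real \<open>coprime p q\<close>] by auto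
  qed
  have g: "g d = mu d * (\<chi> d)\<^sup>2" for d
  proof (cases "squarefree d")
    case True
    have "mu d * (\<chi> d)\<^sup>2 = (\<Prod>p\<in>prime_factors d. - 1 * (\<chi> p)\<^sup>2)"
    proof -
      have "mu d = (\<Prod>p\<in>prime_factors d. - 1)" using True by (simp add: mu_def sqf_mult_def)
      moreover have "(\<chi> d)\<^sup>2 = (\<Prod>p\<in>prime_factors d. (\<chi> p)\<^sup>2)"
        using multiplicative_fun_squarefree[OF character_mult_fun[OF \<chi>] True] by (simp add: prod_power_distrib)
      ultimately show ?thesis unfolding prod.distrib by (rule arg_cong2)
    qed
    also have "\<dots> = g d" unfolding g_def sqf_mult_def using True
      by (auto intro!: prod.cong simp: \<chi>p in_prime_factors_imp_prime)
    finally show ?thesis by simp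
  qed (simp add: g_def mu_def sqf_mult_def)
  have pt: "sqf_mult \<chi> n = (\<Sum>d | d\<^sup>2 dvd n. g d * \<chi> (n div d\<^sup>2))" if n: "n > 0" for n
  proof -
    have "sqf_mult \<chi> n = (if squarefree n then 1 else 0) * \<chi> n"
      using multiplicative_fun_squarefree[OF character_mult_fun[OF \<chi>]] by (simp add: sqf_mult_def)
    also have "\<dots> = (\<Sum>d | d\<^sup>2 dvd n. mu d * \<chi> n)"
      unfolding sum_mu_square_divisors[OF n, symmetric] sum_distrib_right ..
    also have "\<dots> = (\<Sum>d | d\<^sup>2 dvd n. g d * \<chi> (n div d\<^sup>2))"
    proof (intro sum.cong refl)
      fix d assume "d \<in> {d. d\<^sup>2 dvd n}"
      then have "\<chi> n = \<chi> (d * d) * \<chi> (n div d\<^sup>2)" using mult[of "d\<^sup>2" "n div d\<^sup>2"] by (simp add: power2_eq_square)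
      then show "mu d * \<chi> n = g d * \<chi> (n div d\<^sup>2)" unfolding g mult by (simp add: power2_eq_square)
    qed
    finally show ?thesis .
  qed
  have fin: "finite {d. d\<^sup>2 dvd n}" if "n > 0" for n :: nat
  proof (rule finite_subset)
    show "{d. d\<^sup>2 dvd n} \<subseteq> {..n}"
    proof
      fix d assume "d \<in> {d. d\<^sup>2 dvd n}"
      then have "d dvd n" by (auto intro: dvd_trans[of d "d\<^sup>2"])
      then show "d \<in> {..n}" using that by (auto dest: dvd_imp_le)
    qed
  qed simp
  have "summatory (sqf_mult \<chi>) x = (\<Sum>n | n > 0 \<and> real n \<le> x. \<Sum>d | d\<^sup>2 dvd n. g d * \<chi> (n div d\<^sup>2))"
    unfolding summatory_def by (intro sum.cong refl pt) auto
  also have "\<dots> = (\<Sum>(n, d)\<in>Sigma {n. n > 0 \<and> real n \<le> x} (\<lambda>n. {d. d\<^sup>2 dvd n}). g d * \<chi> (n div d\<^sup>2))"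
    by (rule sum.Sigma) (use fin in auto)
  also have "\<dots> = (\<Sum>(d, m)\<in>hyp_region x. g d * \<chi> m)"
  proof (rule sum.reindex_bij_witness[of _ "\<lambda>(d, m). (d\<^sup>2 * m, d)" "\<lambda>(n, d). (d, n div d\<^sup>2)"])
    fix a assume a: "a \<in> Sigma {n. n > 0 \<and> real n \<le> x} (\<lambda>n. {d. d\<^sup>2 dvd n})"
    obtain n d where nd: "a = (n, d)" "n > 0" "real n \<le> x" "d\<^sup>2 dvd n" using a by (cases a) auto
    then obtain m where m: "n = d\<^sup>2 * m" by auto
    have d0: "d > 0" "m > 0" using nd m by auto
    have "(real d)\<^sup>2 * real m \<le> x" using nd(3) unfolding m by simp
    then show "(case a of (n, d) \<Rightarrow> (d, n div d\<^sup>2)) \<in> hyp_region x" using d0 by (simp add: nd(1) m hyp_region_def)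
    show "(case case a of (n, d) \<Rightarrow> (d, n div d\<^sup>2) of (d, m) \<Rightarrow> (d\<^sup>2 * m, d)) = a" using nd by simp
    show "(case case a of (n, d) \<Rightarrow> (d, n div d\<^sup>2) of (d, m) \<Rightarrow> g d * \<chi> m) = (case a of (n, d) \<Rightarrow> g d * \<chi> (n div d\<^sup>2))"
      by (simp add: nd(1))
  next
    fix b assume "b \<in> hyp_region x"
    then obtain d m where dm: "b = (d, m)" "d > 0" "m > 0" "(real d)\<^sup>2 * real m \<le> x" by (auto simp: hyp_region_def)
    then show "(case b of (d, m) \<Rightarrow> (d\<^sup>2 * m, d)) \<in> Sigma {n. n > 0 \<and> real n \<le> x} (\<lambda>n. {d. d\<^sup>2 dvd n})" by simp
    show "(case case b of (d, m) \<Rightarrow> (d\<^sup>2 * m, d) of (n, d) \<Rightarrow> (d, n div d\<^sup>2)) = b" using dm by simp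
  qed
  finally show ?thesis .
qed

lemma summatory_sqf_character_bound:
  assumes \<chi>: "dirichlet_character q \<chi>" and real: "\<forall>n. \<chi> n \<in> \<real>" and np: "\<chi> \<noteq> principal_character q"
  obtains C c :: real where "C > 0" "0 < c" "c \<le> 1 / 8"
    "\<And>x. x \<ge> 1 \<Longrightarrow> norm (summatory (sqf_mult \<chi>) x) \<le> C * (sqrt x * exp (- c * sqrt (ln x)))"
proof -
  have q: "q > 0" using \<chi> by (simp add: dirichlet_character_def)
  define g where "g = sqf_mult (\<lambda>p. if p \<in> prime_factors q then 0 else - 1)"
  obtain C0 c0 :: real where C0: "C0 > 0" "0 < c0" "c0 \<le> 1 / 8" and
    gbd: "\<And>x. x \<ge> 1 \<Longrightarrow> norm (summatory g x) \<le> C0 * (x * exp (- c0 * sqrt (ln x)))"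
    unfolding g_def using summatory_mu_coprime_bound[OF q] by blast
  \<comment> \<open>With L = sqrt (ln x) and D = sqrt x exp (-c L), the factor x / D^2 = exp (2 c L)
    meets exp (-c0 L / 2) = exp (-3 c L); both parts of the hyperbola bound then carry exp (-c
    L).\<close>
  define c where "c = c0 / 6"
  have c: "0 < c" "c \<le> 1 / 48" using C0 by (auto simp: c_def)
  \<comment> \<open>The 10 covers x <= 3, where the sum is at most 3 and the weight at least
    1/3.\<close>
  define C where "C = real q + 10 + 2 * C0"
  have bd: "norm (summatory (sqf_mult \<chi>) x) \<le> C * (sqrt x * exp (- c * sqrt (ln x)))" if x: "x \<ge> 1" for x
  proof -
    define L where "L = sqrt (ln x)"
    have L0: "L \<ge> 0" and L2: "ln x = L\<^sup>2" using x by (simp_all add: L_def)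
    let ?W = "sqrt x * exp (- c * L)"
    show ?thesis
    proof (cases "L \<le> 1")
      case True
      have "L\<^sup>2 \<le> 1" using True L0 by (simp add: power_le_one)
      then have "ln x \<le> 1" by (simp add: L2)
      then have "exp (ln x) \<le> exp 1" by simp
      then have "x \<le> 3" using x exp_le by simp
      moreover have "norm (summatory (sqf_mult \<chi>) x) \<le> x"
        by (intro norm_summatory_le norm_sqf_mult_le norm_character_le[OF \<chi>]) (use x in auto)
      moreover have "1 / 3 \<le> ?W"
      proof -
        have "c * L \<le> 1 * 1" using c L0 True by (intro mult_mono) auto
        then have "exp (- 1) \<le> exp (- c * L)" by simp
        moreover have "1 / 3 \<le> exp (- 1 :: real)" using exp_le by (simp add: exp_minus field_simps)
        moreover have "1 * exp (- c * L) \<le> ?W" using x by (intro mult_right_mono) auto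
        ultimately show ?thesis by linarith
      qed
      then have "9 * (1 / 3) \<le> C * ?W" using C0 unfolding C_def by (intro mult_mono) auto
      ultimately show ?thesis by (simp add: L_def)
    next
      case False
      define D where "D = sqrt x * exp (- c * L)"
      have sx: "sqrt x = exp (L\<^sup>2 / 2)"
      proof -
        have "exp (L\<^sup>2 / 2) ^ 2 = x" using x by (simp flip: exp_double add: L2[symmetric])
        then show ?thesis by (metis exp_ge_zero real_sqrt_unique)
      qed
      have DL: "D = exp (L\<^sup>2 / 2 - c * L)" by (simp add: D_def sx flip: exp_add)
      have "c * L \<le> 1 / 48 * (L * L)" using c False by (intro mult_mono) auto
      moreover have "(L / 2)\<^sup>2 = L\<^sup>2 / 4" "L * L = L\<^sup>2" by (simp_all add: power2_eq_square)
      \<comment> \<open>For y >= D this yields sqrt (ln y) >= L / 2, the source of the exponent in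
        U.\<close>
      ultimately have lnD: "(L / 2)\<^sup>2 \<le> L\<^sup>2 / 2 - c * L" using zero_le_power2[of L] by linarith
      then have lnD0: "0 \<le> L\<^sup>2 / 2 - c * L" using zero_le_power2[of "L / 2"] by linarith
      have D1: "1 \<le> D" unfolding DL using lnD0 by simp
      have D2: "D \<le> sqrt x" unfolding D_def using c L0 x by (simp add: mult_left_le)
      define U where "U = C0 * (sqrt x * exp (- c0 * (L / 2)))"
      have "norm (summatory (sqf_mult \<chi>) x) \<le> D * (real q + 1) + x / D\<^sup>2 * (2 * U)"
        unfolding summatory_sqf_character[OF \<chi> real] g_def[symmetric]
      proof (rule hyperbola_bound[OF D1 D2])
        show "norm (g n) \<le> 1" for n unfolding g_def by (rule norm_sqf_mult_le) auto
        show "norm (summatory g y) \<le> U" if y: "D \<le> y" "y \<le> sqrt x" for y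
        proof -
          have "L\<^sup>2 / 2 - c * L = ln D" by (simp add: DL)
          also have "\<dots> \<le> ln y" using y D1 by (intro ln_mono) auto
          finally have "(L / 2)\<^sup>2 \<le> ln y" using lnD by linarith
          then have "L / 2 \<le> sqrt (ln y)" by (rule real_le_rsqrt)
          then have "c0 * (L / 2) \<le> c0 * sqrt (ln y)" using C0 by (intro mult_left_mono) auto
          then have "exp (- c0 * sqrt (ln y)) \<le> exp (- c0 * (L / 2))" by simp
          then have "C0 * (y * exp (- c0 * sqrt (ln y))) \<le> U"
            unfolding U_def using y D1 C0 x by (intro mult_left_mono mult_mono) auto
          then show ?thesis using gbd[of y] y D1 by linarith
        qed
      qed (use norm_character_le[OF \<chi>] norm_summatory_character_le[OF \<chi> np] in auto)
      also have "x / D\<^sup>2 = exp (2 * (c * L))"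
      proof -
        have "x = sqrt x ^ 2" using x by simp
        then have "x / D\<^sup>2 = 1 / exp (- c * L) ^ 2" using x unfolding D_def by (simp add: power_mult_distrib)
        then show ?thesis by (simp add: exp_minus field_simps flip: exp_double)
      qed
      also have "exp (2 * (c * L)) * (2 * U) = 2 * C0 * ?W"
      proof -
        have "exp (2 * (c * L)) * exp (- c0 * (L / 2)) = exp (- c * L)"
          by (simp add: c_def flip: exp_add)
        then show ?thesis unfolding U_def by (simp add: mult_ac)
      qed
      also have "D * (real q + 1) + 2 * C0 * ?W = (real q + 1 + 2 * C0) * ?W" by (simp add: D_def algebra_simps)
      also have "\<dots> \<le> C * ?W" using x unfolding C_def by (intro mult_right_mono) auto
      finally show ?thesis by (simp add: L_def)
    qed
  qed
  have "C > 0" "c \<le> 1 / 8" using C0 c by (simp_all add: C_def)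
  then show ?thesis using that[OF _ c(1) _ bd] by simp
qed

section \<open>Exceptional primes\<close>

text \<open>From exp t >= (t / 4)^4 with t = \<eta> sqrt (k + 1): the fourth power turns the square
  root into a square, and the bound becomes summable over k.\<close>

lemma exp_minus_sqrt_le:
  assumes "\<eta> > 0"
  shows "exp (- \<eta> * sqrt (real (Suc k))) \<le> (4 / \<eta>) ^ 4 * (1 / real (Suc k) ^ 2)"
proof -
  define t where "t = \<eta> * sqrt (real (Suc k))"
  have t: "t > 0" using assms by (simp add: t_def)
  have t4: "t ^ 4 = \<eta> ^ 4 * real (Suc k) ^ 2"
  proof -
    have "sqrt (real (Suc k)) ^ 4 = real (Suc k) ^ 2"
      using power_mult[of "sqrt (real (Suc k))" 2 2] by simp
    then show ?thesis by (simp add: t_def power_mult_distrib del: of_nat_Suc)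
  qed
  have "(t / 4) ^ 4 \<le> (1 + t / real 4) ^ 4" using t by (intro power_mono) auto
  also have "\<dots> \<le> exp t" using t by (intro exp_ge_one_plus_x_over_n_power_n) auto
  finally have "1 / exp t \<le> 1 / (t / 4) ^ 4" using t by (intro divide_left_mono) auto
  also have "\<dots> = 4 ^ 4 / t ^ 4" by (simp add: power_divide)
  also have "\<dots> = (4 / \<eta>) ^ 4 * (1 / real (Suc k) ^ 2)"
    unfolding t4 by (simp add: power_divide del: of_nat_Suc)
  finally show ?thesis by (simp add: t_def exp_minus divide_inverse)
qed

text \<open>In the dyadic block 2^k <= p < x = 2^(k+1) there are at most K sqrt x exp (-c sqrt (ln
  x)) elements, each contributing at most sqrt 2 exp (l sqrt (ln x)) / sqrt x. The powers of x
  cancel, and l <= c / 2 leaves exp (-(c / 2) sqrt (ln x)), where ln x is linear in k.\<close>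

lemma sum_sparse_set_bounded:
  fixes B :: "nat set"
  assumes B: "\<And>p. p \<in> B \<Longrightarrow> p \<ge> 1" and K: "K \<ge> 0" and c: "c > 0" and l: "0 \<le> l" "l \<le> c / 2"
    and card: "\<And>x. x \<ge> 1 \<Longrightarrow> real (card {p\<in>B. real p \<le> x}) \<le> K * (sqrt x * exp (- c * sqrt (ln x)))"
  obtains A where "\<And>X. (\<Sum>p | p \<in> B \<and> real p \<le> X. real p powr (- (1/2)) * exp (l * sqrt (ln (real p)))) \<le> A"
proof -
  define \<eta> where "\<eta> = c / 2 * sqrt (ln 2)"
  have \<eta>: "\<eta> > 0" using c by (simp add: \<eta>_def)
  define a where "a k = 2 * K * ((4 / \<eta>) ^ 4 * (1 / real (Suc k) ^ 2))" for k
  define h where "h p = real p powr (- (1/2)) * exp (l * sqrt (ln (real p)))" for p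
  define g where "g p = nat \<lfloor>log 2 (real p)\<rfloor>" for p
  have "summable (\<lambda>k. inverse (real (Suc k) ^ 2))"
    using summable_Suc_iff[of "\<lambda>n. inverse (real n ^ 2)"] inverse_power_summable[of 2, where 'a = real] by simp
  then have a: "summable a" unfolding a_def
    by (intro summable_mult) (simp add: divide_inverse)
  have a0: "a k \<ge> 0" for k using K by (simp add: a_def)
  have "(\<Sum>p | p \<in> B \<and> real p \<le> X. h p) \<le> suminf a" for X
  proof -
    let ?S = "{p. p \<in> B \<and> real p \<le> X}"
    have fin: "finite ?S" by (rule finite_subset[OF _ finite_pos_le_real[of X]]) (use B in force)
    have "(\<Sum>p\<in>?S. h p) = (\<Sum>k\<in>g ` ?S. \<Sum>p | p \<in> ?S \<and> g p = k. h p)"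
      by (rule sum.group[symmetric]) (use fin in auto)
    also have "\<dots> \<le> (\<Sum>k\<in>g ` ?S. a k)"
    proof (rule sum_mono)
      fix k
      define x where "x = (2::real) ^ Suc k"
      define s where "s = sqrt (ln x)"
      have x1: "x \<ge> 1" unfolding x_def by (rule one_le_power) simp
      have s0: "s \<ge> 0" using x1 by (simp add: s_def)
      let ?P = "{p. p \<in> ?S \<and> g p = k}"
      have p: "2 ^ k \<le> real p \<and> real p \<le> x" if "p \<in> ?P" for p
      proof -
        have p1: "real p \<ge> 1" using that B by auto
        then have "log 2 (real p) \<ge> 0" by simp
        then have k: "real k \<le> log 2 (real p)" "log 2 (real p) < real k + 1" using that unfolding g_def by auto
        have "2 powr real k \<le> real p" using k(1) p1 by (simp add: le_log_iff)
        moreover have "real p < 2 powr (real k + 1)" using k(2) p1 by (simp add: log_less_iff)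
        ultimately show ?thesis by (simp add: powr_add powr_realpow x_def)
      qed
      have h: "h p \<le> sqrt 2 / sqrt x * exp (l * s)" if pP: "p \<in> ?P" for p
        unfolding h_def
      proof (rule mult_mono)
        have p2: "(0::real) < 2 ^ k" "2 ^ k \<le> real p" "real p \<le> x" using p[OF pP] by auto
        have "real p powr (- (1/2)) \<le> (2 ^ k) powr (- (1/2))" using p2 by (intro powr_mono2') auto
        also have "\<dots> = 1 / sqrt (2 ^ k)"
          unfolding powr_minus powr_half_sqrt[OF less_imp_le[OF p2(1)]] by (rule inverse_eq_divide)
        also have "\<dots> = sqrt 2 / sqrt x" unfolding x_def by (simp add: real_sqrt_mult)
        finally show "real p powr (- (1/2)) \<le> sqrt 2 / sqrt x" .
        have "real p > 0" using p2 by linarith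
        then have "sqrt (ln (real p)) \<le> s" unfolding s_def using p2(3) by (intro real_sqrt_le_mono ln_mono)
        then show "exp (l * sqrt (ln (real p))) \<le> exp (l * s)" using l by (simp add: mult_left_mono)
      qed (use x1 in auto)
      have "(\<Sum>p\<in>?P. h p) \<le> real (card ?P) * (sqrt 2 / sqrt x * exp (l * s))"
        by (rule sum_bounded_above) (rule h)
      also have "\<dots> \<le> (K * (sqrt x * exp (- c * s))) * (sqrt 2 / sqrt x * exp (l * s))"
      proof (rule mult_right_mono)
        have "finite {p\<in>B. real p \<le> x}" by (rule finite_subset[OF _ finite_pos_le_real[of x]]) (use B in force)
        then have "card ?P \<le> card {p\<in>B. real p \<le> x}" using p by (intro card_mono) auto
        then show "real (card ?P) \<le> K * (sqrt x * exp (- c * s))" using card[OF x1] by (simp add: s_def)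
      qed (use x1 in auto)
      also have "\<dots> = K * sqrt 2 * exp (- c * s + l * s)" unfolding exp_add using x1 by simp
      also have "\<dots> \<le> K * 2 * exp (- (c / 2) * s)"
      proof (intro mult_mono mult_left_mono K)
        show "sqrt 2 \<le> (2::real)" by (rule real_le_lsqrt) auto
        have "l * s \<le> c / 2 * s" using l s0 by (intro mult_right_mono) auto
        then show "exp (- c * s + l * s) \<le> exp (- (c / 2) * s)" by simp
      qed (use K in auto)
      also have "- (c / 2) * s = - \<eta> * sqrt (real (Suc k))"
      proof -
        have "ln x = real (Suc k) * ln 2" unfolding x_def by (rule ln_realpow)
        then show ?thesis by (simp add: s_def \<eta>_def real_sqrt_mult del: of_nat_Suc)
      qed
      also have "K * 2 * exp (- \<eta> * sqrt (real (Suc k))) \<le> K * 2 * ((4 / \<eta>) ^ 4 * (1 / real (Suc k) ^ 2))"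
        using K by (intro mult_left_mono exp_minus_sqrt_le[OF \<eta>]) auto
      also have "\<dots> = a k" by (simp add: a_def)
      finally show "(\<Sum>p\<in>?P. h p) \<le> a k" .
    qed
    also have "\<dots> \<le> suminf a" by (rule sum_le_suminf[OF a]) (use fin a0 in auto)
    finally show ?thesis .
  qed
  then show ?thesis using that unfolding h_def by blast
qed

text \<open>An exceptional prime contributes at least 1 to the sum in the hypothesis: 2 if
  \<open>\<chi> p = - f p\<close>, and 1 if p divides q.\<close>

lemma card_bad_primes_le:
  assumes f: "resembles_moebius f" and \<chi>: "dirichlet_character q \<chi>" and real: "\<forall>n. \<chi> n \<in> \<real>"
    and O: "(\<lambda>x::real. \<Sum>p | prime p \<and> real p \<le> x. norm (1 - f p * \<chi> p))
           \<in> O(\<lambda>x. sqrt x / exp (c * sqrt (ln x)))"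
  obtains K where "K \<ge> 0"
    "\<And>x. x \<ge> 1 \<Longrightarrow> real (card {p\<in>{p. prime p \<and> f p \<noteq> \<chi> p}. real p \<le> x}) \<le> K * (sqrt x * exp (- c * sqrt (ln x)))"
proof -
  let ?B = "{p. prime p \<and> f p \<noteq> \<chi> p}"
  let ?W = "\<lambda>x. sqrt x * exp (- c * sqrt (ln x))"
  have card_le: "real (card {p\<in>?B. real p \<le> x}) \<le> (\<Sum>p | prime p \<and> real p \<le> x. norm (1 - f p * \<chi> p))" for x
  proof -
    have fin: "finite {p. prime p \<and> real p \<le> x}"
      by (rule finite_subset[OF _ finite_pos_le_real[of x]]) (auto simp: prime_gt_0_nat)
    have "real (card {p\<in>?B. real p \<le> x}) = (\<Sum>p\<in>{p\<in>?B. real p \<le> x}. 1)" by simp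
    also have "\<dots> \<le> (\<Sum>p\<in>{p\<in>?B. real p \<le> x}. norm (1 - f p * \<chi> p))"
    proof (rule sum_mono)
      fix p assume p: "p \<in> {p\<in>?B. real p \<le> x}"
      then have fp: "f p = 1 \<or> f p = -1" using f by (auto simp: resembles_moebius_def)
      have "\<chi> p = 0 \<or> \<chi> p = 1 \<or> \<chi> p = -1"
        using real_character_values[OF \<chi> real, of p] by (cases "coprime p q") auto
      then show "1 \<le> norm (1 - f p * \<chi> p)" using fp p by auto
    qed
    also have "\<dots> \<le> (\<Sum>p | prime p \<and> real p \<le> x. norm (1 - f p * \<chi> p))"
      by (rule sum_mono2[OF fin]) auto
    finally show ?thesis .
  qed
  obtain K0 where K0: "K0 > 0" and ev: "\<forall>\<^sub>F x in at_top. norm (\<Sum>p | prime p \<and> real p \<le> x. norm (1 - f p * \<chi> p))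
      \<le> K0 * norm (sqrt x / exp (c * sqrt (ln x)))"
    using landau_o.bigE[OF O] by blast
  obtain x0 where x0: "\<And>x. x \<ge> x0 \<Longrightarrow> norm (\<Sum>p | prime p \<and> real p \<le> x. norm (1 - f p * \<chi> p))
      \<le> K0 * norm (sqrt x / exp (c * sqrt (ln x)))"
    using ev unfolding eventually_at_top_linorder by blast
  \<comment> \<open>Below x0 the count is at most max 0 x0, and exp (c^2 / 2) times the weight is at
    least 1, because L^2 / 2 - c L + c^2 / 2 is half a square.\<close>
  define K where "K = K0 + max 0 x0 * exp (c\<^sup>2 / 2)"
  have "real (card {p\<in>?B. real p \<le> x}) \<le> K * ?W x" if x: "x \<ge> 1" for x
  proof (cases "x \<ge> x0")
    case True
    have "real (card {p\<in>?B. real p \<le> x}) \<le> K0 * norm (sqrt x / exp (c * sqrt (ln x)))"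
      using card_le[of x] x0[OF True] by simp
    also have "norm (sqrt x / exp (c * sqrt (ln x))) = ?W x" using x by (simp add: exp_minus divide_inverse)
    also have "K0 * ?W x \<le> K * ?W x" using x by (intro mult_right_mono) (auto simp: K_def)
    finally show ?thesis .
  next
    case False
    define L where "L = sqrt (ln x)"
    have L2: "ln x = L\<^sup>2" using x by (simp add: L_def)
    have sx: "sqrt x = exp (L\<^sup>2 / 2)"
    proof -
      have "exp (L\<^sup>2 / 2) ^ 2 = x" using x by (simp flip: exp_double add: L2[symmetric])
      then show ?thesis by (metis exp_ge_zero real_sqrt_unique)
    qed
    have "0 \<le> (L - c)\<^sup>2" by simp
    then have "0 \<le> c\<^sup>2 / 2 + (L\<^sup>2 / 2 + - c * L)" by (simp add: power2_eq_square algebra_simps)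
    then have "1 \<le> exp (c\<^sup>2 / 2) * ?W x" by (simp add: sx L_def[symmetric] flip: exp_add)
    have "card {p\<in>?B. real p \<le> x} \<le> card {n. n > 0 \<and> real n \<le> x}"
      by (intro card_mono) (auto simp: prime_gt_0_nat)
    then have "real (card {p\<in>?B. real p \<le> x}) \<le> x" using card_pos_le[of x] x by linarith
    also have "\<dots> \<le> max 0 x0 * 1" using False by simp
    also have "\<dots> \<le> max 0 x0 * (exp (c\<^sup>2 / 2) * ?W x)" by (intro mult_left_mono \<open>1 \<le> exp (c\<^sup>2 / 2) * ?W x\<close>) simp
    also have "\<dots> \<le> K * ?W x"
      using K0 x by (simp add: K_def distrib_right mult.assoc)
    finally show ?thesis .
  qed
  moreover have "K \<ge> 0"
    unfolding K_def using K0 by (intro add_nonneg_nonneg mult_nonneg_nonneg) auto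
  ultimately show ?thesis by (rule that[rotated])
qed

lemma resembles_moebius_bound:
  assumes f: "resembles_moebius f" and \<chi>: "dirichlet_character q \<chi>" and real: "\<forall>n. \<chi> n \<in> \<real>"
    and np: "\<chi> \<noteq> principal_character q" and c: "c > 0"
    and O: "(\<lambda>x::real. \<Sum>p | prime p \<and> real p \<le> x. norm (1 - f p * \<chi> p))
           \<in> O(\<lambda>x. sqrt x / exp (c * sqrt (ln x)))"
  obtains C l :: real where "C > 0" "l > 0"
    "\<And>x. x \<ge> 1 \<Longrightarrow> norm (summatory f x) \<le> C * (sqrt x * exp (- l * sqrt (ln x)))"
proof -
  let ?B = "{p. prime p \<and> f p \<noteq> \<chi> p}"
  obtain K where K: "K \<ge> 0"
    "\<And>x. x \<ge> 1 \<Longrightarrow> real (card {p\<in>?B. real p \<le> x}) \<le> K * (sqrt x * exp (- c * sqrt (ln x)))"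
    using card_bad_primes_le[OF f \<chi> real O] by blast
  obtain C0 c0 :: real where C0: "C0 > 0" "0 < c0" "c0 \<le> 1 / 8" and
    bd: "\<And>x. x \<ge> 1 \<Longrightarrow> norm (summatory (sqf_mult \<chi>) x) \<le> C0 * (sqrt x * exp (- c0 * sqrt (ln x)))"
    using summatory_sqf_character_bound[OF \<chi> real np] by blast
  \<comment> \<open>The bound c / 2 makes the sum of the \<theta> converge, and c0 keeps the new
    weight above the one known for \<chi>.\<close>
  define l where "l = min c0 (c / 2)"
  have l: "0 < l" "l \<le> 1 / 8" "l \<le> c / 2" "l \<le> c0" using C0 c by (auto simp: l_def)
  define \<theta> where "\<theta> p = real p powr (- (1/2)) * exp (l * sqrt (ln (real p)))" for p
  obtain A where A: "\<And>X. (\<Sum>p | p \<in> ?B \<and> real p \<le> X. \<theta> p) \<le> A"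
  proof -
    have "\<And>p. p \<in> ?B \<Longrightarrow> p \<ge> 1" using prime_ge_1_nat by blast
    note * = sum_sparse_set_bounded[OF this K(1) c less_imp_le[OF l(1)] l(3) K(2)]
    show ?thesis
    proof (rule *)
      fix A assume "\<And>X. (\<Sum>p | p \<in> ?B \<and> real p \<le> X. real p powr (- (1/2)) * exp (l * sqrt (ln (real p)))) \<le> A"
      then show thesis unfolding \<theta>_def[symmetric] by (rule that)
    qed
  qed
  define W where "W x = x powr (1/2) * exp (- l * sqrt (ln x))" for x :: real
  \<comment> \<open>The value \<open>f 0\<close> is arbitrary, while the change of primes wants a
    bound at every index.\<close>
  define b where "b p = (if prime p then f p else 0)" for p
  have bd': "norm (summatory f X) \<le> C0 * exp (20 * A) * (sqrt X * exp (- l * sqrt (ln X)))" if X: "X \<ge> 1" for X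
  proof -
    define P where "P = {p. p \<in> ?B \<and> real p \<le> X}"
    have prime: "prime p" if "p \<in> P" for p using that by (simp add: P_def)
    have fin: "finite P" unfolding P_def
      by (rule finite_subset[OF _ finite_pos_le_real[of X]]) (auto simp: prime_gt_0_nat)
    have \<theta>0: "0 \<le> \<theta> p" for p by (simp add: \<theta>_def)
    have \<theta>9: "\<theta> p \<le> 9 / 10" if "p \<in> P" for p
      unfolding \<theta>_def by (rule prime_powr_exp_le[OF prime[OF that] l(1,2)]) simp
    \<comment> \<open>An n <= X has only prime factors up to X, so the values at larger primes may
      be left as those of \<chi>.\<close>
    have eq: "summatory f X = summatory (sqf_mult (\<lambda>p. if p \<in> P then b p else \<chi> p)) X"
      unfolding summatory_def
    proof (rule sum.cong[OF refl])
      fix n assume n: "n \<in> {n. n > 0 \<and> real n \<le> X}"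
      show "f n = sqf_mult (\<lambda>p. if p \<in> P then b p else \<chi> p) n"
      proof (cases "squarefree n")
        case True
        have "f n = (\<Prod>p\<in>prime_factors n. f p)"
          using f True by (intro multiplicative_fun_squarefree) (auto simp: resembles_moebius_def)
        also have "\<dots> = (\<Prod>p\<in>prime_factors n. if p \<in> P then b p else \<chi> p)"
        proof (rule prod.cong[OF refl])
          fix p assume p: "p \<in> prime_factors n"
          then have "prime p" "p \<le> n" using n by (auto simp: in_prime_factors_iff dvd_imp_le)
          then show "f p = (if p \<in> P then b p else \<chi> p)" using n by (auto simp: P_def b_def)
        qed
        finally show ?thesis using True by (simp add: sqf_mult_def)
      next
        case False
        then show ?thesis using f n by (simp add: sqf_mult_def resembles_moebius_def)
      qed
    qed
    have "norm (summatory (sqf_mult (\<lambda>p. if p \<in> P then b p else \<chi> p)) X)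
        \<le> C0 * (\<Prod>p\<in>P. (1 + \<theta> p) / (1 - \<theta> p)) * W X"
    proof (rule summatory_sqf_mult_change_finite[where W = W])
      show "norm (b p) \<le> 1" for p using f by (auto simp: b_def resembles_moebius_def)
      show "norm (\<chi> p) \<le> 1" for p by (rule norm_character_le[OF \<chi>])
      show "W (x / real p) \<le> \<theta> p * W x" if "p \<in> P" "real p \<le> x" for p x
        unfolding W_def \<theta>_def using that l prime_ge_1_nat[OF prime[OF that(1)]]
        by (intro weight_divide_le) auto
      show "\<theta> p < 1" if "p \<in> P" for p using \<theta>9[OF that] by linarith
      show "norm (summatory (sqf_mult \<chi>) x) \<le> C0 * W x" if x: "x \<ge> 1" for x
      proof -
        have "l * sqrt (ln x) \<le> c0 * sqrt (ln x)" using l x by (intro mult_right_mono) auto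
        then have "C0 * (sqrt x * exp (- c0 * sqrt (ln x))) \<le> C0 * W x"
          unfolding W_def using C0 x by (simp add: powr_half_sqrt mult_left_mono)
        then show ?thesis using bd[OF x] by linarith
      qed
    qed (use fin prime \<theta>0 C0 X in \<open>auto simp: W_def\<close>)
    also have "\<dots> \<le> C0 * exp (20 * A) * W X"
    proof (intro mult_right_mono mult_left_mono)
      \<comment> \<open>(1 + \<theta>) / (1 - \<theta>) = 1 + 2 \<theta> / (1 - \<theta>), and
        \<theta> <= 9/10 makes this at most 1 + 20 \<theta>.\<close>
      have "(\<Prod>p\<in>P. (1 + \<theta> p) / (1 - \<theta> p)) \<le> (\<Prod>p\<in>P. exp (20 * \<theta> p))"
      proof (rule prod_mono, intro conjI)
        fix p assume p: "p \<in> P"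
        show "0 \<le> (1 + \<theta> p) / (1 - \<theta> p)" using \<theta>9[OF p] \<theta>0[of p] by simp
        have "\<theta> p * \<theta> p \<le> \<theta> p * (9 / 10)" using \<theta>9[OF p] \<theta>0 by (intro mult_left_mono) auto
        then have "1 + \<theta> p \<le> (1 + 20 * \<theta> p) * (1 - \<theta> p)" using \<theta>0[of p] by (simp add: algebra_simps)
        then have "(1 + \<theta> p) / (1 - \<theta> p) \<le> 1 + 20 * \<theta> p" using \<theta>9[OF p] by (simp add: field_simps)
        also have "\<dots> \<le> exp (20 * \<theta> p)" by (rule exp_ge_add_one_self)
        finally show "(1 + \<theta> p) / (1 - \<theta> p) \<le> exp (20 * \<theta> p)" .
      qed
      also have "\<dots> = exp (20 * (\<Sum>p\<in>P. \<theta> p))" using fin by (simp add: exp_sum sum_distrib_left)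
      also have "\<dots> \<le> exp (20 * A)" using A[of X] by (simp add: P_def)
      finally show "(\<Prod>p\<in>P. (1 + \<theta> p) / (1 - \<theta> p)) \<le> exp (20 * A)" .
    qed (use C0 in \<open>auto simp: W_def\<close>)
    finally show ?thesis unfolding eq W_def using X by (simp add: powr_half_sqrt)
  qed
  have "C0 * exp (20 * A) > 0" using C0 by simp
  then show ?thesis using l(1) bd' by (rule that)
qed

theorem theorem1p2:
  fixes f \<chi> :: "nat \<Rightarrow> complex" and q :: nat and c :: real
  assumes "resembles_moebius f"
    and "dirichlet_character q \<chi>"
    and "\<forall>n. \<chi> n \<in> \<real>"
    and "\<chi> \<noteq> principal_character q"
    and "c > 0"
    and "(\<lambda>x::real. \<Sum>p | prime p \<and> real p \<le> x. norm (1 - f p * \<chi> p))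
           \<in> O(\<lambda>x. sqrt x / exp (c * sqrt (ln x)))"
  shows "\<exists>l>0. (\<lambda>x::real. norm (summatory f x))
           \<in> O(\<lambda>x. sqrt x / exp (l * ln x powr (1 / 4)))"
proof -
  obtain C l :: real where C: "C > 0" "l > 0" and
    bd: "\<And>x. x \<ge> 1 \<Longrightarrow> norm (summatory f x) \<le> C * (sqrt x * exp (- l * sqrt (ln x)))"
    using resembles_moebius_bound[OF assms] by blast
  \<comment> \<open>From exp 1 on, ln x >= 1, so its fourth root is at most its square root and the
    stronger bound implies the stated one.\<close>
  have le: "norm (norm (summatory f x)) \<le> C * norm (sqrt x / exp (l * ln x powr (1 / 4)))" if x: "x \<ge> exp 1" for x
  proof -
    have x1: "x \<ge> 1" using x exp_ge_add_one_self[of 1] by linarith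
    then have "ln x \<ge> 1" using x by (simp add: ln_ge_iff)
    then have "ln x powr (1 / 4) \<le> ln x powr (1 / 2)" by (intro powr_mono) auto
    also have "\<dots> = sqrt (ln x)" using x1 by (simp add: powr_half_sqrt)
    finally have "l * ln x powr (1 / 4) \<le> l * sqrt (ln x)" using C by (intro mult_left_mono) auto
    then have "C * (sqrt x * exp (- l * sqrt (ln x))) \<le> C * (sqrt x * exp (- (l * ln x powr (1 / 4))))"
      using C x1 by (intro mult_left_mono) auto
    also have "sqrt x * exp (- (l * ln x powr (1 / 4))) = norm (sqrt x / exp (l * ln x powr (1 / 4)))"
    proof -
      have "sqrt x * exp (- y) = norm (sqrt x / exp y)" for y :: real
        using x1 by (simp add: exp_minus divide_inverse)
      then show ?thesis .
    qed
    finally have "C * (sqrt x * exp (- l * sqrt (ln x))) \<le> C * norm (sqrt x / exp (l * ln x powr (1 / 4)))" .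
    with bd[OF x1] have "norm (summatory f x) \<le> C * norm (sqrt x / exp (l * ln x powr (1 / 4)))"
      by (rule order.trans)
    then show ?thesis by (simp only: real_norm_def abs_norm_cancel)
  qed
  have "(\<lambda>x::real. norm (summatory f x)) \<in> O(\<lambda>x. sqrt x / exp (l * ln x powr (1 / 4)))"
  proof (rule bigoI[where c = C])
    show "\<forall>\<^sub>F x in at_top. norm (norm (summatory f x)) \<le> C * norm (sqrt x / exp (l * ln x powr (1 / 4)))"
      by (rule eventually_mono[OF eventually_ge_at_top[of "exp 1"]]) (rule le)
  qed
  with C show ?thesis by blast
qed

end
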